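(* Let $M^{+}$ and $M^{-}$ be smooth $n$-dimensional manifolds, let $\mu^{+}$ and $\mu^{-}$ be Borel probability measures on $M^{+}$ and $M^{-}$ respectively, and let $c\in C^{2}(M^{+}\times M^{-})$ be a real-valued cost. Assume that the cost $c$ is non-degenerate (at every point of $M^{+}\times M^{-}$) and that an optimizer $\gamma$ of the Kantorovich problem with cost $c$ and marginals $\mu^{+},\mu^{-}$ is supported on the graph of some function $T:\operatorname{dom}(T)\to M^{-}$ which is injective and continuous when restricted to a set $\operatorname{dom}(T)\subseteq M^{+}$ of full Lebesgue measure. Suppose that the marginals are absolutely continuous with respect to volume, and set $d\mu^{+}=f^{+}(x)\,dx$ and $d\mu^{-}=f^{-}(y)\,dy$. Then, for almost every $x$, $$f^{+}(x)=|\det DT(x)|\,f^{-}(T(x)).$$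
   Context: Kantorovich problem: given Borel probability measures $\mu^{\pm}$ on $M^{\pm}$ and a cost $c:M^{+}\times M^{-}\to\mathbf{R}$, minimize $\int_{M^{+}\times M^{-}} c(x,y)\,d\gamma(x,y)$ among all measures $\gamma$ on $M^{+}\times M^{-}$ whose marginals are $\mu^{+}$ and $\mu^{-}$, i.e. $\gamma(A\times M^{-})=\mu^{+}(A)$ and $\gamma(M^{+}\times B)=\mu^{-}(B)$ for all Borel $A\subset M^{+}$, $B\subset M^{-}$. An optimizer is a minimizer. $D^{2}_{xy}c(x_0,y_0)$ denotes the $n\times n$ matrix of mixed second order partial derivatives of $c$ at $(x_0,y_0)$ in local coordinates, with $(i,j)$ entry $\frac{\partial^{2}c}{\partial x^{i}\partial y^{j}}(x_0,y_0)$. A cost $c\in C^{2}(M^{+}\times M^{-})$ is non-degenerate at $(x_0,y_0)$ if $\det D^{2}_{xy}c(x_0,y_0)\neq 0$. "Supported on the graph of $T$" means that $\gamma$ is concentrated on $\{(x,T(x)):x\in\operatorname{dom}(T)\}$, i.e. this graph carries full $\gamma$-measure. Continuity of $T$ is only required relative to $\operatorname{dom}(T)$, not outside it. Here $dx$ and $dy$ denote volume (Lebesgue measure) on $M^{+}$ and $M^{-}$, $DT(x)$ is the derivative of $T$ at $x$ (relative to $\operatorname{dom}(T)$), its determinant is taken relative to these volumes, and "almost every" refers to volume on $M^{+}$.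
   Formalization: DT(x) need not exist a.e. as stated; formally, for a.e. x the equation holds wherever DT(x) relative to dom(T) exists, and for x in spt μ⁺ the derivative of T relative to dom(T)∩spt μ⁺ exists and satisfies it. The optimizer is assumed to have finite cost. *)

theory Defs
  imports "HOL-Analysis.Analysis"
begin

text \<open>
  Continuous differentiability of order k on an open set, by recursion on the order. On the
  finite-dimensional spaces used here, continuity of all iterated directional derivatives is
  the usual notion.
\<close>

primrec Ck_on :: "nat \<Rightarrow> 'a::real_normed_vector set \<Rightarrow> ('a \<Rightarrow> 'b::real_normed_vector) \<Rightarrow> bool" where
  "Ck_on 0 S f \<longleftrightarrow> continuous_on S f"
| "Ck_on (Suc k) S f \<longleftrightarrow>
     (\<forall>x\<in>S. f differentiable (at x)) \<and> (\<forall>v. Ck_on k S (\<lambda>x. frechet_derivative f (at x) v))"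

definition smooth_on :: "'a::real_normed_vector set \<Rightarrow> ('a \<Rightarrow> 'b::real_normed_vector) \<Rightarrow> bool" where
  "smooth_on S f \<longleftrightarrow> (\<forall>k. Ck_on k S f)"

text \<open>
  A manifold is a whole type, Hausdorff and second countable by its type classes, together with
  a (not necessarily maximal) smooth atlas. A chart is a pair of an open domain and a
  coordinate map, whose values outside the domain are irrelevant; the inverse of the chart
  \<open>(U, p)\<close> is \<open>inv_into U p\<close>.
\<close>

type_synonym ('a, 'n) chart = "'a set \<times> ('a \<Rightarrow> real^'n)"

definition is_chart :: "('a::topological_space, 'n::finite) chart \<Rightarrow> bool" where
  "is_chart = (\<lambda>(U, p). open U \<and> open (p ` U) \<and> homeomorphism U (p ` U) p (inv_into U p))"

definition smooth_atlas ::
    "('a::{t2_space, second_countable_topology}, 'n::finite) chart set \<Rightarrow> bool" where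
  "smooth_atlas \<A> \<longleftrightarrow>
     (\<forall>ch\<in>\<A>. is_chart ch) \<and>
     (\<Union>(U, p)\<in>\<A>. U) = UNIV \<and>
     (\<forall>(U, p)\<in>\<A>. \<forall>(V, q)\<in>\<A>. smooth_on (p ` (U \<inter> V)) (q \<circ> inv_into U p))"

text \<open>
  A volume is a Borel measure which in every chart has a smooth positive density with respect
  to Lebesgue measure (for a Riemannian volume: the square root of the determinant of the metric).
  Being continuous, the density is determined on the image of the chart by the measure.
\<close>

definition volume_density ::
    "'a::topological_space measure \<Rightarrow> ('a, 'n::finite) chart \<Rightarrow> (real^'n \<Rightarrow> real) \<Rightarrow> bool" where
  "volume_density vol = (\<lambda>(U, p) \<rho>.
     smooth_on (p ` U) \<rho> \<and> (\<forall>u\<in>p ` U. 0 < \<rho> u) \<and>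
     (\<forall>B\<in>sets borel. B \<subseteq> U \<longrightarrow>
        emeasure vol B = (\<integral>\<^sup>+ u. ennreal (\<rho> u) * indicator (p ` B) u \<partial>lborel)))"

definition smooth_volume ::
    "('a::{t2_space, second_countable_topology}, 'n::finite) chart set \<Rightarrow> 'a measure \<Rightarrow> bool" where
  "smooth_volume \<A> vol \<longleftrightarrow>
     sets vol = sets borel \<and> (\<forall>ch\<in>\<A>. \<exists>\<rho>. volume_density vol ch \<rho>)"

definition local_cost ::
    "('a \<times> 'b \<Rightarrow> real) \<Rightarrow> ('a, 'n::finite) chart \<Rightarrow> ('b, 'n) chart \<Rightarrow> (real^'n) \<times> (real^'n) \<Rightarrow> real" where
  "local_cost c = (\<lambda>(U, p) (V, q) (u, v). c (inv_into U p u, inv_into V q v))"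

definition C2_cost ::
    "('a, 'n::finite) chart set \<Rightarrow> ('b, 'n) chart set \<Rightarrow> ('a \<times> 'b \<Rightarrow> real) \<Rightarrow> bool" where
  "C2_cost \<A> \<B> c \<longleftrightarrow>
     (\<forall>(U, p)\<in>\<A>. \<forall>(V, q)\<in>\<B>. Ck_on 2 (p ` U \<times> q ` V) (local_cost c (U, p) (V, q)))"

text \<open>The (i, j) entry is the second partial derivative in the i-th coordinate of the first
  and the j-th coordinate of the second argument.\<close>

definition mixed_hessian ::
    "((real^'n::finite) \<times> (real^'n) \<Rightarrow> real) \<Rightarrow> real^'n \<Rightarrow> real^'n \<Rightarrow> real^'n^'n" where
  "mixed_hessian C u v =
     (\<chi> i j. deriv (\<lambda>s. deriv (\<lambda>t. C (u + s *\<^sub>R axis i 1, v + t *\<^sub>R axis j 1)) 0) 0)"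

definition nondegenerate_at ::
    "('a, 'n::finite) chart set \<Rightarrow> ('b, 'n) chart set \<Rightarrow> ('a \<times> 'b \<Rightarrow> real) \<Rightarrow> 'a \<Rightarrow> 'b \<Rightarrow> bool" where
  "nondegenerate_at \<A> \<B> c x y \<longleftrightarrow>
     (\<forall>(U, p)\<in>\<A>. \<forall>(V, q)\<in>\<B>. x \<in> U \<longrightarrow> y \<in> V \<longrightarrow>
        det (mixed_hessian (local_cost c (U, p) (V, q)) (p x) (q y)) \<noteq> 0)"

definition borel_probability :: "'a::topological_space measure \<Rightarrow> bool" where
  "borel_probability \<mu> \<longleftrightarrow> sets \<mu> = sets borel \<and> emeasure \<mu> UNIV = 1"

definition coupling ::
    "'a::topological_space measure \<Rightarrow> 'b::topological_space measure \<Rightarrow> ('a \<times> 'b) measure \<Rightarrow> bool" where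
  "coupling \<mu> \<nu> \<gamma> \<longleftrightarrow>
     sets \<gamma> = sets borel \<and>
     (\<forall>A\<in>sets borel. emeasure \<gamma> (A \<times> UNIV) = emeasure \<mu> A) \<and>
     (\<forall>B\<in>sets borel. emeasure \<gamma> (UNIV \<times> B) = emeasure \<nu> B)"

text \<open>
  The minimum is required to be finite: if every coupling had infinite cost, each of them
  would be a minimizer. Integrability has to be stated because the Bochner integral
  of a non-integrable function is 0. Only competitors of finite cost are compared, which asks
  no more of the optimizer than a comparison with all couplings.
\<close>

definition kantorovich_optimizer ::
    "'a::topological_space measure \<Rightarrow> 'b::topological_space measure \<Rightarrow>
     ('a \<times> 'b \<Rightarrow> real) \<Rightarrow> ('a \<times> 'b) measure \<Rightarrow> bool" where
  "kantorovich_optimizer \<mu> \<nu> c \<gamma> \<longleftrightarrow>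
     coupling \<mu> \<nu> \<gamma> \<and> integrable \<gamma> c \<and>
     (\<forall>\<gamma>'. coupling \<mu> \<nu> \<gamma>' \<longrightarrow> integrable \<gamma>' c \<longrightarrow>
        integral\<^sup>L \<gamma> c \<le> integral\<^sup>L \<gamma>' c)"

text \<open>
  The support enters the theorem because the transport problem says nothing about T off the
  support of the source measure, and T may be wild there. For example, let both marginals be uniform
  on K x [0, 1] in the plane, for a fat Cantor set K with k-th stage gaps of length
  proportional to 4 to the power -k, let the cost be half the squared distance, and let
  T (a, b) = (a, b + dist(a, K) to the power 1/4). This homeomorphism of the plane is
  the identity on K x [0, 1], hence optimal, but it has no derivative relative to the
  plane at any point of K x [0, 1]. Relative to the support its derivative is the identity
  there almost everywhere.
\<close>

definition measure_support :: "'a::topological_space measure \<Rightarrow> 'a set" where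
  "measure_support \<mu> = {x. \<forall>U. open U \<longrightarrow> x \<in> U \<longrightarrow> 0 < emeasure \<mu> U}"

text \<open>
  T is differentiable at x relative to S, and J is the absolute value of the determinant of its
  derivative, taken relative to the volumes: the determinant M of the derivative in coordinates is
  corrected by the densities of the volumes in these coordinates. By the chain rule
  the choice of the charts is immaterial.
\<close>

definition has_jacobian_within ::
    "('a::{t2_space, second_countable_topology}, 'n::finite) chart set \<Rightarrow> 'a measure \<Rightarrow>
     ('b::{t2_space, second_countable_topology}, 'n) chart set \<Rightarrow> 'b measure \<Rightarrow>
     ('a \<Rightarrow> 'b) \<Rightarrow> 'a \<Rightarrow> 'a set \<Rightarrow> real \<Rightarrow> bool" where
  "has_jacobian_within \<A> vol \<B> vol' T x S J \<longleftrightarrow>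
     (T \<longlongrightarrow> T x) (at x within S) \<and>
     (\<exists>(U, p)\<in>\<A>. \<exists>(V, q)\<in>\<B>. \<exists>M \<rho> \<sigma>.
        x \<in> U \<and> T x \<in> V \<and>
        volume_density vol (U, p) \<rho> \<and> volume_density vol' (V, q) \<sigma> \<and>
        ((q \<circ> T \<circ> inv_into U p) has_derivative (\<lambda>h. M *v h))
          (at (p x) within p ` {z \<in> S. z \<in> U \<and> T z \<in> V}) \<and>
        J = \<bar>det M\<bar> * \<sigma> (q (T x)) / \<rho> (p x))"

end

theory Submission imports Defs
begin

text \<open>
  Exchanging the targets of two points of the support of an optimizer cannot lower the cost. In
  coordinates, since the matrix of mixed derivatives is invertible, this makes the graph of the map
  over the support locally a monotone graph up to a linear change of variables, hence the image of
  a subset of the Euclidean space under a Lipschitz map. By Rademacher's and Sard's theorems the map is then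
  differentiable almost everywhere relative to the support. Independently of the cost, the
  Jacobian equation holds almost everywhere on the set of differentiability: there the map is
  injective and carries \<open>f\<^sup>+ dx\<close> to \<open>f\<^sup>- dy\<close>, so that the change of variables formula gives
  \<open>f\<^sup>+ = \<bar>det DT\<bar> f\<^sup>- \<circ> T\<close> after integration over every compact subset.
\<close>


section \<open>Change of variables without an order on the index type\<close>

text \<open>Monotonicity of the graph does not bound the difference quotients of the map, because a
  monotone graph may become vertical. This is why the graph is parametrized by a mixed coordinate,
  as in Minty's parametrization of monotone maps: both coordinates become controlled, at the price
  that the parametrization may have a singular derivative, and the points where this happens must be
  shown to form a null set in the original coordinate. The set \<open>domT\<close> is only known to
  be conull and the map only to be continuous on it, so the transport identity is tested on compact
  sets, whose images are compact and hence Borel. Derivatives relative to an arbitrary set need not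
  be unique; the notion \<open>full_at\<close> restores uniqueness at almost every point, and it
  makes the set of differentiability measurable. One covering argument, which compares two measures
  on small balls, yields both the density points and the differentiation of monotone functions of
  one variable. The transition law of the volume densities is itself obtained from the Jacobian
  equation, applied to the identity map.\<close>

text \<open>The change of variables theorem and Sard's theorem are available for well-ordered index
  types only; an order is therefore put on a copy of the index type.\<close>

typedef 'n wo = "UNIV :: 'n set" morphisms of_wo to_wo ..

lemma bij_to_wo: "bij (to_wo :: 'n \<Rightarrow> 'n wo)"
  by (metis bijI' of_wo_inverse to_wo_inverse UNIV_I)

instance wo :: (finite) finite
proof
  show "finite (UNIV :: 'a wo set)"
    using bij_to_wo[where 'n='a] by (metis bij_betw_finite finite)
qed

instantiation wo :: (finite) wellorder
begin

definition less_eq_wo :: "'a wo \<Rightarrow> 'a wo \<Rightarrow> bool"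
  where "less_eq_wo x y \<longleftrightarrow> to_nat (of_wo x) \<le> to_nat (of_wo y)"

definition less_wo :: "'a wo \<Rightarrow> 'a wo \<Rightarrow> bool"
  where "less_wo x y \<longleftrightarrow> to_nat (of_wo x) < to_nat (of_wo y)"

instance
proof
  fix P :: "'a wo \<Rightarrow> bool" and a
  assume step: "\<And>x. (\<And>y. y < x \<Longrightarrow> P y) \<Longrightarrow> P x"
  show "P a"
    by (induction a rule: measure_induct_rule[of "\<lambda>x. to_nat (of_wo x)"])
      (rule step, simp add: less_wo_def)
qed (auto simp: less_eq_wo_def less_wo_def of_wo_inject)

end

section \<open>Vectors, Lebesgue measure and determinants under relabelling of the indices\<close>

definition vec_wo :: "'a^'n \<Rightarrow> 'a^('n wo)"
  where "vec_wo x = (\<chi> i. x $ of_wo i)"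

definition wo_vec :: "'a^('n wo) \<Rightarrow> 'a^'n"
  where "wo_vec x = (\<chi> i. x $ to_wo i)"

lemma wo_vec_vec_wo [simp]: "wo_vec (vec_wo x) = x"
  by (simp add: vec_wo_def wo_vec_def vec_eq_iff to_wo_inverse)

lemma vec_wo_wo_vec [simp]: "vec_wo (wo_vec x) = x"
  by (simp add: vec_wo_def wo_vec_def vec_eq_iff of_wo_inverse)

lemma wo_vec_image_vec_wo [simp]: "wo_vec ` vec_wo ` A = A"
  by (simp add: image_image)

lemma inj_vec_wo: "inj vec_wo" and inj_wo_vec: "inj wo_vec"
  by (metis injI wo_vec_vec_wo) (metis injI vec_wo_wo_vec)

lemma sum_wo: "(\<Sum>i\<in>UNIV. f (of_wo i)) = (\<Sum>i\<in>(UNIV::'n::finite set). f i)"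
  by (rule sum.reindex_bij_witness[of _ to_wo of_wo]) (auto simp: of_wo_inverse to_wo_inverse)

lemma bounded_linear_vec_wo: "bounded_linear (vec_wo :: real^'n::finite \<Rightarrow> _)"
  by (intro linear_conv_bounded_linear[THEN iffD1] linearI) (auto simp: vec_wo_def vec_eq_iff)

lemma bounded_linear_wo_vec: "bounded_linear (wo_vec :: _ \<Rightarrow> real^'n::finite)"
  by (intro linear_conv_bounded_linear[THEN iffD1] linearI) (auto simp: wo_vec_def vec_eq_iff)

lemma inner_vec_wo: "vec_wo x \<bullet> vec_wo y = x \<bullet> (y :: real^'n::finite)"
  by (simp add: vec_wo_def inner_vec_def sum_wo[of "\<lambda>i. x $ i * y $ i"])

lemma norm_vec_wo [simp]: "norm (vec_wo (x :: real^'n::finite)) = norm x"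
  by (simp add: norm_eq_sqrt_inner inner_vec_wo)

lemma norm_wo_vec [simp]: "norm (wo_vec x :: real^'n::finite) = norm x"
  by (metis norm_vec_wo vec_wo_wo_vec)

lemma vec_wo_box: "vec_wo -` box l u = box (wo_vec l) (wo_vec u :: real^'n::finite)"
proof (intro set_eqI)
  fix x :: "real^'n"
  have "(\<forall>i. l $ i < vec_wo x $ i \<and> vec_wo x $ i < u $ i) \<longleftrightarrow>
        (\<forall>i. wo_vec l $ i < x $ i \<and> x $ i < wo_vec u $ i)"
    by (simp add: vec_wo_def wo_vec_def) (metis of_wo_inverse to_wo_inverse UNIV_I)
  then show "x \<in> vec_wo -` box l u \<longleftrightarrow> x \<in> box (wo_vec l) (wo_vec u)"
    by (simp add: mem_box_cart)
qed

text \<open>Lebesgue measure is determined by its values on boxes, and relabelling the coordinates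
  only permutes the side lengths of a box.\<close>

lemma lborel_vec_wo: "distr lborel borel (vec_wo :: real^'n::finite \<Rightarrow> _) = lborel"
proof (rule lborel_eqI[symmetric])
  have meas: "vec_wo \<in> borel_measurable (borel :: (real^'n) measure)"
    by (intro borel_measurable_continuous_onI linear_continuous_on bounded_linear_vec_wo)
  fix l u :: "real^('n wo)"
  assume lu: "\<And>b. b \<in> Basis \<Longrightarrow> l \<bullet> b \<le> u \<bullet> b"
  have le: "l $ i \<le> u $ i" for i
    using lu[of "axis i 1"] by (simp add: inner_axis)
  have "emeasure (distr lborel borel vec_wo) (box l u) =
        emeasure lborel (box (wo_vec l) (wo_vec u :: real^'n))"
    using meas by (subst emeasure_distr) (auto simp: vec_wo_box)
  also have "\<dots> = (\<Prod>i\<in>Basis. (wo_vec u - wo_vec l :: real^'n) \<bullet> i)"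
    using le by (intro emeasure_lborel_box) (auto simp: Basis_vec_def inner_axis wo_vec_def)
  also have "(\<Prod>i\<in>Basis. (wo_vec u - wo_vec l :: real^'n) \<bullet> i) = (\<Prod>i\<in>UNIV. (u - l) $ to_wo i)"
    by (rule prod.reindex_bij_witness[of _ "\<lambda>i. axis i 1" "\<lambda>b. THE i. b = axis i 1"])
      (auto simp: Basis_vec_def axis_eq_axis inner_axis wo_vec_def)
  also have "\<dots> = (\<Prod>i\<in>UNIV. (u - l) $ i)"
    by (rule prod.reindex_bij_witness[of _ of_wo to_wo]) (auto simp: of_wo_inverse to_wo_inverse)
  also have "\<dots> = (\<Prod>b\<in>Basis. (u - l) \<bullet> b)"
    by (rule prod.reindex_bij_witness[of _ "\<lambda>b. THE i. b = axis i 1" "\<lambda>i. axis i 1"])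
      (auto simp: Basis_vec_def axis_eq_axis inner_axis)
  finally show "emeasure (distr lborel borel (vec_wo :: real^'n \<Rightarrow> _)) (box l u) = (\<Prod>b\<in>Basis. (u - l) \<bullet> b)" .
qed simp

lemma lborel_wo_vec: "distr lborel borel (wo_vec :: _ \<Rightarrow> real^'n::finite) = lborel"
proof -
  have m: "vec_wo \<in> borel_measurable (borel :: (real^'n) measure)"
       "wo_vec \<in> measurable borel (borel :: (real^'n) measure)"
    by (intro borel_measurable_continuous_onI linear_continuous_on bounded_linear_vec_wo bounded_linear_wo_vec)+
  have "distr lborel borel (wo_vec :: _ \<Rightarrow> real^'n) = distr (distr lborel borel (vec_wo :: real^'n \<Rightarrow> _)) borel wo_vec"
    by (simp add: lborel_vec_wo)
  also have "\<dots> = distr lborel borel (\<lambda>x. x)"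
    using m by (subst distr_distr) (auto simp: o_def)
  also have "\<dots> = lborel"
    by (rule distr_id2) simp
  finally show ?thesis .
qed


text \<open>A map that preserves Borel Lebesgue measure pulls null sets back to null sets, so it
  stays measurable and measure preserving after completion.\<close>

lemma completion_distr_lborel:
  fixes T :: "'a::euclidean_space \<Rightarrow> 'b::euclidean_space"
  assumes T: "T \<in> borel_measurable borel" and eq: "distr lborel borel T = lborel"
  shows "distr lebesgue lebesgue T = lebesgue" and "T \<in> lebesgue \<rightarrow>\<^sub>M lebesgue"
proof -
  have d: "distr lebesgue lborel T = lborel"
    using T eq by (simp add: distr_completion cong: distr_cong)
  have T': "T \<in> lebesgue \<rightarrow>\<^sub>M lborel"
    using T by (simp add: measurable_completion)
  show "T \<in> lebesgue \<rightarrow>\<^sub>M lebesgue"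
    by (rule completion.measurable_completion2[OF T']) (simp add: d)
  show "distr lebesgue lebesgue T = lebesgue"
    using completion.completion_distr_eq[OF T'] d by simp
qed

text \<open>By injectivity the indicator of the image pulls back to the indicator of
  \<open>S\<close>, so the rule for integrals against an image measure applies to the cut-off
  integrand.\<close>

lemma absolutely_integrable_on_distr_inj:
  fixes T :: "'a::euclidean_space \<Rightarrow> 'b::euclidean_space" and f :: "'b \<Rightarrow> real"
  assumes T: "T \<in> lebesgue \<rightarrow>\<^sub>M lebesgue" and eq: "distr lebesgue lebesgue T = lebesgue"
    and inj: "inj T" and int: "f absolutely_integrable_on (T ` S)"
  shows "(\<lambda>x. f (T x)) absolutely_integrable_on S \<and> integral S (\<lambda>x. f (T x)) = integral (T ` S) f"
proof -
  have ind: "indicator (T ` S) (T x) = (indicator S x :: real)" for x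
    using inj by (auto simp: indicator_def inj_def)
  have i: "integrable (distr lebesgue lebesgue T) (\<lambda>x. indicator (T ` S) x *\<^sub>R f x)"
    using int by (simp add: eq set_integrable_def)
  have "integrable lebesgue (\<lambda>x. indicator (T ` S) (T x) *\<^sub>R f (T x))"
    by (rule integrable_distr[OF T i])
  then have ai: "(\<lambda>x. f (T x)) absolutely_integrable_on S"
    by (simp add: ind set_integrable_def)
  have "(LINT x|lebesgue. indicator S x *\<^sub>R f (T x)) =
        integral\<^sup>L (distr lebesgue lebesgue T) (\<lambda>x. indicator (T ` S) x *\<^sub>R f x)"
    using i by (subst integral_distr[OF T]) (auto simp: ind)
  then have "(LINT x:S|lebesgue. f (T x)) = (LINT x:T ` S|lebesgue. f x)"
    by (simp add: eq set_lebesgue_integral_def)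
  with ai int show ?thesis
    by (simp add: set_lebesgue_integral_eq_integral)
qed

lemmas vec_wo_lebesgue =
  completion_distr_lborel[OF borel_measurable_continuous_onI[OF linear_continuous_on[OF bounded_linear_vec_wo]] lborel_vec_wo]

lemmas wo_vec_lebesgue =
  completion_distr_lborel[OF borel_measurable_continuous_onI[OF linear_continuous_on[OF bounded_linear_wo_vec]] lborel_wo_vec]

text \<open>Conjugation by the relabelling matches the permutations of the two index types and keeps
  their signs, so the Leibniz sums agree term by term.\<close>

lemma det_wo: "det (\<chi> i j. A $ of_wo i $ of_wo j) = det (A :: real^'n::finite^'n)"
proof -
  let ?m = "map_permutation UNIV (of_wo :: 'n wo \<Rightarrow> 'n)"
  have bij: "bij (of_wo :: 'n wo \<Rightarrow> 'n)"
    by (metis bijI' of_wo_inject to_wo_inverse UNIV_I)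
  have inv: "inv_into UNIV (of_wo :: 'n wo \<Rightarrow> 'n) = to_wo"
    by (rule inv_equality) (auto simp: of_wo_inverse to_wo_inverse)
  have m: "?m p i = of_wo (p (to_wo i))" for p i
    using bij by (simp add: map_permutation_def restrict_id_def inv bij_is_surj)
  have "det (\<chi> i j. A $ of_wo i $ of_wo j) =
    (\<Sum>p | p permutes (UNIV::'n wo set). of_int (sign p) * (\<Prod>i\<in>UNIV. A $ of_wo i $ of_wo (p i)))"
    by (simp add: det_def)
  also have "\<dots> = (\<Sum>p | p permutes (UNIV::'n set). of_int (sign p) * (\<Prod>i\<in>UNIV. A $ i $ p i))"
  proof (rule sum.reindex_bij_witness[of _ "\<lambda>p i. to_wo (p (of_wo i))" ?m])
    fix p :: "'n wo \<Rightarrow> 'n wo" assume "p \<in> {p. p permutes UNIV}"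
    then have p: "p permutes UNIV" by simp
    then show "?m p \<in> {p. p permutes UNIV}"
      using map_permutation_permutes[OF bij] by simp
    show "(\<lambda>i. to_wo (?m p (of_wo i))) = p"
      by (simp add: m of_wo_inverse)
    have "sign (?m p) = sign p"
      using p bij by (intro sign_map_permutation) (auto simp: bij_is_inj)
    moreover have "(\<Prod>i\<in>UNIV. A $ i $ ?m p i) = (\<Prod>i\<in>UNIV. A $ of_wo i $ of_wo (p i))"
      unfolding m
      by (rule prod.reindex_bij_witness[of _ of_wo to_wo]) (auto simp: of_wo_inverse to_wo_inverse)
    ultimately show "of_int (sign (?m p)) * (\<Prod>i\<in>UNIV. A $ i $ ?m p i) =
        of_int (sign p) * (\<Prod>i\<in>UNIV. A $ of_wo i $ of_wo (p i))"
      by simp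
  next
    fix p :: "'n \<Rightarrow> 'n" assume "p \<in> {p. p permutes UNIV}"
    then have "bij p" by (simp add: permutes_bij)
    then have "bij (inv of_wo \<circ> p \<circ> of_wo)"
      using bij by (intro bij_comp bij_imp_bij_inv) auto
    then show "(\<lambda>i. to_wo (p (of_wo i))) \<in> {p. p permutes UNIV}"
      by (auto simp: inv o_def intro: bij_imp_permutes)
    show "?m (\<lambda>i. to_wo (p (of_wo i))) = p"
      by (simp add: m to_wo_inverse fun_eq_iff)
  qed
  finally show ?thesis by (simp add: det_def)
qed

section \<open>Change of variables and Sard's theorem for every finite index type\<close>

lemma has_derivative_vec_wo_conj:
  fixes g :: "real^'n::finite \<Rightarrow> real^'n"
  assumes "(g has_derivative (*v) M) (at (wo_vec x) within wo_vec ` S)"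
  shows "((\<lambda>x. vec_wo (g (wo_vec x))) has_derivative (*v) (\<chi> i j. M $ of_wo i $ of_wo j)) (at x within S)"
proof -
  have Mv: "(\<chi> i j. M $ of_wo i $ of_wo j) *v h = vec_wo (M *v wo_vec h)" for h
    by (simp add: vec_eq_iff matrix_vector_mult_def vec_wo_def wo_vec_def
        flip: sum_wo[of "\<lambda>j. M $ of_wo _ $ j * h $ to_wo j"])
      (simp add: of_wo_inverse)
  have "(wo_vec has_derivative wo_vec) (at x within S)"
    by (rule bounded_linear_imp_has_derivative[OF bounded_linear_wo_vec])
  from has_derivative_in_compose[OF this assms]
  have "((\<lambda>x. vec_wo (g (wo_vec x))) has_derivative (\<lambda>h. vec_wo (M *v wo_vec h))) (at x within S)"
    by (rule bounded_linear.has_derivative[OF bounded_linear_vec_wo])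
  then show ?thesis
    by (simp add: Mv[abs_def])
qed

lemma absolutely_integrable_change_of_variables_real_cart:
  fixes f :: "real^'n::finite \<Rightarrow> real" and g :: "real^'n \<Rightarrow> real^'n"
  assumes S: "S \<in> sets lebesgue"
    and der: "\<And>x. x \<in> S \<Longrightarrow> (g has_derivative (*v) (M x)) (at x within S)"
    and inj: "inj_on g S" and f: "f absolutely_integrable_on g ` S"
  shows "(\<lambda>x. \<bar>det (M x)\<bar> * f (g x)) absolutely_integrable_on S \<and>
         integral S (\<lambda>x. \<bar>det (M x)\<bar> * f (g x)) = integral (g ` S) f"
proof -
  let ?S = "vec_wo ` S" and ?g = "\<lambda>x. vec_wo (g (wo_vec x))"
  let ?M = "\<lambda>x. \<chi> i j. M (wo_vec x) $ of_wo i $ of_wo j"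
  \<comment> \<open>The change of variables theorem is about vector-valued integrands; a scalar
    integrand is read as a vector with one entry.\<close>
  let ?f = "\<lambda>x. vec (f (wo_vec x)) :: real^1"
  let ?h = "\<lambda>x. \<bar>det (M x)\<bar> * f (g x)"
  have gS: "?g ` ?S = vec_wo ` g ` S"
    by (auto simp: image_comp)
  have "?S = wo_vec -` S \<inter> space lebesgue"
    by auto (metis image_eqI vec_wo_wo_vec)
  then have S': "?S \<in> sets lebesgue"
    using measurable_sets[OF wo_vec_lebesgue(2) S] by simp
  have der': "(?g has_derivative (*v) (?M x)) (at x within ?S)" if "x \<in> ?S" for x
    by (rule has_derivative_vec_wo_conj) (use der that in auto)
  have inj': "inj_on ?g ?S"
    using inj inj_vec_wo by (auto simp: inj_on_def)
  have f': "(\<lambda>x. f (wo_vec x)) absolutely_integrable_on (?g ` ?S)"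
    and fi: "integral (?g ` ?S) (\<lambda>x. f (wo_vec x)) = integral (g ` S) f"
    using absolutely_integrable_on_distr_inj[OF wo_vec_lebesgue(2,1) inj_wo_vec, where f=f and S="?g ` ?S"] f
    by (simp_all add: gS)
  have det: "det (matrix ((*v) (?M x))) = det (M (wo_vec x))" for x
    by (simp add: det_wo)
  have "?f absolutely_integrable_on ?g ` ?S \<and> integral (?g ` ?S) ?f = vec (integral (g ` S) f)"
    using f' fi unfolding absolutely_integrable_on_1_iff integral_on_1_eq
    by (simp add: o_def)
  then have "(\<lambda>x. \<bar>det (matrix ((*v) (?M x)))\<bar> *\<^sub>R ?f (?g x)) absolutely_integrable_on ?S \<and>
      integral ?S (\<lambda>x. \<bar>det (matrix ((*v) (?M x)))\<bar> *\<^sub>R ?f (?g x)) = vec (integral (g ` S) f)"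
    by (subst has_absolute_integral_change_of_variables[OF S' der' inj'])
  then have h: "(\<lambda>x. ?h (wo_vec x)) absolutely_integrable_on ?S"
      "integral ?S (\<lambda>x. ?h (wo_vec x)) = integral (g ` S) f"
    unfolding absolutely_integrable_on_1_iff integral_on_1_eq det
    by (simp_all add: o_def vec_eq_iff)
  show ?thesis
    using absolutely_integrable_on_distr_inj[OF vec_wo_lebesgue(2,1) inj_vec_wo h(1)] h(2) by simp
qed

text \<open>In equal dimensions a vanishing determinant means deficient rank, which is the case
  treated by Sard's theorem. The way back from the relabelled space is an isometry, and Lipschitz
  maps between spaces of equal dimension keep sets negligible.\<close>

lemma negligible_image_det_0:
  fixes g :: "real^'n::finite \<Rightarrow> real^'n"
  assumes der: "\<And>x. x \<in> S \<Longrightarrow> (g has_derivative (*v) (M x)) (at x within S)"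
    and det: "\<And>x. x \<in> S \<Longrightarrow> det (M x) = 0"
  shows "negligible (g ` S)"
proof -
  let ?S = "vec_wo ` S" and ?g = "\<lambda>x. vec_wo (g (wo_vec x))"
  let ?M = "\<lambda>x. \<chi> i j. M (wo_vec x) $ of_wo i $ of_wo j"
  have gS: "?g ` ?S = vec_wo ` g ` S"
    by (auto simp: image_comp)
  have "negligible (?g ` ?S)"
  proof (rule baby_Sard)
    fix x assume x: "x \<in> ?S"
    show "(?g has_derivative (*v) (?M x)) (at x within ?S)"
      by (rule has_derivative_vec_wo_conj) (use der x in auto)
    have "det (?M x) = 0"
      using det x by (auto simp: det_wo)
    then show "rank (matrix ((*v) (?M x))) < CARD('n wo)"
      by (simp add: det_eq_0_rank)
  qed simp
  moreover have "CARD('n wo) = CARD('n)"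
    using bij_betw_same_card[OF bij_to_wo[where 'n='n]] by simp
  ultimately have "negligible (wo_vec ` (vec_wo ` g ` S))"
    unfolding gS
  proof (rule_tac negligible_locally_Lipschitz_image)
    fix x :: "real^'n wo"
    show "\<exists>T B. open T \<and> x \<in> T \<and> (\<forall>y\<in>vec_wo ` g ` S \<inter> T.
        norm (wo_vec y - wo_vec x :: real^'n) \<le> B * norm (y - x))"
      by (intro exI[of _ UNIV] exI[of _ 1])
        (simp flip: linear_diff[OF bounded_linear.linear[OF bounded_linear_wo_vec]])
  qed simp_all
  then show ?thesis
    by simp
qed


section \<open>Points at which a set is full\<close>

text \<open>Lebesgue density points of \<open>S\<close> are full, and derivatives relative to \<open>S\<close> are unique at full
  points.\<close>

definition full_at :: "'a::real_normed_vector set \<Rightarrow> 'a \<Rightarrow> bool" where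
  "full_at S x \<longleftrightarrow> (\<forall>e>0. \<exists>d>0. \<forall>h. norm h < d \<longrightarrow> (\<exists>y\<in>S. norm (x + h - y) \<le> e * norm h))"

lemma full_atD:
  assumes "full_at S x" "0 < e"
  obtains d where "0 < d" "\<And>h. norm h < d \<Longrightarrow> \<exists>y\<in>S. norm (x + h - y) \<le> e * norm h"
  using assms unfolding full_at_def by blast

text \<open>Every short vector is a difference \<open>y - x\<close> with \<open>y\<close> in
  \<open>S\<close> up to an error that is small relative to its length. A bound on such differences
  therefore passes to all short vectors, and by homogeneity to all vectors.\<close>

lemma full_at_linear_bound:
  fixes L :: "'a::real_normed_vector \<Rightarrow> 'b::real_normed_vector"
  assumes full: "full_at S x" and L: "bounded_linear L" and d: "0 < d" and e: "0 \<le> e"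
    and bound: "\<And>y. y \<in> S \<Longrightarrow> norm (y - x) < d \<Longrightarrow> norm (L (y - x)) \<le> e * norm (y - x)"
  shows "norm (L h) \<le> e * norm h"
proof (cases "h = 0")
  case True
  then show ?thesis
    using linear_0[OF bounded_linear.linear[OF L]] by simp
next
  case False
  obtain B where B: "0 < B" "\<And>z. norm (L z) \<le> norm z * B"
    using bounded_linear.pos_bounded[OF L] by auto
  show ?thesis
  proof (rule field_le_epsilon)
    fix \<epsilon> :: real assume "0 < \<epsilon>"
    \<comment> \<open>The relative error \<eta> enters twice: \<open>norm (y - x)\<close> exceeds
      the length of the scaled \<open>h\<close> by the factor \<open>1 + \<eta>\<close>, which costs
      \<open>e * \<eta>\<close>, and the remainder costs \<open>B * \<eta>\<close>. The sum is to
      stay below \<epsilon>.\<close>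
    define \<eta> where "\<eta> = min 1 (\<epsilon> / ((e + B) * norm h))"
    have pos: "0 < (e + B) * norm h"
      using False B e by simp
    then have \<eta>: "0 < \<eta>" "\<eta> \<le> 1"
      using \<open>0 < \<epsilon>\<close> by (auto simp: \<eta>_def)
    have "\<eta> * ((e + B) * norm h) \<le> \<epsilon> / ((e + B) * norm h) * ((e + B) * norm h)"
      unfolding \<eta>_def using pos by (intro mult_right_mono min.cobounded2) simp
    also have "\<dots> = \<epsilon>"
      using pos by (intro nonzero_eq_divide_eq[THEN iffD1]) auto
    finally have \<eta>3: "\<eta> * ((e + B) * norm h) \<le> \<epsilon>" .
    obtain d' where d': "0 < d'" "\<And>k. norm k < d' \<Longrightarrow> \<exists>y\<in>S. norm (x + k - y) \<le> \<eta> * norm k"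
      using full_atD[OF full \<eta>(1)] by blast
    \<comment> \<open>Since \<eta> is at most 1, \<open>y - x\<close> is at most twice as long as
      the scaled \<open>h\<close>; the bound \<open>d / 3\<close> keeps it shorter than
      \<open>d\<close>.\<close>
    define t where "t = min (d' / 2) (d / 3) / norm h"
    have t: "0 < t" "norm (t *\<^sub>R h) < d'" "2 * norm (t *\<^sub>R h) < d"
      using False d d' by (auto simp: t_def min_def)
    obtain y where y: "y \<in> S" "norm (x + t *\<^sub>R h - y) \<le> \<eta> * norm (t *\<^sub>R h)"
      using d'(2)[OF t(2)] by blast
    have "norm (y - x) \<le> norm (t *\<^sub>R h) + norm (x + t *\<^sub>R h - y)"
      using norm_triangle_ineq4[of "t *\<^sub>R h" "x + t *\<^sub>R h - y"] by (simp add: algebra_simps)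
    then have yx: "norm (y - x) \<le> (1 + \<eta>) * norm (t *\<^sub>R h)"
      using y by (simp add: algebra_simps)
    also have "\<dots> \<le> 2 * norm (t *\<^sub>R h)"
      using \<eta> by (intro mult_right_mono) auto
    finally have "norm (y - x) < d"
      using t by simp
    then have Ly: "norm (L (y - x)) \<le> e * ((1 + \<eta>) * norm (t *\<^sub>R h))"
      using bound[OF y(1)] yx e by (meson mult_left_mono order_trans)
    have "L (t *\<^sub>R h) = L (y - x) + L (x + t *\<^sub>R h - y)"
      using linear_add[OF bounded_linear.linear[OF L], of "y - x" "x + t *\<^sub>R h - y"] by simp
    then have "norm (L (t *\<^sub>R h)) \<le> norm (L (y - x)) + norm (L (x + t *\<^sub>R h - y))"
      by (metis norm_triangle_ineq)
    also have "\<dots> \<le> e * ((1 + \<eta>) * norm (t *\<^sub>R h)) + \<eta> * norm (t *\<^sub>R h) * B"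
      using Ly B(2)[of "x + t *\<^sub>R h - y"] mult_right_mono[OF y(2), of B] B(1) by linarith
    also have "\<dots> = t * (e * norm h + \<eta> * ((e + B) * norm h))"
      using t by (simp add: algebra_simps)
    finally have "t * norm (L h) \<le> t * (e * norm h + \<eta> * ((e + B) * norm h))"
      using t linear_scale[OF bounded_linear.linear[OF L], of t h] by simp
    then have "norm (L h) \<le> e * norm h + \<eta> * ((e + B) * norm h)"
      using t by simp
    then show "norm (L h) \<le> e * norm h + \<epsilon>"
      using \<eta>3 by linarith
  qed
qed

lemma has_derivative_matrix:
  fixes f :: "real^'n::finite \<Rightarrow> real^'m::finite"
  assumes "(f has_derivative L) F"
  shows "(f has_derivative (*v) (matrix L)) F"
proof -
  have "(*v) (matrix L) = L"
    using has_derivative_linear[OF assms] by (simp add: fun_eq_iff matrix_works)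
  then show ?thesis
    using assms by simp
qed

lemma has_derivative_within_bound:
  assumes "(f has_derivative L) (at x within S)" "0 < e"
  obtains d where "0 < d" "\<And>y. y \<in> S \<Longrightarrow> norm (y - x) < d \<Longrightarrow> norm (f y - f x - L (y - x)) \<le> e * norm (y - x)"
  using assms unfolding has_derivative_within_alt by blast

text \<open>The difference of two derivatives is arbitrarily small relative to \<open>y - x\<close>
  for \<open>y\<close> in \<open>S\<close>, hence relative to every vector by fullness.\<close>

lemma has_derivative_unique_full_at:
  assumes full: "full_at S x"
    and f: "(f has_derivative L) (at x within S)" "(f has_derivative L') (at x within S)"
  shows "L = L'"
proof
  fix h
  have L: "bounded_linear (\<lambda>h. L h - L' h)"
    using f by (intro bounded_linear_sub has_derivative_bounded_linear)
  have "norm (L h - L' h) \<le> e * norm h" if "0 < e" for e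
  proof -
    from \<open>0 < e\<close> have e2: "0 < e / 2" by simp
    obtain d where d: "0 < d" "\<And>y. y \<in> S \<Longrightarrow> norm (y - x) < d \<Longrightarrow> norm (f y - f x - L (y - x)) \<le> e / 2 * norm (y - x)"
      using has_derivative_within_bound[OF f(1) e2] by blast
    obtain d' where d': "0 < d'" "\<And>y. y \<in> S \<Longrightarrow> norm (y - x) < d' \<Longrightarrow> norm (f y - f x - L' (y - x)) \<le> e / 2 * norm (y - x)"
      using has_derivative_within_bound[OF f(2) e2] by blast
    show ?thesis
    proof (rule full_at_linear_bound[OF full L, of "min d d'"])
      fix y assume y: "y \<in> S" "norm (y - x) < min d d'"
      have "L (y - x) - L' (y - x) = (f y - f x - L' (y - x)) - (f y - f x - L (y - x))"
        by simp
      then have "norm (L (y - x) - L' (y - x)) \<le> norm (f y - f x - L' (y - x)) + norm (f y - f x - L (y - x))"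
        by (metis norm_triangle_ineq4)
      then show "norm (L (y - x) - L' (y - x)) \<le> e * norm (y - x)"
        using d(2)[of y] d'(2)[of y] y by simp
    qed (use d d' \<open>0 < e\<close> in auto)
  qed
  note bound = this
  have "norm (L h - L' h) \<le> 0"
  proof (rule field_le_epsilon)
    fix \<epsilon> :: real assume "0 < \<epsilon>"
    have pos: "0 < norm h + 1"
      by (simp add: add_nonneg_pos)
    have "norm (L h - L' h) \<le> \<epsilon> / (norm h + 1) * norm h"
      using \<open>0 < \<epsilon>\<close> pos by (intro bound divide_pos_pos)
    also have "\<dots> \<le> \<epsilon> / (norm h + 1) * (norm h + 1)"
      using \<open>0 < \<epsilon>\<close> pos by (intro mult_left_mono) auto
    finally show "norm (L h - L' h) \<le> 0 + \<epsilon>"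
      using pos by simp
  qed
  then show "L h = L' h"
    by simp
qed

text \<open>At a full point two approximating linear maps differ by at most the sum of their errors,
  so maps with errors tending to 0 converge pointwise, and the limit is the derivative.
  Differentiability thus becomes a condition on approximations, which can be taken from a countable
  set.\<close>

lemma differentiable_within_if_approx:
  fixes f :: "'a::euclidean_space \<Rightarrow> 'b::euclidean_space"
  assumes full: "full_at S x"
    and approx: "\<And>e. 0 < e \<Longrightarrow> \<exists>A d. linear A \<and> 0 < d \<and>
      (\<forall>y\<in>S. norm (y - x) < d \<longrightarrow> norm (f y - f x - A (y - x)) \<le> e * norm (y - x))"
  shows "f differentiable (at x within S)"
proof -
  let ?e = "\<lambda>k::nat. inverse (real (Suc k))"
  have "\<forall>k. \<exists>A d. linear A \<and> 0 < d \<and>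
      (\<forall>y\<in>S. norm (y - x) < d \<longrightarrow> norm (f y - f x - A (y - x)) \<le> ?e k * norm (y - x))"
    using approx by simp
  then obtain A d where A: "\<And>k. linear (A k)" and d: "\<And>k. 0 < d k"
    and bound: "\<And>k y. y \<in> S \<Longrightarrow> norm (y - x) < d k \<Longrightarrow> norm (f y - f x - A k (y - x)) \<le> ?e k * norm (y - x)"
    by metis
  have diff: "norm (A k h - A l h) \<le> (?e k + ?e l) * norm h" for k l h
  proof (rule full_at_linear_bound[OF full, of _ "min (d k) (d l)"])
    show "bounded_linear (\<lambda>h. A k h - A l h)"
      using A by (intro bounded_linear_sub linear_linear[THEN iffD2])
    fix y assume y: "y \<in> S" "norm (y - x) < min (d k) (d l)"
    have "A k (y - x) - A l (y - x) = (f y - f x - A l (y - x)) - (f y - f x - A k (y - x))"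
      by simp
    then have "norm (A k (y - x) - A l (y - x)) \<le> norm (f y - f x - A l (y - x)) + norm (f y - f x - A k (y - x))"
      by (metis norm_triangle_ineq4)
    then show "norm (A k (y - x) - A l (y - x)) \<le> (?e k + ?e l) * norm (y - x)"
      using bound[of y k] bound[of y l] y by (simp add: algebra_simps)
  qed (use d in auto)
  have e0: "?e \<longlonglongrightarrow> 0"
    by (rule LIMSEQ_inverse_real_of_nat)
  have "\<exists>a. (\<lambda>k. A k h) \<longlonglongrightarrow> a" for h
  proof -
    have "Cauchy (\<lambda>k. A k h)"
    proof (rule metric_CauchyI)
      fix e :: real assume "0 < e"
      have "(\<lambda>k. 2 * ?e k * norm h) \<longlonglongrightarrow> 2 * 0 * norm h"
        by (intro tendsto_intros e0)
      then have "\<forall>\<^sub>F k in sequentially. 2 * ?e k * norm h < e"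
        using \<open>0 < e\<close> by (auto dest: order_tendstoD(2))
      then obtain K where K: "2 * ?e K * norm h < e"
        by (auto simp: eventually_sequentially)
      show "\<exists>M. \<forall>m\<ge>M. \<forall>n\<ge>M. dist (A m h) (A n h) < e"
      proof (intro exI[of _ K] allI impI)
        fix m n assume "K \<le> m" "K \<le> n"
        then have "?e m + ?e n \<le> 2 * ?e K"
          using le_imp_inverse_le[of "real (Suc K)" "real (Suc m)"] le_imp_inverse_le[of "real (Suc K)" "real (Suc n)"]
          by (simp del: inverse_le_iff_le)
        then have "(?e m + ?e n) * norm h \<le> 2 * ?e K * norm h"
          by (rule mult_right_mono) simp
        then show "dist (A m h) (A n h) < e"
          using diff[of m h n] K by (simp only: dist_norm)
      qed
    qed
    then show ?thesis
      by (simp add: Cauchy_convergent_iff convergent_def)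
  qed
  then obtain L where L: "\<And>h. (\<lambda>k. A k h) \<longlonglongrightarrow> L h"
    by metis
  have lin: "linear L"
  proof (rule linearI)
    fix h h' and r :: real
    have "(\<lambda>k. A k h + A k h') \<longlonglongrightarrow> L h + L h'"
      by (intro tendsto_add L)
    then show "L (h + h') = L h + L h'"
      using L[of "h + h'"] by (simp add: linear_add[OF A] LIMSEQ_unique)
    have "(\<lambda>k. r *\<^sub>R A k h) \<longlonglongrightarrow> r *\<^sub>R L h"
      by (intro tendsto_scaleR tendsto_const L)
    then show "L (r *\<^sub>R h) = r *\<^sub>R L h"
      using L[of "r *\<^sub>R h"] by (simp add: linear_scale[OF A] LIMSEQ_unique)
  qed
  have AL: "norm (A k h - L h) \<le> ?e k * norm h" for k h
  proof (rule LIMSEQ_le)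
    show "(\<lambda>l. norm (A k h - A l h)) \<longlonglongrightarrow> norm (A k h - L h)"
      by (intro tendsto_intros L)
    have "(\<lambda>l. (?e k + ?e l) * norm h) \<longlonglongrightarrow> (?e k + 0) * norm h"
      by (intro tendsto_intros e0)
    then show "(\<lambda>l. (?e k + ?e l) * norm h) \<longlonglongrightarrow> ?e k * norm h"
      by simp
  qed (use diff in blast)
  have "(f has_derivative L) (at x within S)"
    unfolding has_derivative_within_alt
  proof (intro conjI allI impI)
    show "bounded_linear L"
      using lin by (simp add: linear_linear)
    fix e :: real assume "0 < e"
    then obtain k where k: "?e k < e / 2"
      using reals_Archimedean[of "e / 2"] by auto
    show "\<exists>\<delta>>0. \<forall>y\<in>S. norm (y - x) < \<delta> \<longrightarrow> norm (f y - f x - L (y - x)) \<le> e * norm (y - x)"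
    proof (intro exI[of _ "d k"] conjI ballI impI d)
      fix y assume y: "y \<in> S" "norm (y - x) < d k"
      have "f y - f x - L (y - x) = (f y - f x - A k (y - x)) + (A k (y - x) - L (y - x))"
        by simp
      then have "norm (f y - f x - L (y - x)) \<le> norm (f y - f x - A k (y - x)) + norm (A k (y - x) - L (y - x))"
        by (metis norm_triangle_ineq)
      also have "\<dots> \<le> 2 * ?e k * norm (y - x)"
        using bound[OF y] AL[of k "y - x"] by simp
      also have "\<dots> \<le> e * norm (y - x)"
        using k by (intro mult_right_mono) auto
      finally show "norm (f y - f x - L (y - x)) \<le> e * norm (y - x)" .
    qed
  qed
  then show ?thesis
    by (auto simp: differentiable_def)
qed

section \<open>Comparison of measures through small balls\<close>

text \<open>Vitali's theorem selects disjoint balls of the given kind which cover \<open>E\<close>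
  up to a Lebesgue null set. Domination by Lebesgue measure makes the uncovered part null for \<mu>
  and makes the overshoot of the balls beyond \<open>E\<close> cheap for \<nu>.\<close>

lemma emeasure_le_if_small_balls_le:
  fixes \<mu> \<nu> :: "'a::euclidean_space measure"
  assumes sets: "sets \<mu> = sets borel" "sets \<nu> = sets borel"
    and \<mu>: "\<And>B. B \<in> sets borel \<Longrightarrow> emeasure \<mu> B \<le> ennreal C * emeasure lborel B"
    and \<nu>: "\<And>B. B \<in> sets borel \<Longrightarrow> emeasure \<nu> B \<le> ennreal C * emeasure lborel B"
    and C: "0 < C"
    and E: "E \<in> sets borel"
    and small: "\<And>x d. x \<in> E \<Longrightarrow> 0 < d \<Longrightarrow>
      \<exists>a r. x \<in> cball a r \<and> 0 < r \<and> r < d \<and> emeasure \<mu> (cball a r) \<le> emeasure \<nu> (cball a r)"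
  shows "emeasure \<mu> E \<le> emeasure \<nu> E"
proof (rule ennreal_le_epsilon)
  fix e :: real assume "0 < e"
  then have "0 < e / C" using C by simp
  \<comment> \<open>Under the factor \<open>C\<close> the excess of \<open>U\<close> over
    \<open>E\<close> becomes at most \<open>e\<close> for \<nu>.\<close>
  obtain U where U: "open U" "E \<subseteq> U" "emeasure lebesgue (U - E) < ennreal (e / C)"
    using sets_lebesgue_outer_open[of E, OF _ \<open>0 < e / C\<close>] E by (metis sets_completionI_sets sets_lborel)
  define K where "K = {(a, r). 0 < r \<and> cball a r \<subseteq> U \<and> emeasure \<mu> (cball a r) \<le> emeasure \<nu> (cball a r)}"
  have cov: "\<exists>i. i \<in> K \<and> x \<in> cball (fst i) (snd i) \<and> snd i < d" if x: "x \<in> E" "0 < d" for x d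
  proof -
    from x obtain s where s: "0 < s" "ball x s \<subseteq> U"
      using U by (meson open_contains_ball subsetD)
    \<comment> \<open>The point need not be the centre of its ball, so the diameter has to stay
      below \<open>s\<close>.\<close>
    obtain a r where ar: "x \<in> cball a r" "0 < r" "r < min d (s / 2)"
        "emeasure \<mu> (cball a r) \<le> emeasure \<nu> (cball a r)"
      using small[OF x(1), of "min d (s / 2)"] x s by auto
    have "cball a r \<subseteq> ball x s"
    proof
      fix y assume "y \<in> cball a r"
      then have "dist a y \<le> r" by simp
      moreover have "dist x a \<le> r" using ar by (simp add: dist_commute)
      ultimately show "y \<in> ball x s"
        using dist_triangle[of x y a] ar by simp
    qed
    then have "(a, r) \<in> K"
      using s ar by (auto simp: K_def)
    then show ?thesis
      using ar by (intro exI[of _ "(a, r)"]) auto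
  qed
  have pos: "0 < snd i" if "i \<in> K" for i
    using that by (auto simp: K_def)
  obtain D where D: "countable D" "D \<subseteq> K"
      "pairwise (\<lambda>i j. disjnt (cball (fst i) (snd i)) (cball (fst j) (snd j))) D"
      "negligible (E - (\<Union>i\<in>D. cball (fst i) (snd i)))"
    by (rule Vitali_covering_theorem_cballs[of K snd E fst, OF pos cov])
  let ?V = "\<Union>i\<in>D. cball (fst i) (snd i)"
  have V: "?V \<in> sets borel"
    using D by (intro sets.countable_UN'') auto
  have VU: "?V \<subseteq> U"
    using D by (force simp: K_def)
  have disj: "disjoint_family_on (\<lambda>i. cball (fst i) (snd i)) D"
    using D(3) by (auto simp: disjoint_family_on_def pairwise_def disjnt_def)
  have "emeasure lborel (E - ?V) = 0"
    using D(4) E V by (simp add: negligible_iff_emeasure0 sets_completionI_sets)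
  then have \<mu>0: "emeasure \<mu> (E - ?V) = 0"
    using \<mu>[of "E - ?V"] E V by simp
  have "emeasure \<mu> E \<le> emeasure \<mu> ((E - ?V) \<union> ?V)"
    using E V sets by (intro emeasure_mono) auto
  also have "\<dots> \<le> emeasure \<mu> (E - ?V) + emeasure \<mu> ?V"
    using E V sets by (intro emeasure_subadditive) auto
  also have "\<dots> = emeasure \<mu> ?V"
    by (simp add: \<mu>0)
  also have "\<dots> = (\<integral>\<^sup>+i. emeasure \<mu> (cball (fst i) (snd i)) \<partial>count_space D)"
    using D sets disj by (intro emeasure_UN_countable) auto
  also have "\<dots> \<le> (\<integral>\<^sup>+i. emeasure \<nu> (cball (fst i) (snd i)) \<partial>count_space D)"
    using D by (intro nn_integral_mono) (auto simp: K_def)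
  also have "\<dots> = emeasure \<nu> ?V"
    using D sets disj by (intro emeasure_UN_countable[symmetric]) auto
  also have "\<dots> \<le> emeasure \<nu> (E \<union> (U - E))"
    using E V U VU sets by (intro emeasure_mono) auto
  also have "\<dots> \<le> emeasure \<nu> E + emeasure \<nu> (U - E)"
    using E U sets by (intro emeasure_subadditive) auto
  also have "\<dots> \<le> emeasure \<nu> E + ennreal e"
  proof (rule add_left_mono)
    have "emeasure \<nu> (U - E) \<le> ennreal C * emeasure lborel (U - E)"
      using E U by (intro \<nu>) auto
    also have "\<dots> \<le> ennreal C * ennreal (e / C)"
      using U E by (intro mult_left_mono) (auto simp: less_imp_le)
    also have "\<dots> = ennreal e"
      using C by (simp flip: ennreal_mult')
    finally show "emeasure \<nu> (U - E) \<le> ennreal e" .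
  qed
  finally show "emeasure \<mu> E \<le> emeasure \<nu> E + ennreal e" .
qed


section \<open>Almost every point of a measurable set is full\<close>

lemma full_at_mono: "full_at S x \<Longrightarrow> S \<subseteq> S' \<Longrightarrow> full_at S' x"
  unfolding full_at_def by (meson subset_iff)

text \<open>Around a point of \<open>S\<close> that is not full there are arbitrarily small balls
  with a hole, disjoint from \<open>S\<close>, of comparable radius. In these balls \<open>S\<close>
  fills at most a fixed fraction \<open>1 - \<eta>\<close>. Comparison on small balls turns this
  into the inequality that a bounded part of the exceptional set has at most
  \<open>1 - \<eta>\<close> times its own finite measure.\<close>

lemma negligible_not_full_at_borel:
  fixes S :: "'a::euclidean_space set"
  assumes S: "S \<in> sets borel"
  shows "negligible {x \<in> S. \<not> full_at S x}"
\<comment> \<open>The distance to the empty set is 0 by convention, so \<open>infdist\<close>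
  describes holes only for nonempty \<open>S\<close>.\<close>
proof (cases "S = {}")
  case False
  define e where "e k = inverse (real (Suc k))" for k
  \<comment> \<open>For fixed \<open>h\<close> the strict inequality with \<open>infdist\<close> is
    open in the point, so even the uncountable union over \<open>h\<close> is open and
    \<open>E k\<close> is Borel.\<close>
  define E where "E k = S \<inter> (\<Inter>m::nat. \<Union>h\<in>{h. norm h < inverse (real (Suc m))}. {x. e k * norm h < infdist (x + h) S})" for k
  have e: "0 < e k" "e k \<le> 1" for k
    by (auto simp: e_def field_simps)
  have E_borel: "E k \<in> sets borel" for k
    unfolding E_def
  proof (intro sets.Int S sets.countable_INT'' borel_open open_UN ballI)
    fix h :: 'a
    show "open {x. e k * norm h < infdist (x + h) S}"
      by (intro open_Collect_less continuous_intros)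
  qed auto
  have null: "emeasure lborel (E k \<inter> cball 0 N) = 0" for k and N :: real
  proof -
    let ?E = "E k \<inter> cball 0 N" and ?n = "DIM('a)"
    \<comment> \<open>This is the volume of a hole of radius \<open>e k * norm h\<close> relative to
      that of a ball of radius \<open>2 * norm h\<close>. The factor 2 makes the ball around
      \<open>x\<close> contain the hole around \<open>x + h\<close>.\<close>
    define \<eta> where "\<eta> = (e k / 2) ^ DIM('a)"
    have \<eta>: "0 < \<eta>" "\<eta> \<le> 1"
      using e[of k] by (auto simp: \<eta>_def intro: power_le_one)
    have "emeasure (density lborel (indicator S)) ?E \<le> emeasure (scale_measure (ennreal (1 - \<eta>)) lborel) ?E"
    proof (rule emeasure_le_if_small_balls_le[where C=1])
      fix B :: "'a set" assume B: "B \<in> sets borel"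
      then have "emeasure (density lborel (indicator S)) B = emeasure lborel (S \<inter> B)"
        using S by (simp add: emeasure_density indicator_inter_arith[symmetric])
      also have "\<dots> \<le> emeasure lborel B"
        using B by (intro emeasure_mono) auto
      finally show "emeasure (density lborel (indicator S)) B \<le> ennreal 1 * emeasure lborel B"
        by simp
      show "emeasure (scale_measure (ennreal (1 - \<eta>)) lborel) B \<le> ennreal 1 * emeasure lborel B"
        using \<eta> by (simp del: ennreal_1) (intro mult_right_mono ennreal_leI, auto)
    next
      fix x and d :: real assume x: "x \<in> ?E" and "0 < d"
      then obtain m where m: "inverse (real (Suc m)) < d / 2"
        using reals_Archimedean[of "d / 2"] by auto
      from x obtain h where h: "norm h < inverse (real (Suc m))" "e k * norm h < infdist (x + h) S"
        by (force simp: E_def)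
      have "x \<in> S"
        using x by (simp add: E_def)
      then have "h \<noteq> 0"
        using h by auto
      let ?B = "cball x (2 * norm h)" and ?B' = "cball (x + h) (e k * norm h)"
      have "?B' \<subseteq> ?B"
      proof
        fix y assume "y \<in> ?B'"
        then have "dist (x + h) y \<le> 1 * norm h"
          using e[of k] mult_right_mono[of "e k" 1 "norm h"] by simp
        moreover have "dist x (x + h) = norm h"
          by (simp add: dist_norm)
        ultimately show "y \<in> ?B"
          using dist_triangle[of x y "x + h"] by simp
      qed
      have disj: "S \<inter> ?B' = {}"
      proof -
        have False if "y \<in> S" "dist (x + h) y \<le> e k * norm h" for y
          using infdist_le[OF that(1), of "x + h"] that(2) h(2) by simp
        then show ?thesis by auto
      qed
      have "emeasure (density lborel (indicator S)) ?B = emeasure lborel (S \<inter> ?B)"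
        using S by (simp add: emeasure_density indicator_inter_arith[symmetric])
      also have "\<dots> \<le> emeasure lborel (?B - ?B')"
        using disj by (intro emeasure_mono) auto
      also have "\<dots> = emeasure lborel ?B - emeasure lborel ?B'"
        using \<open>?B' \<subseteq> ?B\<close> emeasure_bounded_finite[of ?B'] by (intro emeasure_Diff) auto
      also have "\<dots> = ennreal (unit_ball_vol ?n * (2 * norm h) ^ ?n - unit_ball_vol ?n * (e k * norm h) ^ ?n)"
        using e[of k] by (simp add: emeasure_cball ennreal_minus)
      also have "unit_ball_vol ?n * (2 * norm h) ^ ?n - unit_ball_vol ?n * (e k * norm h) ^ ?n =
          (1 - \<eta>) * (unit_ball_vol ?n * (2 * norm h) ^ ?n)"
        by (simp add: \<eta>_def field_simps power_mult_distrib power_divide)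
      also have "ennreal \<dots> = emeasure (scale_measure (ennreal (1 - \<eta>)) lborel) ?B"
        using \<eta> by (simp add: emeasure_cball ennreal_mult')
      finally show "\<exists>a r. x \<in> cball a r \<and> 0 < r \<and> r < d \<and>
          emeasure (density lborel (indicator S)) (cball a r) \<le> emeasure (scale_measure (ennreal (1 - \<eta>)) lborel) (cball a r)"
        using \<open>h \<noteq> 0\<close> h m by (intro exI[of _ x] exI[of _ "2 * norm h"]) auto
    qed (use E_borel in auto)
    also have "emeasure (density lborel (indicator S)) ?E = emeasure lborel (S \<inter> ?E)"
      using S E_borel by (simp add: emeasure_density indicator_inter_arith[symmetric])
    also have "S \<inter> ?E = ?E"
      by (auto simp: E_def)
    finally have le: "emeasure lborel ?E \<le> ennreal (1 - \<eta>) * emeasure lborel ?E"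
      by simp
    have "emeasure lborel ?E \<le> emeasure lborel (cball 0 N :: 'a set)"
      by (intro emeasure_mono) auto
    also have "\<dots> < \<infinity>"
      using emeasure_bounded_finite[of "cball 0 N :: 'a set"] by simp
    finally obtain v where v: "emeasure lborel ?E = ennreal v" "0 \<le> v"
      by (cases "emeasure lborel ?E") auto
    have "v \<le> (1 - \<eta>) * v"
      using le v \<eta> by (simp flip: ennreal_mult)
    then have "\<eta> * v \<le> 0"
      by (simp add: algebra_simps)
    then show ?thesis
      using v \<eta> by (simp add: mult_le_0_iff)
  qed
  have "{x \<in> S. \<not> full_at S x} \<subseteq> (\<Union>k. \<Union>N::nat. E k \<inter> cball 0 (real N))"
  proof
    fix x assume x: "x \<in> {x \<in> S. \<not> full_at S x}"
    then have "\<not> full_at S x" by simp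
    then have "\<exists>a>0. \<forall>d>0. \<exists>h. norm h < d \<and> (\<forall>y\<in>S. a * norm h < norm (x + h - y))"
      unfolding full_at_def by (simp add: not_le)
    then obtain a where a: "0 < a" "\<forall>d>0. \<exists>h. norm h < d \<and> (\<forall>y\<in>S. a * norm h < norm (x + h - y))"
      by (elim exE conjE)
    obtain k where k: "e k < a"
      using reals_Archimedean[OF a(1)] by (auto simp: e_def)
    have "\<exists>h. norm h < inverse (real (Suc m)) \<and> e k * norm h < infdist (x + h) S" for m
    proof -
      have "0 < inverse (real (Suc m))" by simp
      then obtain h where h: "norm h < inverse (real (Suc m))" "\<forall>y\<in>S. a * norm h < norm (x + h - y)"
        using a(2) by blast
      have "h \<noteq> 0"
        using h(2) x by force
      then have "e k * norm h < a * norm h"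
        using k by simp
      also have "\<dots> \<le> infdist (x + h) S"
      proof -
        have "a * norm h \<le> (INF y\<in>S. dist (x + h) y)"
          by (rule cINF_greatest[OF False]) (use h(2) in \<open>simp add: dist_norm less_imp_le\<close>)
        then show ?thesis
          using False by (simp add: infdist_def)
      qed
      finally show ?thesis
        using h(1) by blast
    qed
    then have "x \<in> E k"
      using x by (auto simp: E_def)
    moreover obtain N :: nat where "norm x \<le> real N"
      using real_arch_simple by blast
    ultimately show "x \<in> (\<Union>k. \<Union>N::nat. E k \<inter> cball 0 (real N))"
      by auto
  qed
  moreover have "negligible (\<Union>k. \<Union>N::nat. E k \<inter> cball 0 (real N))"
    using null E_borel by (intro negligible_Union_nat) (simp add: negligible_iff_emeasure0)
  ultimately show ?thesis
    by (rule negligible_subset[rotated])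
qed simp

text \<open>Fullness passes to larger sets, so it suffices to treat an F-sigma subset of full
  measure.\<close>

lemma negligible_not_full_at:
  fixes S :: "'a::euclidean_space set"
  assumes "S \<in> sets lebesgue"
  shows "negligible {x \<in> S. \<not> full_at S x}"
proof -
  obtain C N where C: "fsigma C" and N: "N \<in> null_sets lebesgue" and CN: "C \<union> N = S"
    using lebesgue_set_almost_fsigma[OF assms] by metis
  have "C \<in> sets borel"
    using C by cases (auto intro!: sets.countable_UN borel_closed)
  then have "negligible ({x \<in> C. \<not> full_at C x} \<union> N)"
    using N by (intro negligible_Un negligible_not_full_at_borel) (simp_all add: negligible_iff_null_sets)
  moreover have "{x \<in> S. \<not> full_at S x} \<subseteq> {x \<in> C. \<not> full_at C x} \<union> N"
    using CN full_at_mono[of C _ S] by auto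
  ultimately show ?thesis
    by (rule negligible_subset)
qed

section \<open>Rademacher's theorem\<close>

text \<open>Both \<open>F\<close> and \<open>x - F x\<close> are increasing and continuous, and
  their Stieltjes measures add up to Lebesgue measure; hence the measure \<open>M\<close> of
  \<open>F\<close> is dominated by Lebesgue measure. If a set consists of points with arbitrarily
  short surrounding intervals of slope below \<open>p\<close> and also of slope above
  \<open>q\<close>, the comparison on small balls bounds its \<open>M\<close>-measure by
  \<open>p\<close> times and from below by \<open>q\<close> times its length. For
  \<open>p < q\<close> it is null.\<close>

lemma mono_Lipschitz_differentiable_AE:
  fixes F :: "real \<Rightarrow> real"
  assumes mono: "\<And>a b. a \<le> b \<Longrightarrow> F a \<le> F b" and lip: "\<And>a b. a \<le> b \<Longrightarrow> F b - F a \<le> b - a"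
  shows "negligible {x. \<not> F differentiable (at x)}"
proof -
  define G where "G x = x - F x" for x
  have absF: "\<bar>F a - F b\<bar> \<le> \<bar>a - b\<bar>" for a b
    using mono[of a b] mono[of b a] lip[of a b] lip[of b a] by (cases "a \<le> b") auto
  have contF: "continuous_on UNIV F"
    using absF by (intro lipschitz_on_continuous_on[of 1] lipschitz_onI) (auto simp: dist_real_def)
  then have contG: "continuous_on UNIV G"
    unfolding G_def by (intro continuous_intros)
  have monoG: "a \<le> b \<Longrightarrow> G a \<le> G b" for a b
    using lip[of a b] by (simp add: G_def)
  define M where "M = interval_measure F"
  define M' where "M' = interval_measure G"
  have sets: "sets M = sets borel" "sets M' = sets borel" "space M = UNIV" "space M' = UNIV"
    by (auto simp: M_def M'_def)
  have M_Icc: "emeasure M {a..b} = F b - F a" "emeasure M' {a..b} = G b - G a" if "a \<le> b" for a b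
    using that mono monoG contF contG by (simp_all add: M_def M'_def emeasure_interval_measure_Icc)
  have box: "emeasure M {a<..<b} = F b - F a" "emeasure M' {a<..<b} = G b - G a" if "a \<le> b" for a b
  proof -
    have "emeasure M {c} = 0" "emeasure M' {c} = 0" for c
      using M_Icc[of c c] by simp_all
    then have ab: "{a, b} \<in> null_sets M" "{a, b} \<in> null_sets M'"
      using null_sets.Un[of "{a}" M "{b}"] null_sets.Un[of "{a}" M' "{b}"] sets
      by (auto simp: null_sets_def insert_commute)
    have eq: "{a..b} = {a<..<b} \<union> {a, b}"
      using that by auto
    show "emeasure M {a<..<b} = F b - F a" "emeasure M' {a<..<b} = G b - G a"
      using M_Icc[OF that] emeasure_Un_null_set[OF _ ab(1), of "{a<..<b}"]
        emeasure_Un_null_set[OF _ ab(2), of "{a<..<b}"] sets by (simp_all add: eq)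
  qed
  define S where "S = measure_of UNIV (sets borel) (\<lambda>A. emeasure M A + emeasure M' A)"
  have S: "emeasure S A = emeasure M A + emeasure M' A" if "A \<in> sets borel" for A
  proof -
    have "countably_additive (sets borel) (\<lambda>A. emeasure M A + emeasure M' A)"
      using sets by (auto simp: countably_additive_def suminf_add[symmetric] suminf_emeasure)
    then show ?thesis
      unfolding S_def using that sets.sigma_algebra_axioms[of "borel :: real measure"]
      by (intro emeasure_measure_of_sigma) (auto simp: positive_def)
  qed
  have "lborel = S"
  proof (rule lborel_eqI)
    fix l u :: real assume "\<And>b. b \<in> Basis \<Longrightarrow> l \<bullet> b \<le> u \<bullet> b"
    then have "l \<le> u" by simp
    then show "emeasure S (box l u) = (\<Prod>b\<in>Basis. (u - l) \<bullet> b)"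
      using mono[of l u] monoG[of l u]
      by (simp add: S box box_real flip: ennreal_plus) (simp add: G_def)
  qed (use sets.sigma_sets_eq[of "borel :: real measure"] in \<open>simp add: S_def\<close>)
  then have M_le: "emeasure M A \<le> emeasure lborel A" if "A \<in> sets borel" for A
    using S[OF that] by simp
  \<comment> \<open>\<open>W P\<close> collects the points that lie inside arbitrarily short
    intervals with the property \<open>P\<close>. As unions of open intervals are open, it is Borel
    for every \<open>P\<close>.\<close>
  define W where "W P = (\<Inter>m::nat. \<Union>(a, b)\<in>{(a, b). 0 < b - a \<and> b - a < inverse (real (Suc m)) \<and> P a b}. {a<..<b})"
    for P :: "real \<Rightarrow> real \<Rightarrow> bool"
  define Lo where "Lo p = W (\<lambda>a b. F b - F a < p * (b - a))" for p
  define Up where "Up q = W (\<lambda>a b. q * (b - a) < F b - F a)" for q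
  have "W P \<in> sets borel" for P
    unfolding W_def by (intro sets.countable_INT'' borel_open open_UN ballI) auto
  then have borel: "Lo p \<in> sets borel" "Up p \<in> sets borel" for p
    unfolding Lo_def Up_def by blast+
  have WD: "\<exists>a b. x \<in> {a<..<b} \<and> b - a < d \<and> P a b" if xd: "x \<in> W P" "0 < d" for x d P
  proof -
    obtain m where m: "inverse (real (Suc m)) < d"
      using reals_Archimedean[OF xd(2)] by auto
    have "\<exists>(a, b)\<in>{(a, b). 0 < b - a \<and> b - a < inverse (real (Suc m)) \<and> P a b}. x \<in> {a<..<b}"
      using xd(1) unfolding W_def by blast
    then show ?thesis
      using m by force
  qed
  have WI: "\<exists>d>0. \<forall>a b. a < x \<longrightarrow> x < b \<longrightarrow> b - a < d \<longrightarrow> \<not> P a b" if x: "x \<notin> W P" for x P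
  proof -
    obtain m where m: "x \<notin> (\<Union>(a, b)\<in>{(a, b). 0 < b - a \<and> b - a < inverse (real (Suc m)) \<and> P a b}. {a<..<b})"
      using x unfolding W_def by blast
    show ?thesis
      by (rule exI[of _ "inverse (real (Suc m))"]) (use m in force)
  qed
  note LoD = WD[of _ "\<lambda>a b. F b - F a < _ * (b - a)", folded Lo_def]
    and UpD = WD[of _ "\<lambda>a b. _ * (b - a) < F b - F a", folded Up_def]
    and LoI = WI[of _ "\<lambda>a b. F b - F a < _ * (b - a)", folded Lo_def, unfolded not_less]
    and UpI = WI[of _ "\<lambda>a b. _ * (b - a) < F b - F a", folded Up_def, unfolded not_less]
  have ball: "cball ((a + b) / 2) ((b - a) / 2) = {a..b}" for a b :: real
    by (auto simp: dist_real_def abs_if field_simps split: if_splits)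
  have null: "negligible (Lo p \<inter> Up q)" if "p < q" for p q
  \<comment> \<open>Only nonnegative slopes can serve as factors of a measure,
    \<open>ennreal\<close> being 0 on negative numbers. For negative \<open>p\<close> no interval
    has slope below \<open>p\<close>, since \<open>F\<close> is increasing.\<close>
  proof (cases "0 \<le> p")
    case False
    have "x \<notin> Lo p" for x
    proof
      assume "x \<in> Lo p"
      obtain a b where ab: "a < x" "x < b" "F b - F a < p * (b - a)"
        using LoD[OF \<open>x \<in> Lo p\<close>, of 1] by auto
      then have "p * (b - a) \<le> 0"
        using False by (intro mult_nonpos_nonneg) auto
      then show False
        using mono[of a b] ab by auto
    qed
    then show ?thesis by (metis Int_iff ex_in_conv negligible_empty)
  next
    case True
    have "emeasure lborel (Lo p \<inter> Up q \<inter> cball 0 N) = 0" for N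
    proof -
      let ?E = "Lo p \<inter> Up q \<inter> cball 0 N"
      \<comment> \<open>The constant has to dominate \<open>M\<close>, whose density is at most 1,
        and both multiples \<open>p\<close> and \<open>q\<close> of Lebesgue measure.\<close>
      define C where "C = max 1 q"
      have C: "1 \<le> C" "q \<le> C" by (auto simp: C_def)
      have bound: "emeasure M B \<le> ennreal C * emeasure lborel B"
          "emeasure (scale_measure (ennreal r) lborel) B \<le> ennreal C * emeasure lborel B"
        if "B \<in> sets borel" "r \<le> q" for B :: "real set" and r
      proof -
        have "1 * emeasure lborel B \<le> ennreal C * emeasure lborel B"
          using C by (intro mult_right_mono) (auto simp flip: ennreal_1)
        then show "emeasure M B \<le> ennreal C * emeasure lborel B"
          using M_le[OF that(1)] by simp
        show "emeasure (scale_measure (ennreal r) lborel) B \<le> ennreal C * emeasure lborel B"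
          using C that by (simp, intro mult_right_mono ennreal_leI) auto
      qed
      have 1: "emeasure M ?E \<le> emeasure (scale_measure (ennreal p) lborel) ?E"
      proof (rule emeasure_le_if_small_balls_le[of _ _ C])
        fix x and d :: real assume x: "x \<in> ?E" "0 < d"
        then have "x \<in> Lo p" by blast
        obtain a b where ab: "a < x" "x < b" "b - a < d" "F b - F a < p * (b - a)"
          using LoD[OF \<open>x \<in> Lo p\<close> x(2)] by auto
        then have "emeasure M {a..b} \<le> emeasure (scale_measure (ennreal p) lborel) {a..b}"
          using True by (simp add: M_Icc ennreal_leI flip: ennreal_mult)
        then show "\<exists>a r. x \<in> cball a r \<and> 0 < r \<and> r < d \<and>
            emeasure M (cball a r) \<le> emeasure (scale_measure (ennreal p) lborel) (cball a r)"
          using ab by (intro exI[of _ "(a + b) / 2"] exI[of _ "(b - a) / 2"]) (auto simp only: ball, auto)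
      qed (use bound borel sets that C in auto)
      have 2: "emeasure (scale_measure (ennreal q) lborel) ?E \<le> emeasure M ?E"
      proof (rule emeasure_le_if_small_balls_le[of _ _ C])
        fix x and d :: real assume x: "x \<in> ?E" "0 < d"
        then have "x \<in> Up q" by blast
        obtain a b where ab: "a < x" "x < b" "b - a < d" "q * (b - a) < F b - F a"
          using UpD[OF \<open>x \<in> Up q\<close> x(2)] by auto
        then have "emeasure (scale_measure (ennreal q) lborel) {a..b} \<le> emeasure M {a..b}"
          using True that by (simp add: M_Icc ennreal_leI flip: ennreal_mult)
        then show "\<exists>a r. x \<in> cball a r \<and> 0 < r \<and> r < d \<and>
            emeasure (scale_measure (ennreal q) lborel) (cball a r) \<le> emeasure M (cball a r)"
          using ab by (intro exI[of _ "(a + b) / 2"] exI[of _ "(b - a) / 2"]) (auto simp only: ball, auto)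
      qed (use bound borel sets that C in auto)
      have le: "ennreal q * emeasure lborel ?E \<le> ennreal p * emeasure lborel ?E"
        using order_trans[OF 2 1] by simp
      have "emeasure lborel ?E \<le> emeasure lborel (cball 0 N :: real set)"
        by (intro emeasure_mono) auto
      also have "\<dots> < \<infinity>"
        using emeasure_bounded_finite[of "cball 0 N :: real set"] by simp
      finally obtain v where v: "emeasure lborel ?E = ennreal v" "0 \<le> v"
        by (cases "emeasure lborel ?E") auto
      have "q * v \<le> p * v"
        using le v True that by (simp flip: ennreal_mult)
      then show ?thesis
        using v that by (auto simp: mult_le_cancel_right)
    qed
    then have "negligible (\<Union>N::nat. Lo p \<inter> Up q \<inter> cball 0 (real N))"
      using borel by (intro negligible_countable_Union) (auto simp: negligible_iff_emeasure0)
    moreover have "Lo p \<inter> Up q \<subseteq> (\<Union>N::nat. Lo p \<inter> Up q \<inter> cball 0 (real N))"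
      using real_arch_simple by auto
    ultimately show ?thesis
      by (rule negligible_subset)
  qed
  have "negligible (\<Union>(p, q)\<in>{(p, q). p \<in> \<rat> \<and> q \<in> \<rat> \<and> p < q}. Lo p \<inter> Up q)"
  proof (intro negligible_countable_Union countable_image)
    show "countable {(p, q). p \<in> \<rat> \<and> q \<in> \<rat> \<and> p < (q::real)}"
      by (rule countable_subset[of _ "\<rat> \<times> \<rat>"]) (auto intro: countable_rat)
  qed (use null in auto)
  moreover have "F differentiable (at x)" if x: "x \<notin> (\<Union>(p, q)\<in>{(p, q). p \<in> \<rat> \<and> q \<in> \<rat> \<and> p < q}. Lo p \<inter> Up q)" for x
  proof -
    have excl: "x \<notin> Lo p" if "x \<in> Up q" "p \<in> \<rat>" "q \<in> \<rat>" "p < q" for p q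
      using x that by blast
    \<comment> \<open>The supremum of \<open>Q\<close> is the upper derivate at \<open>x\<close>.
      The set contains -1 because slopes are nonnegative, and is bounded by 1 because
      \<open>F\<close> is 1-Lipschitz. As \<open>x\<close> avoids the exceptional sets, no rational
      number below this supremum is undercut by the slopes of short intervals, so the lower derivate
      is the same.\<close>
    define Q where "Q = {q \<in> \<rat>. x \<in> Up q}"
    define D where "D = Sup Q"
    have "-1 \<in> Q"
    proof -
      have "x \<in> (\<Union>(a, b)\<in>{(a, b). 0 < b - a \<and> b - a < inverse (real (Suc m)) \<and> (-1) * (b - a) < F b - F a}. {a<..<b})" for m
      proof -
        have "0 < inverse (real (Suc m)) / 2" by simp
        then obtain r where r: "0 < r" "r < inverse (real (Suc m)) / 2"
          using dense by blast
        then show ?thesis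
          using mono[of "x - r" "x + r"] by (intro UN_I[of "(x - r, x + r)"]) auto
      qed
      then show ?thesis
        by (simp add: Q_def Up_def W_def)
    qed
    have bdd: "bdd_above Q"
    proof (rule bdd_aboveI)
      fix q assume "q \<in> Q"
      then have "x \<in> Up q" by (simp add: Q_def)
      obtain a b where "a < x" "x < b" "q * (b - a) < F b - F a"
        using UpD[OF \<open>x \<in> Up q\<close>, of 1] by auto
      then have "0 < b - a" "(q - 1) * (b - a) < 0"
        using lip[of a b] by (auto simp: algebra_simps)
      then show "q \<le> 1"
        by (simp add: mult_less_0_iff)
    qed
    have near: "\<exists>d>0. \<forall>a b. a < x \<longrightarrow> x < b \<longrightarrow> b - a < d \<longrightarrow> \<bar>F b - F a - D * (b - a)\<bar> \<le> e * (b - a)" if e: "0 < e" for e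
    proof -
      obtain q where q: "q \<in> \<rat>" "D < q" "q < D + e"
        using Rats_dense_in_real[of D "D + e"] e by auto
      then have "q \<notin> Q"
        using cSup_upper[OF _ bdd, of q] by (auto simp: D_def)
      then obtain d1 where d1: "0 < d1" "\<And>a b. a < x \<Longrightarrow> x < b \<Longrightarrow> b - a < d1 \<Longrightarrow> F b - F a \<le> q * (b - a)"
        using UpI[of x q] q(1) unfolding Q_def by blast
      obtain p where p: "p \<in> \<rat>" "D - e < p" "p < D"
        using Rats_dense_in_real[of "D - e" D] e by auto
      then obtain r where r: "r \<in> Q" "p < r"
        using less_cSupD[of Q p] \<open>-1 \<in> Q\<close> by (auto simp: D_def)
      then have "x \<notin> Lo p"
        using excl[of r p] p(1) by (auto simp: Q_def)
      then obtain d2 where d2: "0 < d2" "\<And>a b. a < x \<Longrightarrow> x < b \<Longrightarrow> b - a < d2 \<Longrightarrow> p * (b - a) \<le> F b - F a"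
        using LoI[of x p] by blast
      show ?thesis
      proof (intro exI[of _ "min d1 d2"] conjI allI impI)
        fix a b assume ab: "a < x" "x < b" "b - a < min d1 d2"
        then have "F b - F a \<le> q * (b - a)" "p * (b - a) \<le> F b - F a"
          using d1(2)[of a b] d2(2)[of a b] by auto
        moreover have "q * (b - a) \<le> (D + e) * (b - a)" "(D - e) * (b - a) \<le> p * (b - a)"
          using p q ab by (auto intro!: mult_right_mono)
        ultimately show "\<bar>F b - F a - D * (b - a)\<bar> \<le> e * (b - a)"
          by (simp add: algebra_simps abs_le_iff)
      qed (use d1 d2 in auto)
    qed
    \<comment> \<open>The derivative compares \<open>F y\<close> with \<open>F x\<close>, so
      intervals ending at \<open>x\<close> are required. They are limits of intervals with
      \<open>x\<close> in the interior, and the estimate is kept by continuity of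
      \<open>F\<close>.\<close>
    have near': "\<exists>d>0. \<forall>a b. a \<le> x \<longrightarrow> x \<le> b \<longrightarrow> b - a < d \<longrightarrow> \<bar>F b - F a - D * (b - a)\<bar> \<le> e * (b - a)" if e: "0 < e" for e
    proof -
      obtain d where d: "0 < d" "\<And>a b. a < x \<Longrightarrow> x < b \<Longrightarrow> b - a < d \<Longrightarrow> \<bar>F b - F a - D * (b - a)\<bar> \<le> e * (b - a)"
        using near[OF e] by blast
      have "\<bar>F b - F a - D * (b - a)\<bar> \<le> e * (b - a)" if ab: "a \<le> x" "x \<le> b" "b - a < d" for a b
      proof (rule tendsto_le[of "at_right (0::real)"])
        have contF': "((\<lambda>t. F (g t)) \<longlongrightarrow> F (g 0)) (at_right 0)" if "isCont g 0" for g :: "real \<Rightarrow> real"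
          using that contF by (intro isCont_tendsto_compose[of "g 0" F])
            (auto simp: continuous_on_eq_continuous_at isCont_def tendsto_within_subset intro: filterlim_mono[OF _ order_refl at_le])
        show "((\<lambda>t. \<bar>F (b + t) - F (a - t) - D * ((b + t) - (a - t))\<bar>) \<longlongrightarrow> \<bar>F b - F a - D * (b - a)\<bar>) (at_right 0)"
          using contF'[of "\<lambda>t. b + t"] contF'[of "\<lambda>t. a - t"] by (auto intro!: tendsto_eq_intros)
        show "((\<lambda>t. e * ((b + t) - (a - t))) \<longlongrightarrow> e * (b - a)) (at_right 0)"
          by (auto intro!: tendsto_eq_intros)
        have "\<forall>\<^sub>F t in at_right 0. t < (d - (b - a)) / 2"
          using ab by (intro order_tendstoD(2)[OF tendsto_ident_at]) auto
        then show "\<forall>\<^sub>F t in at_right 0. \<bar>F (b + t) - F (a - t) - D * ((b + t) - (a - t))\<bar> \<le> e * ((b + t) - (a - t))"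
          using eventually_at_right_less[of 0]
        proof eventually_elim
          case (elim t)
          then show ?case
            using ab by (intro d(2)) auto
        qed
      qed simp
      then show ?thesis
        using d(1) by blast
    qed
    have "(F has_derivative (\<lambda>h. D * h)) (at x)"
      unfolding has_derivative_at_alt
    proof (intro conjI allI impI)
      show "bounded_linear (\<lambda>h. D * h)"
        by (rule bounded_linear_mult_right)
      fix e :: real assume "0 < e"
      then obtain d where d: "0 < d" "\<And>a b. a \<le> x \<Longrightarrow> x \<le> b \<Longrightarrow> b - a < d \<Longrightarrow> \<bar>F b - F a - D * (b - a)\<bar> \<le> e * (b - a)"
        using near' by blast
      show "\<exists>d>0. \<forall>y. norm (y - x) < d \<longrightarrow> norm (F y - F x - D * (y - x)) \<le> e * norm (y - x)"
      proof (intro exI[of _ d] conjI allI impI d)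
        fix y assume "norm (y - x) < d"
        then show "norm (F y - F x - D * (y - x)) \<le> e * norm (y - x)"
          using d(2)[of x y] d(2)[of y x] by (cases "x \<le> y") (auto simp: abs_if algebra_simps split: if_splits)
      qed
    qed
    then show ?thesis
      by (auto simp: differentiable_def)
  qed
  ultimately show ?thesis
    by (elim negligible_subset) blast
qed


text \<open>A multiple of \<open>f\<close> with slopes between -1/2 and 1/2, added to
  \<open>x / 2\<close>, has slopes between 0 and 1, which is the monotone case. The maximum with 1
  only keeps \<open>K\<close> positive.\<close>

lemma Lipschitz_real_differentiable_AE:
  fixes f :: "real \<Rightarrow> real"
  assumes L: "\<And>x y. \<bar>f x - f y\<bar> \<le> L * \<bar>x - y\<bar>"
  shows "negligible {x. \<not> f differentiable (at x)}"
proof -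
  define K where "K = max 1 L"
  have K: "0 < K" "L \<le> K" by (auto simp: K_def)
  define F where "F x = x / 2 + f x / (2 * K)" for x
  have f: "\<bar>f b - f a\<bar> \<le> K * (b - a)" if "a \<le> b" for a b
  proof -
    have "\<bar>f b - f a\<bar> \<le> L * (b - a)"
      using L[of b a] that by simp
    also have "\<dots> \<le> K * (b - a)"
      using K that by (intro mult_right_mono) auto
    finally show ?thesis .
  qed
  have Fd: "F b - F a = (b - a) / 2 + (f b - f a) / (2 * K)" for a b
    by (simp add: F_def diff_divide_distrib)
  have bound: "\<bar>(f b - f a) / (2 * K)\<bar> \<le> (b - a) / 2" if "a \<le> b" for a b
  proof -
    have "\<bar>(f b - f a) / (2 * K)\<bar> = \<bar>f b - f a\<bar> / (2 * K)"
      using K by (simp add: abs_divide)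
    also have "\<dots> \<le> K * (b - a) / (2 * K)"
      using f[OF that] K by (intro divide_right_mono) auto
    also have "\<dots> = (b - a) / 2"
      using K by simp
    finally show ?thesis .
  qed
  have "negligible {x. \<not> F differentiable (at x)}"
  proof (rule mono_Lipschitz_differentiable_AE)
    fix a b :: real assume "a \<le> b"
    define z where "z = (f b - f a) / (2 * K)"
    have "z \<le> (b - a) / 2" "- z \<le> (b - a) / 2" "F b - F a = (b - a) / 2 + z"
      using bound[OF \<open>a \<le> b\<close>] Fd[of b a] by (simp_all only: z_def abs_le_iff)
    moreover have "(b - a) / 2 + (b - a) / 2 = b - a"
      by simp
    ultimately show "F a \<le> F b" "F b - F a \<le> b - a"
      by linarith+
  qed
  moreover have "f differentiable (at x)" if "F differentiable (at x)" for x
  proof -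
    have "(\<lambda>x. 2 * K * (F x - x / 2)) differentiable (at x)"
      using that by (intro derivative_intros) auto
    moreover have "(\<lambda>x. 2 * K * (F x - x / 2)) = f"
      using K by (auto simp: F_def)
    ultimately show ?thesis by simp
  qed
  ultimately show ?thesis
    by (elim negligible_subset) blast
qed

text \<open>Translation invariance reduces differentiability along lines to the case of one variable:
  the measure of the exceptional set is its average over the translates along a segment.\<close>

lemma Lipschitz_directional_derivative_AE:
  fixes f :: "'a::euclidean_space \<Rightarrow> real"
  assumes L: "\<And>x y. \<bar>f x - f y\<bar> \<le> L * norm (x - y)"
  shows "negligible {x. \<not> (\<lambda>t. f (x + t *\<^sub>R v)) differentiable (at (0::real))}"
proof -
  have contf: "continuous_on UNIV f"
  proof (intro lipschitz_on_continuous_on[of "max 0 L"] lipschitz_onI)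
    fix x y
    have "\<bar>f x - f y\<bar> \<le> max 0 L * norm (x - y)"
      using L[of x y] mult_right_mono[of L "max 0 L" "norm (x - y)"] by simp
    then show "dist (f x) (f y) \<le> max 0 L * dist x y"
      by (simp add: dist_norm)
  qed simp
  define q where "q x t = (f (x + t *\<^sub>R v) - f x) / t" for x t
  \<comment> \<open>This is the failure of the Cauchy criterion for the difference quotients as the
    step tends to 0. The criterion avoids naming the limit and exhibits the exceptional set as
    Borel, which Fubini's theorem requires.\<close>
  define N where "N = (\<Union>k::nat. \<Inter>m::nat. \<Union>(s, t)\<in>{(s, t). s \<noteq> 0 \<and> t \<noteq> 0 \<and> \<bar>s\<bar> < inverse (real (Suc m)) \<and> \<bar>t\<bar> < inverse (real (Suc m))}.
      {x. inverse (real (Suc k)) < \<bar>q x s - q x t\<bar>})"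
  have "open (\<Union>(s, t)\<in>{(s, t). s \<noteq> 0 \<and> t \<noteq> 0 \<and> \<bar>s\<bar> < d \<and> \<bar>t\<bar> < d}. {x. e < \<bar>q x s - q x t\<bar>})" for d e
  proof (intro open_UN ballI, clarify)
    fix s t :: real assume "s \<noteq> 0" "t \<noteq> 0"
    then show "open {x. e < \<bar>q x s - q x t\<bar>}"
      unfolding q_def by (intro open_Collect_less continuous_intros continuous_on_compose2[OF contf]) auto
  qed
  then have N: "N \<in> sets borel"
    unfolding N_def by (intro sets.countable_UN'' sets.countable_INT'' borel_open) auto
  have diff_iff: "x \<notin> N \<longleftrightarrow> (\<lambda>t. f (x + t *\<^sub>R v)) differentiable (at 0)" for x
  proof -
    have "(\<lambda>t. f (x + t *\<^sub>R v)) differentiable (at 0) \<longleftrightarrow> (\<exists>D. (q x \<longlongrightarrow> D) (at 0))"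
      by (simp add: real_differentiable_def DERIV_def q_def[abs_def])
    also have "\<dots> \<longleftrightarrow> (\<forall>e>0. \<exists>d>0. \<forall>s t. s \<noteq> 0 \<longrightarrow> t \<noteq> 0 \<longrightarrow> \<bar>s\<bar> < d \<longrightarrow> \<bar>t\<bar> < d \<longrightarrow> \<bar>q x s - q x t\<bar> \<le> e)"
    proof (intro iffI allI impI)
      fix e :: real assume "\<exists>D. (q x \<longlongrightarrow> D) (at 0)" "0 < e"
      then obtain D where "(q x \<longlongrightarrow> D) (at 0)" by blast
      moreover have "0 < e / 2" using \<open>0 < e\<close> by simp
      ultimately have "\<forall>\<^sub>F s in at 0. dist (q x s) D < e / 2"
        by (rule tendstoD)
      then obtain d where d: "0 < d" "\<And>s. s \<noteq> 0 \<Longrightarrow> \<bar>s\<bar> < d \<Longrightarrow> \<bar>q x s - D\<bar> < e / 2"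
        by (auto simp: eventually_at dist_real_def)
      show "\<exists>d>0. \<forall>s t. s \<noteq> 0 \<longrightarrow> t \<noteq> 0 \<longrightarrow> \<bar>s\<bar> < d \<longrightarrow> \<bar>t\<bar> < d \<longrightarrow> \<bar>q x s - q x t\<bar> \<le> e"
      proof (intro exI[of _ d] conjI allI impI d(1))
        fix s t assume "s \<noteq> 0" "t \<noteq> 0" "\<bar>s\<bar> < d" "\<bar>t\<bar> < d"
        then show "\<bar>q x s - q x t\<bar> \<le> e"
          using d(2)[of s] d(2)[of t] by linarith
      qed
    next
      assume c: "\<forall>e>0. \<exists>d>0. \<forall>s t. s \<noteq> 0 \<longrightarrow> t \<noteq> 0 \<longrightarrow> \<bar>s\<bar> < d \<longrightarrow> \<bar>t\<bar> < d \<longrightarrow> \<bar>q x s - q x t\<bar> \<le> e"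
      let ?X = "\<lambda>n::nat. q x (inverse (real (Suc n)))"
      have small: "\<exists>M. \<forall>n\<ge>M. inverse (real (Suc n)) < d" if "0 < d" for d
        using order_tendstoD(2)[OF LIMSEQ_inverse_real_of_nat that] by (simp add: eventually_sequentially)
      have "Cauchy ?X"
      proof (rule metric_CauchyI)
        fix e :: real assume "0 < e"
        then have "0 < e / 2" by simp
        then obtain d where d: "0 < d" "\<forall>s t. s \<noteq> 0 \<longrightarrow> t \<noteq> 0 \<longrightarrow> \<bar>s\<bar> < d \<longrightarrow> \<bar>t\<bar> < d \<longrightarrow> \<bar>q x s - q x t\<bar> \<le> e / 2"
          using c by blast
        obtain M where M: "\<forall>n\<ge>M. inverse (real (Suc n)) < d"
          using small[OF d(1)] by blast
        have "\<bar>?X m - ?X n\<bar> \<le> e / 2" if "M \<le> m" "M \<le> n" for m n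
          using M that d(2)[rule_format, of "inverse (real (Suc m))" "inverse (real (Suc n))"] by simp
        then show "\<exists>M. \<forall>m\<ge>M. \<forall>n\<ge>M. dist (?X m) (?X n) < e"
          using \<open>0 < e\<close> by (intro exI[of _ M]) (force simp: dist_real_def)
      qed
      then obtain D where D: "?X \<longlonglongrightarrow> D"
        by (auto simp: Cauchy_convergent_iff convergent_def)
      have "(q x \<longlongrightarrow> D) (at 0)"
      proof (rule tendstoI)
        fix e :: real assume "0 < e"
        then have "0 < e / 2" by simp
        then obtain d where d: "0 < d" "\<forall>s t. s \<noteq> 0 \<longrightarrow> t \<noteq> 0 \<longrightarrow> \<bar>s\<bar> < d \<longrightarrow> \<bar>t\<bar> < d \<longrightarrow> \<bar>q x s - q x t\<bar> \<le> e / 2"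
          using c by blast
        obtain M where M: "\<forall>n\<ge>M. inverse (real (Suc n)) < d"
          using small[OF d(1)] by blast
        have "\<bar>q x t - D\<bar> \<le> e / 2" if "t \<noteq> 0" "\<bar>t\<bar> < d" for t
        proof (rule LIMSEQ_le_const2)
          show "(\<lambda>n. \<bar>q x t - ?X n\<bar>) \<longlonglongrightarrow> \<bar>q x t - D\<bar>"
            by (intro tendsto_intros D)
          show "\<exists>M. \<forall>n\<ge>M. \<bar>q x t - ?X n\<bar> \<le> e / 2"
            using M d(2) that by (intro exI[of _ M]) simp
        qed
        then show "\<forall>\<^sub>F t in at 0. dist (q x t) D < e"
          using d(1) \<open>0 < e\<close> unfolding eventually_at by (intro exI[of _ d]) (force simp: dist_real_def)
      qed
      then show "\<exists>D. (q x \<longlongrightarrow> D) (at 0)" ..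
    qed
    also have "\<dots> \<longleftrightarrow> x \<notin> N"
    proof
      assume c: "\<forall>e>0. \<exists>d>0. \<forall>s t. s \<noteq> 0 \<longrightarrow> t \<noteq> 0 \<longrightarrow> \<bar>s\<bar> < d \<longrightarrow> \<bar>t\<bar> < d \<longrightarrow> \<bar>q x s - q x t\<bar> \<le> e"
      show "x \<notin> N"
      proof
        assume "x \<in> N"
        then obtain k where k: "\<forall>m::nat. \<exists>s t. s \<noteq> 0 \<and> t \<noteq> 0 \<and> \<bar>s\<bar> < inverse (real (Suc m)) \<and> \<bar>t\<bar> < inverse (real (Suc m)) \<and>
            inverse (real (Suc k)) < \<bar>q x s - q x t\<bar>"
          unfolding N_def by auto
        have "0 < inverse (real (Suc k))" by simp
        then obtain d where d: "0 < d"
          "\<forall>s t. s \<noteq> 0 \<longrightarrow> t \<noteq> 0 \<longrightarrow> \<bar>s\<bar> < d \<longrightarrow> \<bar>t\<bar> < d \<longrightarrow> \<bar>q x s - q x t\<bar> \<le> inverse (real (Suc k))"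
          using c by blast
        obtain m where "inverse (real (Suc m)) < d"
          using reals_Archimedean[OF d(1)] by blast
        then show False
          using k[rule_format, of m] d(2) by (meson less_trans not_le)
      qed
    next
      assume "x \<notin> N"
      show "\<forall>e>0. \<exists>d>0. \<forall>s t. s \<noteq> 0 \<longrightarrow> t \<noteq> 0 \<longrightarrow> \<bar>s\<bar> < d \<longrightarrow> \<bar>t\<bar> < d \<longrightarrow> \<bar>q x s - q x t\<bar> \<le> e"
      proof (intro allI impI)
        fix e :: real assume "0 < e"
        then obtain k where k: "inverse (real (Suc k)) < e"
          using reals_Archimedean by blast
        obtain m where m: "x \<notin> (\<Union>(s, t)\<in>{(s, t). s \<noteq> 0 \<and> t \<noteq> 0 \<and> \<bar>s\<bar> < inverse (real (Suc m)) \<and> \<bar>t\<bar> < inverse (real (Suc m))}.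
            {x. inverse (real (Suc k)) < \<bar>q x s - q x t\<bar>})"
          using \<open>x \<notin> N\<close> unfolding N_def by blast
        show "\<exists>d>0. \<forall>s t. s \<noteq> 0 \<longrightarrow> t \<noteq> 0 \<longrightarrow> \<bar>s\<bar> < d \<longrightarrow> \<bar>t\<bar> < d \<longrightarrow> \<bar>q x s - q x t\<bar> \<le> e"
        proof (intro exI[of _ "inverse (real (Suc m))"] conjI allI impI)
          fix s t assume "s \<noteq> 0" "t \<noteq> 0" "\<bar>s\<bar> < inverse (real (Suc m))" "\<bar>t\<bar> < inverse (real (Suc m))"
          then have "\<not> inverse (real (Suc k)) < \<bar>q x s - q x t\<bar>"
            using m by blast
          then show "\<bar>q x s - q x t\<bar> \<le> e"
            using k by linarith
        qed simp
      qed
    qed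
    finally show ?thesis by simp
  qed
  have translates: "{x. x + t *\<^sub>R v \<in> N} \<in> sets borel" "{t. x + t *\<^sub>R v \<in> N} \<in> sets borel" for x and t :: real
  proof -
    have "(\<lambda>x. x + t *\<^sub>R v) -` N \<inter> space borel \<in> sets borel" "(\<lambda>t. x + t *\<^sub>R v) -` N \<inter> space borel \<in> sets borel"
      by (intro measurable_sets[OF _ N] borel_measurable_continuous_onI continuous_intros)+
    then show "{x. x + t *\<^sub>R v \<in> N} \<in> sets borel" "{t. x + t *\<^sub>R v \<in> N} \<in> sets borel"
      by (simp_all add: vimage_def)
  qed
  have line: "emeasure lborel {t. x + t *\<^sub>R v \<in> N} = 0" for x
  proof -
    have "negligible {t. \<not> (\<lambda>s. f (x + s *\<^sub>R v)) differentiable (at t)}"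
    proof (rule Lipschitz_real_differentiable_AE[of _ "L * norm v"])
      fix s t :: real
      have "x + s *\<^sub>R v - (x + t *\<^sub>R v) = (s - t) *\<^sub>R v"
        by (simp add: algebra_simps)
      then show "\<bar>f (x + s *\<^sub>R v) - f (x + t *\<^sub>R v)\<bar> \<le> L * norm v * \<bar>s - t\<bar>"
        using L[of "x + s *\<^sub>R v" "x + t *\<^sub>R v"] by (simp add: mult.commute mult.left_commute)
    qed
    moreover have "{t. x + t *\<^sub>R v \<in> N} \<subseteq> {t. \<not> (\<lambda>s. f (x + s *\<^sub>R v)) differentiable (at t)}"
    proof clarify
      fix t assume t: "x + t *\<^sub>R v \<in> N" and d: "(\<lambda>s. f (x + s *\<^sub>R v)) differentiable (at t)"
      have "((\<lambda>s. f (x + s *\<^sub>R v)) \<circ> (\<lambda>s. t + s)) differentiable (at 0)"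
        using d by (intro differentiable_chain_at derivative_intros) auto
      then show False
        using t diff_iff[of "x + t *\<^sub>R v"] by (simp add: o_def algebra_simps)
    qed
    ultimately have "negligible {t. x + t *\<^sub>R v \<in> N}"
      by (rule negligible_subset)
    then show ?thesis
      by (simp add: negligible_iff_emeasure0 translates)
  qed
  have shift: "emeasure lborel {x. x + t *\<^sub>R v \<in> N} = emeasure lborel N" for t
  proof -
    have "emeasure lborel N = emeasure (distr lborel borel ((+) (t *\<^sub>R v))) N"
      by (simp add: lborel_distr_plus)
    also have "\<dots> = emeasure lborel ((+) (t *\<^sub>R v) -` N \<inter> space lborel)"
      using N by (intro emeasure_distr) auto
    also have "(+) (t *\<^sub>R v) -` N \<inter> space lborel = {x. x + t *\<^sub>R v \<in> N}"
      by (auto simp: add.commute)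
    finally show ?thesis by simp
  qed
  have ind: "(\<lambda>(x, t). indicator N (x + t *\<^sub>R v) :: ennreal) \<in> borel_measurable (lborel \<Otimes>\<^sub>M lborel)"
  proof -
    have "(\<lambda>(x::'a, t::real). x + t *\<^sub>R v) \<in> borel_measurable (borel \<Otimes>\<^sub>M borel)"
      unfolding borel_prod split_beta' by (intro borel_measurable_continuous_onI continuous_intros)
    then have "(\<lambda>(x::'a, t::real). x + t *\<^sub>R v) \<in> borel_measurable (lborel \<Otimes>\<^sub>M lborel)"
      by (simp cong: measurable_cong_sets)
    then have "indicator N \<circ> (\<lambda>(x::'a, t::real). x + t *\<^sub>R v) \<in> borel_measurable (lborel \<Otimes>\<^sub>M lborel)"
      using N by (intro measurable_comp[of _ _ borel]) auto
    then show ?thesis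
      by (simp add: o_def split_beta')
  qed
  have "emeasure lborel N = (\<integral>\<^sup>+t. indicator {0..1::real} t * emeasure lborel N \<partial>lborel)"
    by (simp add: nn_integral_multc)
  also have "\<dots> = (\<integral>\<^sup>+t. indicator {0..1} t * (\<integral>\<^sup>+x. indicator N (x + t *\<^sub>R v) \<partial>lborel) \<partial>lborel)"
  proof (intro nn_integral_cong arg_cong2[where f="(*)"] refl)
    fix t :: real
    have "(\<integral>\<^sup>+x. indicator {x. x + t *\<^sub>R v \<in> N} x \<partial>lborel) = emeasure lborel N"
      by (simp add: shift translates)
    moreover have "(\<lambda>x. indicator {x. x + t *\<^sub>R v \<in> N} x :: ennreal) = (\<lambda>x. indicator N (x + t *\<^sub>R v))"
      by (auto simp: indicator_def)
    ultimately show "emeasure lborel N = (\<integral>\<^sup>+x. indicator N (x + t *\<^sub>R v) \<partial>lborel)"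
      by simp
  qed
  \<comment> \<open>Dropping the cut-off to the unit interval loses nothing: after the exchange of
    integrals, each whole line contributes 0.\<close>
  also have "\<dots> \<le> (\<integral>\<^sup>+t. (\<integral>\<^sup>+x. indicator N (x + t *\<^sub>R v) \<partial>lborel) \<partial>lborel)"
    by (intro nn_integral_mono) (auto simp: indicator_def)
  also have "\<dots> = (\<integral>\<^sup>+x. (\<integral>\<^sup>+t. indicator N (x + t *\<^sub>R v) \<partial>lborel) \<partial>lborel)"
    using lborel_pair.Fubini'[OF ind] by simp
  also have "\<dots> = (\<integral>\<^sup>+x. 0 \<partial>(lborel :: 'a measure))"
  proof (intro nn_integral_cong)
    fix x
    have "(\<integral>\<^sup>+t. indicator {t. x + t *\<^sub>R v \<in> N} t \<partial>lborel) = 0"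
      by (simp add: line translates)
    moreover have "(\<lambda>t. indicator {t. x + t *\<^sub>R v \<in> N} t :: ennreal) = (\<lambda>t. indicator N (x + t *\<^sub>R v))"
      by (auto simp: indicator_def)
    ultimately show "(\<integral>\<^sup>+t. indicator N (x + t *\<^sub>R v) \<partial>lborel) = 0"
      by simp
  qed
  finally have "negligible N"
    using N by (simp add: negligible_iff_emeasure0)
  moreover have "{x. \<not> (\<lambda>t. f (x + t *\<^sub>R v)) differentiable (at 0)} \<subseteq> N"
    using diff_iff by blast
  ultimately show ?thesis
    by (rule negligible_subset)
qed


text \<open>At points where \<open>A\<close> is full, \<open>f\<close> can be followed along the coordinate directions through
  points of \<open>A\<close>, where its increments in these directions are controlled uniformly.\<close>

lemma full_at_approx_from_partial_increments:
  fixes f :: "'a::euclidean_space \<Rightarrow> real"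
  assumes L: "\<And>x y. \<bar>f x - f y\<bar> \<le> L * norm (x - y)" and "0 \<le> L" and c: "0 < c" and r: "0 < r"
    and full: "full_at A x"
    and A: "\<And>y i t. y \<in> A \<Longrightarrow> i \<in> Basis \<Longrightarrow> \<bar>t\<bar> < r \<Longrightarrow> \<bar>f (y + t *\<^sub>R i) - f y - t * (a \<bullet> i)\<bar> \<le> c * \<bar>t\<bar>"
  shows "\<exists>d>0. \<forall>h. norm h < d \<longrightarrow> \<bar>f (x + h) - f x - a \<bullet> h\<bar> \<le> (2 * c * DIM('a)) * norm h"
proof -
  let ?n = "real DIM('a)"
  \<comment> \<open>Each coordinate step replaces its two endpoints by points over \<open>A\<close>,
    at a distance of at most \<open>\<eta> * DIM('a) * norm h\<close>. The two Lipschitz errors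
    together are to cost at most \<open>c * norm h\<close>; \<open>L + 1\<close> avoids a division
    by 0.\<close>
  define \<eta> where "\<eta> = c / (2 * (L + 1) * ?n)"
  have n: "1 \<le> ?n"
    using DIM_positive[where 'a='a] by linarith
  have \<eta>: "0 < \<eta>"
    using c \<open>0 \<le> L\<close> n by (simp add: \<eta>_def)
  have "2 * L * (\<eta> * ?n) \<le> 2 * (L + 1) * ?n * \<eta>"
    using \<eta> n by (simp add: algebra_simps)
  also have "\<dots> = c"
    using \<open>0 \<le> L\<close> n by (simp add: \<eta>_def)
  finally have L\<eta>: "2 * L * (\<eta> * ?n) \<le> c" .
  obtain d where d: "0 < d" "\<And>h. norm h < d \<Longrightarrow> \<exists>y\<in>A. norm (x + h - y) \<le> \<eta> * norm h"
    using full_atD[OF full \<eta>] by blast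
  \<comment> \<open>The corners of the coordinate path are at most \<open>DIM('a) * norm h\<close>
    away from \<open>x\<close>, and each single step is at most \<open>norm h\<close>, which has to
    stay below \<open>r\<close>.\<close>
  define d' where "d' = min (d / ?n) r"
  have d': "0 < d'" "d' \<le> r"
    using d r n by (auto simp: d'_def)
  have part: "norm (\<Sum>i\<in>B. (h \<bullet> i) *\<^sub>R i) \<le> ?n * norm h" if "B \<subseteq> Basis" for B and h :: 'a
  proof -
    have "norm (\<Sum>i\<in>B. (h \<bullet> i) *\<^sub>R i) \<le> (\<Sum>i\<in>B. norm h)"
      using that by (intro sum_norm_le) (auto simp: Basis_le_norm subset_iff)
    also have "\<dots> \<le> ?n * norm h"
      using that card_mono[OF finite_Basis that] by (simp add: mult_right_mono)
    finally show ?thesis .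
  qed
  have walk: "\<bar>f (x + (\<Sum>i\<in>B. (h \<bullet> i) *\<^sub>R i)) - f x - (\<Sum>i\<in>B. (h \<bullet> i) * (a \<bullet> i))\<bar> \<le> (2 * c * card B) * norm h"
    if h: "norm h < d'" and B: "finite B" "B \<subseteq> Basis" for B h
    using B
  proof (induction B)
    case (insert i B)
    let ?p = "\<Sum>i\<in>B. (h \<bullet> i) *\<^sub>R i" and ?t = "h \<bullet> i"
    have p: "norm ?p \<le> ?n * norm h"
      using insert.prems by (intro part) auto
    also have "\<dots> < d"
      using h n by (auto simp: d'_def field_simps)
    finally obtain y where y: "y \<in> A" "norm (x + ?p - y) \<le> \<eta> * norm ?p"
      using d(2) by blast
    have t: "\<bar>?t\<bar> \<le> norm h"
      using insert.prems by (simp add: Basis_le_norm)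
    have "L * norm (x + ?p - y) \<le> L * (\<eta> * (?n * norm h))"
      using y(2) p \<eta> \<open>0 \<le> L\<close> by (meson mult_left_mono order_trans less_imp_le)
    then have Ly: "2 * (L * norm (x + ?p - y)) \<le> c * norm h"
      using mult_right_mono[OF L\<eta>, of "norm h"] by (simp add: algebra_simps)
    have 1: "\<bar>f (x + ?p + ?t *\<^sub>R i) - f (y + ?t *\<^sub>R i)\<bar> \<le> L * norm (x + ?p - y)"
      using L[of "x + ?p + ?t *\<^sub>R i" "y + ?t *\<^sub>R i"] by simp
    have 2: "\<bar>f (x + ?p) - f y\<bar> \<le> L * norm (x + ?p - y)"
      by (rule L)
    have "\<bar>f (y + ?t *\<^sub>R i) - f y - ?t * (a \<bullet> i)\<bar> \<le> c * \<bar>?t\<bar>"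
      using insert.prems y t h d' by (intro A) auto
    also have "\<dots> \<le> c * norm h"
      using t c by simp
    finally have 3: "\<bar>f (y + ?t *\<^sub>R i) - f y - ?t * (a \<bullet> i)\<bar> \<le> c * norm h" .
    have step: "\<bar>f (x + ?p + ?t *\<^sub>R i) - f (x + ?p) - ?t * (a \<bullet> i)\<bar> \<le> 2 * c * norm h"
      using 1 2 3 Ly by linarith
    have IH: "\<bar>f (x + ?p) - f x - (\<Sum>i\<in>B. (h \<bullet> i) * (a \<bullet> i))\<bar> \<le> (2 * c * card B) * norm h"
      using insert by blast
    have "(\<Sum>i\<in>insert i B. (h \<bullet> i) *\<^sub>R i) = ?p + ?t *\<^sub>R i"
         "(\<Sum>i\<in>insert i B. (h \<bullet> i) * (a \<bullet> i)) = (\<Sum>i\<in>B. (h \<bullet> i) * (a \<bullet> i)) + ?t * (a \<bullet> i)"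
         "(2 * c * card (insert i B)) * norm h = (2 * c * card B) * norm h + 2 * c * norm h"
      using insert.hyps by (simp_all add: algebra_simps)
    then show ?case
      using step IH by (simp only: add.assoc[symmetric])
  qed simp
  show ?thesis
  proof (intro exI[of _ d'] conjI allI impI d')
    fix h :: 'a assume "norm h < d'"
    from walk[OF this finite_Basis order_refl]
    show "\<bar>f (x + h) - f x - a \<bullet> h\<bar> \<le> (2 * c * DIM('a)) * norm h"
      by (simp add: euclidean_representation euclidean_inner[of a h] mult.commute)
  qed
qed

text \<open>Partial derivatives alone do not give differentiability; what helps is a neighbourhood
  rich in points with nearly the same partial increments, uniformly in the step. The sets
  \<open>A k m a\<close> collect such points, and with \<open>a\<close> from a countable dense set
  there are countably many of them, so almost every point is full in each one to which it
  belongs.\<close>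

lemma Lipschitz_differentiable_AE:
  fixes f :: "'a::euclidean_space \<Rightarrow> real"
  assumes L: "\<And>x y. \<bar>f x - f y\<bar> \<le> L * norm (x - y)" and "0 \<le> L"
  shows "negligible {x. \<not> f differentiable (at x)}"
proof -
  define c where "c k = inverse (real (Suc k))" for k
  have c: "0 < c k" for k by (simp add: c_def)
  obtain Q :: "'a set" where Q: "countable Q" "\<And>X. open X \<Longrightarrow> X \<noteq> {} \<Longrightarrow> \<exists>q\<in>Q. q \<in> X"
    using countable_dense_exists[where 'a='a] by blast
  have contf: "continuous_on UNIV f"
    using L \<open>0 \<le> L\<close> by (intro lipschitz_on_continuous_on[of L] lipschitz_onI) (auto simp: dist_norm)
  \<comment> \<open>The estimates are not strict, so each set is an intersection of closed sets and
    thereby measurable.\<close>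
  define A where "A k m a = {x. \<forall>i\<in>Basis. \<forall>t\<in>{t. \<bar>t\<bar> < c m}. \<bar>f (x + t *\<^sub>R i) - f x - t * (a \<bullet> i)\<bar> \<le> c k * \<bar>t\<bar>}" for k m a
  have "closed (A k m a)" for k m a
  proof -
    have "A k m a = (\<Inter>i\<in>Basis. \<Inter>t\<in>{t. \<bar>t\<bar> < c m}. {x. \<bar>f (x + t *\<^sub>R i) - f x - t * (a \<bullet> i)\<bar> \<le> c k * \<bar>t\<bar>})"
      by (auto simp: A_def)
    also have "closed \<dots>"
      by (intro closed_INT ballI closed_Collect_le continuous_intros continuous_on_compose2[OF contf]) auto
    finally show ?thesis .
  qed
  then have A_meas: "A k m a \<in> sets lebesgue" for k m a
    by simp
  define N where "N = (\<Union>i\<in>Basis. {x. \<not> (\<lambda>t. f (x + t *\<^sub>R i)) differentiable (at (0::real))}) \<union>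
    (\<Union>(k, m, a)\<in>UNIV \<times> UNIV \<times> Q. {x \<in> A k m a. \<not> full_at (A k m a) x})"
  have "negligible N"
    unfolding N_def
  proof (intro negligible_Un negligible_countable_Union countable_image countable_SIGMA Q countableI_type)
    fix S assume "S \<in> (\<lambda>i. {x. \<not> (\<lambda>t. f (x + t *\<^sub>R i)) differentiable (at (0::real))}) ` Basis"
    then show "negligible S"
      using Lipschitz_directional_derivative_AE[OF L] by auto
  next
    fix S assume "S \<in> (\<lambda>(k, m, a). {x \<in> A k m a. \<not> full_at (A k m a) x}) ` (UNIV \<times> UNIV \<times> Q)"
    then show "negligible S"
      using negligible_not_full_at[OF A_meas] by auto
  qed (simp add: countable_finite)
  moreover have "f differentiable (at x)" if x: "x \<notin> N" for x
  proof -
    have "\<forall>i\<in>Basis. \<exists>D. ((\<lambda>t. f (x + t *\<^sub>R i)) has_real_derivative D) (at 0)"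
      using x by (auto simp: N_def real_differentiable_def)
    then obtain D where D: "\<And>i. i \<in> Basis \<Longrightarrow> ((\<lambda>t. f (x + t *\<^sub>R i)) has_real_derivative D i) (at 0)"
      by metis
    have "\<exists>A d. linear A \<and> 0 < d \<and> (\<forall>y\<in>UNIV. norm (y - x) < d \<longrightarrow> norm (f y - f x - A (y - x)) \<le> e * norm (y - x))"
      if e: "0 < e" for e
    proof -
      have "0 < e / (2 * real DIM('a))" using e by simp
      \<comment> \<open>The passage from coordinate increments to all directions loses the factor
        \<open>2 * DIM('a)\<close>.\<close>
      then obtain k where k: "c k < e / (2 * real DIM('a))"
        unfolding c_def using reals_Archimedean by blast
      have k': "2 * c k * real DIM('a) \<le> e"
        using k by (simp add: field_simps)
      have "ball (\<Sum>i\<in>Basis. D i *\<^sub>R i) (c k / 2) \<noteq> {}"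
        using c[of k] by (simp add: ball_eq_empty not_le)
      \<comment> \<open>The error \<open>c k\<close> is shared equally between the approximation of
        the partial derivatives by \<open>a\<close> and that of the increments by the partial
        derivatives.\<close>
      then obtain a where a: "a \<in> Q" "a \<in> ball (\<Sum>i\<in>Basis. D i *\<^sub>R i) (c k / 2)"
        using Q(2)[OF open_ball] by blast
      have aD: "\<bar>a \<bullet> i - D i\<bar> \<le> c k / 2" if "i \<in> Basis" for i
      proof -
        have "\<bar>(a - (\<Sum>i\<in>Basis. D i *\<^sub>R i)) \<bullet> i\<bar> \<le> norm (a - (\<Sum>i\<in>Basis. D i *\<^sub>R i))"
          using that by (rule Basis_le_norm)
        also have "\<dots> \<le> c k / 2"
          using a(2) by (simp add: dist_norm norm_minus_commute)
        finally show ?thesis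
          using that by (simp add: inner_diff_left inner_sum_left_Basis)
      qed
      have "\<forall>i\<in>Basis. \<exists>s>0. \<forall>t. \<bar>t\<bar> < s \<longrightarrow> \<bar>f (x + t *\<^sub>R i) - f x - t * D i\<bar> \<le> c k / 2 * \<bar>t\<bar>"
      proof
        fix i :: 'a assume "i \<in> Basis"
        then have "((\<lambda>t. f (x + t *\<^sub>R i)) has_derivative (\<lambda>t. t * D i)) (at 0)"
          using D by (simp add: has_field_derivative_def mult_commute_abs)
        moreover have "0 < c k / 2"
          using c[of k] by simp
        ultimately obtain s where "0 < s"
          "\<And>t. t \<in> UNIV \<Longrightarrow> norm (t - 0) < s \<Longrightarrow> norm (f (x + t *\<^sub>R i) - f (x + 0 *\<^sub>R i) - (t - 0) * D i) \<le> c k / 2 * norm (t - 0)"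
          using has_derivative_within_bound by blast
        then show "\<exists>s>0. \<forall>t. \<bar>t\<bar> < s \<longrightarrow> \<bar>f (x + t *\<^sub>R i) - f x - t * D i\<bar> \<le> c k / 2 * \<bar>t\<bar>"
          by (intro exI[of _ s]) simp
      qed
      then obtain s where s: "\<And>i. i \<in> Basis \<Longrightarrow> 0 < s i"
        "\<And>i t. i \<in> Basis \<Longrightarrow> \<bar>t\<bar> < s i \<Longrightarrow> \<bar>f (x + t *\<^sub>R i) - f x - t * D i\<bar> \<le> c k / 2 * \<bar>t\<bar>"
        by metis
      have "0 < Min (s ` Basis)"
        using s(1) by (simp add: Min_gr_iff)
      then obtain m where m: "c m < Min (s ` Basis)"
        unfolding c_def using reals_Archimedean by blast
      have "\<bar>f (x + t *\<^sub>R i) - f x - t * (a \<bullet> i)\<bar> \<le> c k * \<bar>t\<bar>" if "i \<in> Basis" "\<bar>t\<bar> < c m" for i t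
      proof -
        have "c m < s i"
          using that(1) m by (simp add: Min_gr_iff)
        then have "\<bar>t\<bar> < s i"
          using that(2) by simp
        then have "\<bar>f (x + t *\<^sub>R i) - f x - t * D i\<bar> \<le> c k / 2 * \<bar>t\<bar>"
          using s(2) that by blast
        moreover have "\<bar>t * (a \<bullet> i) - t * D i\<bar> \<le> c k / 2 * \<bar>t\<bar>"
          using mult_left_mono[OF aD[OF that(1)], of "\<bar>t\<bar>"] by (simp add: abs_mult[symmetric] algebra_simps)
        ultimately show ?thesis
          by linarith
      qed
      then have "x \<in> A k m a"
        by (auto simp: A_def)
      moreover have "\<not> (x \<in> A k m a \<and> \<not> full_at (A k m a) x)"
        using x a(1) unfolding N_def by blast
      ultimately have "full_at (A k m a) x"
        by blast
      have "\<exists>d>0. \<forall>h. norm h < d \<longrightarrow> \<bar>f (x + h) - f x - a \<bullet> h\<bar> \<le> (2 * c k * DIM('a)) * norm h"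
      proof (rule full_at_approx_from_partial_increments[OF L \<open>0 \<le> L\<close> c[of k] c[of m] \<open>full_at (A k m a) x\<close>])
        fix y i :: 'a and t :: real assume "y \<in> A k m a" "i \<in> Basis" "\<bar>t\<bar> < c m"
        then show "\<bar>f (y + t *\<^sub>R i) - f y - t * (a \<bullet> i)\<bar> \<le> c k * \<bar>t\<bar>"
          unfolding A_def by blast
      qed
      then obtain d where d: "0 < d"
        "\<forall>h. norm h < d \<longrightarrow> \<bar>f (x + h) - f x - a \<bullet> h\<bar> \<le> (2 * c k * DIM('a)) * norm h"
        by blast
      show ?thesis
      proof (intro exI[of _ "\<lambda>h. a \<bullet> h"] exI[of _ d] conjI ballI impI d(1))
        show "linear (\<lambda>h. a \<bullet> h)"
          by (simp add: bounded_linear.linear bounded_linear_inner_right)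
        fix y assume "norm (y - x) < d"
        then have "\<bar>f (x + (y - x)) - f x - a \<bullet> (y - x)\<bar> \<le> (2 * c k * DIM('a)) * norm (y - x)"
          using d(2) by blast
        also have "\<dots> \<le> e * norm (y - x)"
          using k' by (intro mult_right_mono) auto
        finally show "norm (f y - f x - a \<bullet> (y - x)) \<le> e * norm (y - x)"
          by simp
      qed
    qed
    moreover have "full_at UNIV x"
      unfolding full_at_def
    proof (intro allI impI exI[of _ "1::real"] conjI)
      fix e :: real and h :: 'a assume "0 < e"
      then show "\<exists>y\<in>UNIV. norm (x + h - y) \<le> e * norm h"
        by (intro bexI[of _ "x + h"]) auto
    qed simp
    ultimately show ?thesis
      using differentiable_within_if_approx[of UNIV x f] by blast
  qed
  ultimately show ?thesis
    by (elim negligible_subset) blast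
qed

text \<open>McShane's extension: the lower envelope of the cones of slope \<open>L\<close> with
  their tips on the graph of \<open>f\<close>. The empty set is separate because the infimum over it
  carries no information.\<close>

lemma Lipschitz_extension_real:
  fixes f :: "'a::metric_space \<Rightarrow> real"
  assumes L: "\<And>x y. x \<in> S \<Longrightarrow> y \<in> S \<Longrightarrow> \<bar>f x - f y\<bar> \<le> L * dist x y" and "0 \<le> L"
  obtains g where "\<And>x. x \<in> S \<Longrightarrow> g x = f x" "\<And>x y. \<bar>g x - g y\<bar> \<le> L * dist x y"
proof (cases "S = {}")
  case True
  then show ?thesis
    using \<open>0 \<le> L\<close> by (intro that[of "\<lambda>_. 0"]) auto
next
  case False
  then obtain s where s: "s \<in> S" by blast
  define g where "g x = (INF y\<in>S. f y + L * dist x y)" for x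
  have bdd: "bdd_below ((\<lambda>y. f y + L * dist x y) ` S)" for x
  proof (rule bdd_belowI2)
    fix y assume "y \<in> S"
    have "L * dist y s \<le> L * (dist x y + dist x s)"
      using \<open>0 \<le> L\<close> by (intro mult_left_mono) (metis dist_commute dist_triangle)
    then show "f s - L * dist x s \<le> f y + L * dist x y"
      using L[OF \<open>y \<in> S\<close> s] by (simp add: algebra_simps)
  qed
  have le: "g x \<le> g y + L * dist x y" for x y
  proof -
    have "g x - L * dist x y \<le> g y"
      unfolding g_def[of y]
    proof (rule cINF_greatest[OF False])
      fix z assume "z \<in> S"
      then have "g x \<le> f z + L * dist x z"
        unfolding g_def by (intro cINF_lower bdd)
      also have "\<dots> \<le> f z + L * (dist y z + dist x y)"
        using \<open>0 \<le> L\<close> dist_triangle[of x z y] by (intro add_left_mono mult_left_mono) auto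
      finally show "g x - L * dist x y \<le> f z + L * dist y z"
        by (simp add: algebra_simps)
    qed
    then show ?thesis by simp
  qed
  have eq: "g x = f x" if "x \<in> S" for x
  proof (rule antisym)
    have "g x \<le> f x + L * dist x x"
      unfolding g_def using that by (intro cINF_lower bdd)
    then show "g x \<le> f x" by simp
    show "f x \<le> g x"
      unfolding g_def
    proof (rule cINF_greatest[OF False])
      fix y assume "y \<in> S"
      then show "f x \<le> f y + L * dist x y"
        using L[OF that \<open>y \<in> S\<close>] by linarith
    qed
  qed
  show ?thesis
  proof (rule that[of g])
    fix x y
    show "\<bar>g x - g y\<bar> \<le> L * dist x y"
      using le[of x y] le[of y x] by (simp add: dist_commute abs_le_iff)
  qed (rule eq)
qed

text \<open>Each component extends with the same constant to the whole space, where it is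
  differentiable almost everywhere; the derivative restricts to \<open>S\<close>. Thus
  \<open>S\<close> may be arbitrary, as the parameter set of a monotone graph will be.\<close>

theorem Rademacher_within:
  fixes f :: "'a::euclidean_space \<Rightarrow> 'b::euclidean_space"
  assumes L: "\<And>x y. x \<in> S \<Longrightarrow> y \<in> S \<Longrightarrow> norm (f x - f y) \<le> L * norm (x - y)" and "0 \<le> L"
  shows "negligible {x \<in> S. \<not> f differentiable (at x within S)}"
proof -
  have "\<forall>i\<in>Basis. \<exists>g. (\<forall>x\<in>S. g x = f x \<bullet> i) \<and> (\<forall>x y. \<bar>g x - g y\<bar> \<le> L * norm (x - y))"
  proof
    fix i :: 'b assume i: "i \<in> Basis"
    have "\<bar>f x \<bullet> i - f y \<bullet> i\<bar> \<le> L * dist x y" if "x \<in> S" "y \<in> S" for x y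
      using Basis_le_norm[OF i, of "f x - f y"] L[OF that] by (simp add: inner_diff_left dist_norm)
    then obtain g where "\<And>x. x \<in> S \<Longrightarrow> g x = f x \<bullet> i" "\<And>x y. \<bar>g x - g y\<bar> \<le> L * dist x y"
      using Lipschitz_extension_real[of S "\<lambda>x. f x \<bullet> i" L] \<open>0 \<le> L\<close> by blast
    then show "\<exists>g. (\<forall>x\<in>S. g x = f x \<bullet> i) \<and> (\<forall>x y. \<bar>g x - g y\<bar> \<le> L * norm (x - y))"
      by (auto simp: dist_norm)
  qed
  then obtain g where g: "\<And>i x. i \<in> Basis \<Longrightarrow> x \<in> S \<Longrightarrow> g i x = f x \<bullet> i"
    "\<And>i x y. i \<in> Basis \<Longrightarrow> \<bar>g i x - g i y\<bar> \<le> L * norm (x - y)"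
    by metis
  have "negligible (\<Union>i\<in>Basis. {x. \<not> g i differentiable (at x)})"
    using Lipschitz_differentiable_AE[OF g(2) \<open>0 \<le> L\<close>]
    by (intro negligible_countable_Union countable_image) (auto simp: countable_finite)
  moreover have "f differentiable (at x within S)" if "x \<in> S" "x \<notin> (\<Union>i\<in>Basis. {x. \<not> g i differentiable (at x)})" for x
  proof (subst differentiable_componentwise_within, intro ballI)
    fix i :: 'b assume i: "i \<in> Basis"
    then have "g i differentiable (at x within S)"
      using that by (auto intro: differentiable_at_withinI)
    then show "(\<lambda>x. f x \<bullet> i) differentiable (at x within S)"
      by (rule differentiable_transform_within[where d=1]) (use g(1)[OF i] \<open>x \<in> S\<close> in auto)
  qed
  ultimately show ?thesis
    by (elim negligible_subset) blast
qed


section \<open>The Jacobian equation in Euclidean space\<close>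

text \<open>Up to a null set, the set where \<open>f\<close> has a given sign is a countable union
  of compact sets. A function that is positive on a compact set and has integral 0 over it forces
  this set to be null. Compact sets are the right tests because continuous maps keep them
  compact.\<close>

lemma negligible_nonzero_if_compact_integrals_0:
  fixes f :: "'a::euclidean_space \<Rightarrow> real"
  assumes S: "S \<in> sets lebesgue" and f: "f absolutely_integrable_on S"
    and zero: "\<And>K. compact K \<Longrightarrow> K \<subseteq> S \<Longrightarrow> integral K f = 0"
  shows "negligible {x \<in> S. f x \<noteq> 0}"
proof -
  have pos: "negligible {x \<in> S. 0 < s * f x}" if s: "s \<noteq> 0" for s :: real
  proof -
    let ?P = "{x \<in> S. 0 < s * f x}"
    have fm: "f \<in> borel_measurable (lebesgue_on S)"
      using f S by (rule absolutely_integrable_imp_borel_measurable)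
    have "{x \<in> space (lebesgue_on S). 0 < s * f x} \<in> sets (lebesgue_on S)"
      using fm by measurable
    then have P: "?P \<in> sets lebesgue"
      using S by (simp add: sets_restrict_space_iff)
    obtain C T where C: "fsigma C" and T: "T \<in> null_sets lebesgue" and CT: "C \<union> T = ?P"
      using lebesgue_set_almost_fsigma[OF P] by metis
    obtain K :: "nat \<Rightarrow> 'a set" where K: "range K \<subseteq> Collect compact" "C = (\<Union>n. K n)"
      using C unfolding fsigma_Union_compact by blast
    have "negligible (K n)" for n
    proof -
      have Kc: "compact (K n)"
        using K(1) by blast
      have KS: "K n \<subseteq> S" and Kpos: "\<And>x. x \<in> K n \<Longrightarrow> 0 < s * f x"
        using K(2) CT by auto
      have Kl: "K n \<in> sets lebesgue"
        using Kc by (simp add: compact_imp_closed)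
      have fK: "f absolutely_integrable_on K n"
        using set_integrable_subset[OF f Kl KS] .
      have "(LINT x:K n|lebesgue. f x) = 0"
        using zero[OF Kc KS] set_lebesgue_integral_eq_integral(2)[OF fK] by simp
      then have "(LINT x|lebesgue. s * (indicator (K n) x * f x)) = 0"
        by (simp add: set_lebesgue_integral_def)
      moreover have "integrable lebesgue (\<lambda>x. s * (indicator (K n) x * f x))"
        using fK by (simp add: set_integrable_def)
      moreover have "0 \<le> s * (indicator (K n) x * f x)" for x
        using Kpos[of x] by (auto simp: indicator_def)
      ultimately have "AE x in lebesgue. s * (indicator (K n) x * f x) = 0"
        by (subst (asm) integral_nonneg_eq_0_iff_AE) auto
      then have "AE x in lebesgue. x \<notin> K n"
        by (rule AE_mp) (use Kpos in \<open>force intro!: AE_I2 simp: indicator_def\<close>)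
      then show ?thesis
        using Kl by (simp add: AE_iff_null_sets negligible_iff_null_sets)
    qed
    then have "negligible (C \<union> T)"
      using T by (auto simp: K(2) negligible_iff_null_sets[symmetric])
    then show ?thesis
      by (simp add: CT)
  qed
  have "{x \<in> S. f x \<noteq> 0} = {x \<in> S. 0 < 1 * f x} \<union> {x \<in> S. 0 < (-1) * f x}"
    by auto
  also have "negligible \<dots>"
    by (intro negligible_Un pos) auto
  finally show ?thesis .
qed

lemma norm_matrix_vector_mult_le:
  fixes A :: "real^'n::finite^'m::finite"
  shows "norm (A *v h) \<le> real CARD('m) * norm A * norm h"
proof -
  have "norm (A *v h) \<le> (\<Sum>i\<in>UNIV. \<bar>(A *v h) $ i\<bar>)"
    by (rule norm_le_l1_cart)
  also have "\<dots> \<le> (\<Sum>i\<in>(UNIV::'m set). norm A * norm h)"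
  proof (rule sum_mono)
    fix i
    have "\<bar>(A *v h) $ i\<bar> \<le> norm (A $ i) * norm h"
      by (simp add: matrix_vector_mul_component Cauchy_Schwarz_ineq2)
    also have "\<dots> \<le> norm A * norm h"
      by (intro mult_right_mono) (auto simp: Finite_Cartesian_Product.norm_nth_le)
    finally show "\<bar>(A *v h) $ i\<bar> \<le> norm A * norm h" .
  qed
  finally show ?thesis by simp
qed

text \<open>At full points differentiability means that for every \<open>k\<close> some matrix from
  a countable dense set approximates the increments up to the error \<open>c k\<close> within some
  distance \<open>c m\<close>. For fixed parameters this is a relatively closed condition, so only
  countable operations remain.\<close>

lemma lebesgue_measurable_differentiable_full_at:
  fixes g :: "real^'n::finite \<Rightarrow> real^'m::finite"
  assumes S: "S \<in> sets lebesgue" and g: "continuous_on S g"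
  shows "{x \<in> S. full_at S x \<and> g differentiable (at x within S)} \<in> sets lebesgue"
proof -
  define c where "c k = inverse (real (Suc k))" for k
  have c: "0 < c k" for k by (simp add: c_def)
  obtain Q :: "(real^'n^'m) set" where Q: "countable Q" "\<And>X. open X \<Longrightarrow> X \<noteq> {} \<Longrightarrow> \<exists>q\<in>Q. q \<in> X"
    using countable_dense_exists by blast
  define R where "R A k m = {x \<in> S. \<forall>y\<in>S. norm (y - x) < c m \<longrightarrow> norm (g y - g x - A *v (y - x)) \<le> c k * norm (y - x)}" for A k m
  have "closedin (top_of_set S) (R A k m)" for A k m
  proof -
    \<comment> \<open>For a fixed \<open>y\<close> either \<open>y\<close> is at distance at least
      \<open>c m\<close> from the point or the estimate holds; both alternatives are closed in the
      point.\<close>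
    let ?C = "\<lambda>y. (S \<inter> (\<lambda>x. norm (y - x)) -` {c m..}) \<union>
        (S \<inter> (\<lambda>x. c k * norm (y - x) - norm (g y - g x - A *v (y - x))) -` {0..})"
    have "closedin (top_of_set S) (S \<inter> \<Inter> (?C ` S))"
    proof (cases "S = {}")
      case False
      have "closedin (top_of_set S) (?C y)" for y
        by (intro closedin_Un continuous_closedin_preimage continuous_intros g closed_atLeast
            bounded_linear.continuous_on[OF matrix_vector_mul_bounded_linear])
      then show ?thesis
        using False by (intro closedin_Int closedin_Inter) auto
    qed simp
    also have "S \<inter> \<Inter> (?C ` S) = R A k m"
      by (auto simp: R_def not_less) (meson leD)
    finally show ?thesis .
  qed
  then have "\<exists>T. closed T \<and> R A k m = S \<inter> T" for A k m
    unfolding closedin_closed .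
  then have R: "R A k m \<in> sets lebesgue" for A k m
    using S by (metis lborelD sets.Int sets_completionI_sets borel_closed sets_lborel)
  define D where "D = (\<Inter>k. \<Union>A\<in>Q. \<Union>m. R A k m)"
  have "{x \<in> S. \<not> full_at S x} \<in> sets lebesgue"
    using negligible_not_full_at[OF S] by (simp add: negligible_imp_sets)
  then have full: "S - {x \<in> S. \<not> full_at S x} \<in> sets lebesgue"
    using S by (rule sets.Diff[rotated])
  have D: "D \<in> sets lebesgue"
    unfolding D_def using R Q(1) by (intro sets.countable_INT'' sets.countable_UN'') auto
  have "g differentiable (at x within S)" if "x \<in> D" "full_at S x" for x
  proof (rule differentiable_within_if_approx[OF that(2)])
    fix e :: real assume "0 < e"
    then obtain k where k: "c k < e"
      unfolding c_def using reals_Archimedean by blast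
    from \<open>x \<in> D\<close> obtain A m where A: "x \<in> R A k m"
      unfolding D_def by blast
    show "\<exists>A d. linear A \<and> 0 < d \<and> (\<forall>y\<in>S. norm (y - x) < d \<longrightarrow> norm (g y - g x - A (y - x)) \<le> e * norm (y - x))"
    proof (intro exI[of _ "(*v) A"] exI[of _ "c m"] conjI ballI impI c)
      fix y assume "y \<in> S" "norm (y - x) < c m"
      then have "norm (g y - g x - A *v (y - x)) \<le> c k * norm (y - x)"
        using A by (simp add: R_def)
      also have "\<dots> \<le> e * norm (y - x)"
        using k by (intro mult_right_mono) auto
      finally show "norm (g y - g x - A *v (y - x)) \<le> e * norm (y - x)" .
    qed simp
  qed
  moreover have "x \<in> D" if x: "x \<in> S" "g differentiable (at x within S)" for x
  proof -
    obtain L where L: "(g has_derivative L) (at x within S)"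
      using x(2) by (auto simp: differentiable_def)
    define B where "B = matrix L"
    have B: "L h = B *v h" for h
      using has_derivative_linear[OF L] by (simp add: B_def matrix_works)
    have "\<exists>A\<in>Q. \<exists>m. x \<in> R A k m" for k
    proof -
      let ?n = "real CARD('m)"
      have n: "0 < ?n" by simp
      \<comment> \<open>The factor \<open>CARD('m)\<close> comes from the bound on a matrix acting
        on a vector; the other half of \<open>c k\<close> is left for the differentiability
        error.\<close>
      have "ball B (c k / (2 * ?n)) \<noteq> {}"
        using c[of k] n by (simp add: ball_eq_empty not_le)
      then obtain A where A: "A \<in> Q" "A \<in> ball B (c k / (2 * ?n))"
        using Q(2)[OF open_ball] by blast
      have AB: "norm (B *v h - A *v h) \<le> c k / 2 * norm h" for h
      proof -
        have "norm (B *v h - A *v h) \<le> ?n * norm (B - A) * norm h"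
          using norm_matrix_vector_mult_le[of "B - A" h] by (simp add: matrix_vector_mult_diff_rdistrib)
        also have "\<dots> \<le> ?n * (c k / (2 * ?n)) * norm h"
          using A(2) by (intro mult_right_mono mult_left_mono) (auto simp: dist_norm)
        finally show ?thesis by simp
      qed
      have "0 < c k / 2" using c[of k] by simp
      then obtain d where d: "0 < d" "\<And>y. y \<in> S \<Longrightarrow> norm (y - x) < d \<Longrightarrow> norm (g y - g x - L (y - x)) \<le> c k / 2 * norm (y - x)"
        using has_derivative_within_bound[OF L] by blast
      obtain m where m: "c m < d"
        unfolding c_def using reals_Archimedean[OF d(1)] by blast
      have "norm (g y - g x - A *v (y - x)) \<le> c k * norm (y - x)" if "y \<in> S" "norm (y - x) < c m" for y
      proof -
        have "g y - g x - A *v (y - x) = (g y - g x - L (y - x)) + (B *v (y - x) - A *v (y - x))"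
          by (simp add: B)
        then have "norm (g y - g x - A *v (y - x)) \<le> norm (g y - g x - L (y - x)) + norm (B *v (y - x) - A *v (y - x))"
          by (metis norm_triangle_ineq)
        then show ?thesis
          using d(2)[of y] AB[of "y - x"] that m by simp
      qed
      then have "x \<in> R A k m"
        using x(1) by (simp add: R_def)
      then show ?thesis
        using A(1) by blast
    qed
    then show ?thesis
      by (auto simp: D_def)
  qed
  ultimately have "{x \<in> S. full_at S x \<and> g differentiable (at x within S)} = D \<inter> (S - {x \<in> S. \<not> full_at S x})"
    by blast
  then show ?thesis
    using D full by simp
qed

text \<open>On compact subsets of the set of differentiability the change of variables formula turns
  the integral of \<open>G\<close> over the image into that of the Jacobian term. Its difference
  from \<open>F\<close> therefore has integral 0 over all of them.\<close>

lemma Jacobian_equation_AE: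
  fixes g :: "real^'n::finite \<Rightarrow> real^'n"
  assumes S: "S \<in> sets lebesgue" and g: "continuous_on S g" and inj: "inj_on g S"
    and F: "F absolutely_integrable_on S"
    and G: "\<And>K. compact K \<Longrightarrow> K \<subseteq> S \<Longrightarrow> G absolutely_integrable_on g ` K"
    and FG: "\<And>K. compact K \<Longrightarrow> K \<subseteq> S \<Longrightarrow> integral (g ` K) G = integral K F"
  shows "negligible {x \<in> S. \<exists>M. (g has_derivative (*v) M) (at x within S) \<and> F x \<noteq> \<bar>det M\<bar> * G (g x)}"
proof -
  define D where "D = {x \<in> S. full_at S x \<and> g differentiable (at x within S)}"
  have DS: "D \<subseteq> S" by (auto simp: D_def)
  have "\<exists>M. (g has_derivative (*v) M) (at x within S)" if x: "x \<in> D" for x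
  proof -
    obtain L where L: "(g has_derivative L) (at x within S)"
      using x by (auto simp: D_def differentiable_def)
    then show ?thesis
      using has_derivative_matrix by blast
  qed
  then obtain M where M: "\<And>x. x \<in> D \<Longrightarrow> (g has_derivative (*v) (M x)) (at x within S)"
    by metis
  let ?h = "\<lambda>x. F x - \<bar>det (M x)\<bar> * G (g x)"
  \<comment> \<open>Integrability of the Jacobian term is known on compact subsets only, so
    \<open>D\<close> is exhausted by compact sets up to a null set.\<close>
  obtain C T where C: "fsigma C" and T: "T \<in> null_sets lebesgue" and CT: "C \<union> T = D"
    by (rule lebesgue_set_almost_fsigma[OF lebesgue_measurable_differentiable_full_at[OF S g], folded D_def])
  obtain K :: "nat \<Rightarrow> (real^'n) set" where K: "range K \<subseteq> Collect compact" "C = (\<Union>n. K n)"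
    using C unfolding fsigma_Union_compact by blast
  have compact: "?h absolutely_integrable_on K' \<and> integral K' ?h = 0" if K': "compact K'" "K' \<subseteq> D" for K'
  proof -
    have KS: "K' \<subseteq> S" using K' DS by blast
    have Kl: "K' \<in> sets lebesgue"
      using K' by (simp add: compact_imp_closed)
    have J: "(\<lambda>x. \<bar>det (M x)\<bar> * G (g x)) absolutely_integrable_on K' \<and>
        integral K' (\<lambda>x. \<bar>det (M x)\<bar> * G (g x)) = integral (g ` K') G"
    proof (rule absolutely_integrable_change_of_variables_real_cart[OF Kl])
      show "(g has_derivative (*v) (M x)) (at x within K')" if "x \<in> K'" for x
        using M[of x] that K' KS by (meson has_derivative_subset subset_iff)
      show "inj_on g K'"
        using inj KS by (rule inj_on_subset)
    qed (rule G[OF K'(1) KS])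
    have FK: "F absolutely_integrable_on K'"
      using set_integrable_subset[OF F Kl KS] .
    show ?thesis
    proof
      show "?h absolutely_integrable_on K'"
        using FK J by (intro set_integral_diff(1)) auto
      have "integral K' ?h = integral K' F - integral K' (\<lambda>x. \<bar>det (M x)\<bar> * G (g x))"
        using FK J by (intro Henstock_Kurzweil_Integration.integral_diff) (auto intro: set_lebesgue_integral_eq_integral(1))
      then show "integral K' ?h = 0"
        using J FG[OF K'(1) KS] by simp
    qed
  qed
  have "negligible {x \<in> K n. ?h x \<noteq> 0}" for n
  proof (rule negligible_nonzero_if_compact_integrals_0)
    have "K n \<subseteq> D" using K(2) CT by blast
    then show "?h absolutely_integrable_on K n" "\<And>K'. compact K' \<Longrightarrow> K' \<subseteq> K n \<Longrightarrow> integral K' ?h = 0"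
      using compact K(1) by (blast, meson order_trans)
    have "compact (K n)" using K(1) by blast
    then show "K n \<in> sets lebesgue"
      by (simp add: compact_imp_closed)
  qed
  then have "negligible ((\<Union>n. {x \<in> K n. ?h x \<noteq> 0}) \<union> T \<union> {x \<in> S. \<not> full_at S x})"
    using T negligible_not_full_at[OF S]
    by (intro negligible_Un negligible_Union_nat) (auto simp: negligible_iff_null_sets)
  moreover have "{x \<in> S. \<exists>M. (g has_derivative (*v) M) (at x within S) \<and> F x \<noteq> \<bar>det M\<bar> * G (g x)} \<subseteq>
      (\<Union>n. {x \<in> K n. ?h x \<noteq> 0}) \<union> T \<union> {x \<in> S. \<not> full_at S x}"
  proof
    fix x assume "x \<in> {x \<in> S. \<exists>M. (g has_derivative (*v) M) (at x within S) \<and> F x \<noteq> \<bar>det M\<bar> * G (g x)}"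
    then obtain M' where x: "x \<in> S" and M': "(g has_derivative (*v) M') (at x within S)" "F x \<noteq> \<bar>det M'\<bar> * G (g x)"
      by blast
    show "x \<in> (\<Union>n. {x \<in> K n. ?h x \<noteq> 0}) \<union> T \<union> {x \<in> S. \<not> full_at S x}"
    \<comment> \<open>The derivative relative to \<open>S\<close> is unique at full points, so the
      equation for the selected matrix \<open>M x\<close> settles it for every
      \<open>M'\<close>.\<close>
    proof (cases "full_at S x")
      case True
      then have xD: "x \<in> D"
        using x M'(1) by (auto simp: D_def differentiable_def)
      have "(*v) M' = (*v) (M x)"
        using has_derivative_unique_full_at[OF True M'(1) M[OF xD]] .
      then have "M' = M x"
        by (simp add: matrix_eq fun_eq_iff)
      then have "?h x \<noteq> 0"
        using M'(2) by simp
      then show ?thesis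
        using xD CT K(2) by blast
    qed (use x in blast)
  qed
  ultimately show ?thesis
    by (rule negligible_subset)
qed


section \<open>Monotone graphs of non-degenerate costs\<close>

lemma has_real_derivative_along_line:
  fixes f :: "'a::real_normed_vector \<Rightarrow> real"
  assumes "f differentiable (at (z + t *\<^sub>R w))"
  shows "((\<lambda>t. f (z + t *\<^sub>R w)) has_real_derivative frechet_derivative f (at (z + t *\<^sub>R w)) w) (at t)"
proof -
  let ?D = "frechet_derivative f (at (z + t *\<^sub>R w))"
  have f: "(f has_derivative ?D) (at (z + t *\<^sub>R w))"
    using assms by (simp add: frechet_derivative_works)
  have "((\<lambda>t. z + t *\<^sub>R w) has_derivative (\<lambda>s. s *\<^sub>R w)) (at t)"
    by (auto intro!: derivative_eq_intros)
  from has_derivative_compose[OF this f]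
  have "((\<lambda>t. f (z + t *\<^sub>R w)) has_derivative (\<lambda>s. ?D (s *\<^sub>R w))) (at t)" .
  moreover have "?D (s *\<^sub>R w) = ?D w * s" for s
    using linear_scale[OF has_derivative_linear[OF f], of s w] by (simp add: mult.commute)
  ultimately show ?thesis
    by (simp add: has_field_derivative_def)
qed

section \<open>Second differences of a twice continuously differentiable cost\<close>

locale C2_pair =
  fixes A B :: "(real^'n::finite) set" and C :: "(real^'n) \<times> (real^'n) \<Rightarrow> real"
  assumes A: "open A" and B: "open B" and C2: "Ck_on 2 (A \<times> B) C"
begin

definition D :: "(real^'n) \<times> (real^'n) \<Rightarrow> (real^'n) \<times> (real^'n) \<Rightarrow> real"
  where "D w z = frechet_derivative C (at z) w"

text \<open>The derivative in the second argument is taken first, as in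
  \<open>mixed_hessian\<close>, so that the two agree without exchanging the order of
  differentiation.\<close>

definition H :: "(real^'n) \<times> (real^'n) \<Rightarrow> real^'n^'n"
  where "H z = (\<chi> i j. frechet_derivative (D (0, axis j 1)) (at z) (axis i 1, 0))"

lemma C_differentiable: "z \<in> A \<times> B \<Longrightarrow> C differentiable (at z)"
  and D_differentiable: "z \<in> A \<times> B \<Longrightarrow> D w differentiable (at z)"
  and continuous_D2: "continuous_on (A \<times> B) (\<lambda>z. frechet_derivative (D w) (at z) w')"
  using C2 unfolding numeral_2_eq_2 D_def[abs_def] Ck_on.simps by blast+

lemma continuous_H: "continuous_on (A \<times> B) H"
  unfolding H_def by (intro continuous_on_vec_lambda continuous_D2)

lemma mixed_hessian_eq:
  assumes "u \<in> A" "v \<in> B"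
  shows "mixed_hessian C u v = H (u, v)"
proof -
  have "deriv (\<lambda>s. deriv (\<lambda>t. C (u + s *\<^sub>R axis i 1, v + t *\<^sub>R axis j 1)) 0) 0 =
        frechet_derivative (D (0, axis j 1)) (at (u, v)) (axis i 1, 0)" for i j
  proof -
    have inner: "deriv (\<lambda>t. C (x, v + t *\<^sub>R axis j 1)) 0 = D (0, axis j 1) (x, v)" if "x \<in> A" for x
      using has_real_derivative_along_line[of C "(x, v)" 0 "(0, axis j 1)"] C_differentiable[of "(x, v)"] that assms
      by (auto simp: D_def intro: DERIV_imp_deriv)
    have "open ((\<lambda>s::real. u + s *\<^sub>R axis i 1) -` A)"
      by (intro open_vimage A continuous_intros)
    then have "\<forall>\<^sub>F s in nhds 0. u + s *\<^sub>R axis i 1 \<in> A"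
      using assms eventually_nhds_in_open[of "(\<lambda>s::real. u + s *\<^sub>R axis i 1) -` A" 0] by simp
    then have "\<forall>\<^sub>F s in nhds 0. deriv (\<lambda>t. C (u + s *\<^sub>R axis i 1, v + t *\<^sub>R axis j 1)) 0 =
        D (0, axis j 1) (u + s *\<^sub>R axis i 1, v)"
      by eventually_elim (rule inner)
    then have "deriv (\<lambda>s. deriv (\<lambda>t. C (u + s *\<^sub>R axis i 1, v + t *\<^sub>R axis j 1)) 0) 0 =
        deriv (\<lambda>s. D (0, axis j 1) (u + s *\<^sub>R axis i 1, v)) 0"
      by (rule deriv_cong_ev) simp
    also have "\<dots> = frechet_derivative (D (0, axis j 1)) (at (u, v)) (axis i 1, 0)"
      using has_real_derivative_along_line[of "D (0, axis j 1)" "(u, v)" 0 "(axis i 1, 0)"] D_differentiable[of "(u, v)"] assms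
      by (auto intro: DERIV_imp_deriv)
    finally show ?thesis .
  qed
  then show ?thesis
    by (simp add: mixed_hessian_def H_def)
qed

text \<open>Two applications of the mean value theorem, one in each argument, turn the second
  difference into the bilinear form of \<open>H\<close> at an intermediate point, and
  \<open>H\<close> is continuous.\<close>

lemma mixed_difference:
  assumes u: "u0 \<in> A" and v: "v0 \<in> B" and e: "0 < e"
  shows "\<exists>d>0. \<forall>u\<in>ball u0 d. \<forall>u'\<in>ball u0 d. \<forall>v\<in>ball v0 d. \<forall>v'\<in>ball v0 d.
    \<bar>C (u, v) - C (u, v') - C (u', v) + C (u', v') - (u - u') \<bullet> (H (u0, v0) *v (v - v'))\<bar> \<le>
      e * norm (u - u') * norm (v - v')"
proof -
  let ?n = "real CARD('n)"
  have n: "0 < ?n" by simp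
  obtain r where r: "0 < r" "ball u0 r \<subseteq> A" "ball v0 r \<subseteq> B"
  proof -
    obtain r1 r2 where "0 < r1" "ball u0 r1 \<subseteq> A" "0 < r2" "ball v0 r2 \<subseteq> B"
      using A B u v by (meson openE)
    then show ?thesis
      by (intro that[of "min r1 r2"]) auto
  qed
  have "continuous (at (u0, v0)) H"
    using continuous_H A B u v by (simp add: continuous_on_eq_continuous_at open_Times)
  \<comment> \<open>Dividing by the dimension compensates for the dimensional factor in
    \<open>norm_matrix_vector_mult_le\<close>.\<close>
  then obtain s where s: "0 < s" "\<And>z. dist z (u0, v0) < s \<Longrightarrow> dist (H z) (H (u0, v0)) < e / ?n"
    using e n unfolding continuous_at_eps_delta by (metis divide_pos_pos)
  \<comment> \<open>The distance of pairs is at most the sum of the two distances, hence the half of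
    \<open>s\<close>.\<close>
  define d where "d = min r (s / 2)"
  have d: "0 < d" "d \<le> r" "2 * d \<le> s"
    using r s by (auto simp: d_def)
  have "\<bar>C (u, v) - C (u, v') - C (u', v) + C (u', v') - (u - u') \<bullet> (H (u0, v0) *v (v - v'))\<bar> \<le>
      e * norm (u - u') * norm (v - v')"
    if uv: "u \<in> ball u0 d" "u' \<in> ball u0 d" "v \<in> ball v0 d" "v' \<in> ball v0 d" for u u' v v'
  proof -
    define h where "h = u - u'"
    define k where "k = v - v'"
    have seg: "x' + t *\<^sub>R (x - x') \<in> ball x0 d" if "x \<in> ball x0 d" "x' \<in> ball x0 d" "0 \<le> t" "t \<le> 1" for x x' x0 :: "real^'n" and t
    proof -
      have "x' + t *\<^sub>R (x - x') = (1 - t) *\<^sub>R x' + t *\<^sub>R x"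
        by (simp add: algebra_simps)
      also have "\<dots> \<in> ball x0 d"
        using convex_ball[of x0 d] that by (auto simp: convex_def)
      finally show ?thesis .
    qed
    have sub: "ball u0 d \<subseteq> A" "ball v0 d \<subseteq> B"
      using r d by (meson subset_ball order_trans)+
    have lin: "D (0, k) z = (\<Sum>j\<in>UNIV. k $ j * D (0, axis j 1) z)" if "z \<in> A \<times> B" for z
    proof -
      have l: "linear (frechet_derivative C (at z))"
        using C_differentiable[OF that] by (rule linear_frechet_derivative)
      have "(0 :: real^'n, k) = (\<Sum>j\<in>UNIV. k $ j *\<^sub>R (0, axis j 1))"
        by (simp add: prod_eq_iff fst_sum snd_sum vec_eq_iff axis_def if_distrib cong: if_cong)
      then have "frechet_derivative C (at z) (0, k) = frechet_derivative C (at z) (\<Sum>j\<in>UNIV. k $ j *\<^sub>R (0, axis j 1))"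
        by (rule arg_cong)
      also have "\<dots> = (\<Sum>j\<in>UNIV. k $ j * frechet_derivative C (at z) (0, axis j 1))"
        by (simp only: linear_sum[OF l] linear_scale[OF l] real_scaleR_def)
      finally show ?thesis
        by (simp add: D_def)
    qed
    \<comment> \<open>The mean value theorem is applied to the difference of the costs at
      \<open>u\<close> and \<open>u'\<close>, as a function of the second argument, so that a single
      intermediate point serves both.\<close>
    have "\<exists>t. 0 < t \<and> t < 1 \<and> (C (u, v' + 1 *\<^sub>R k) - C (u', v' + 1 *\<^sub>R k)) - (C (u, v' + 0 *\<^sub>R k) - C (u', v' + 0 *\<^sub>R k)) =
        (1 - 0) * (D (0, k) (u, v' + t *\<^sub>R k) - D (0, k) (u', v' + t *\<^sub>R k))"
    proof (rule MVT2)
      fix t :: real assume "0 \<le> t" "t \<le> 1"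
      then have "v' + t *\<^sub>R k \<in> ball v0 d"
        unfolding k_def using uv by (intro seg)
      then have "(u, v' + t *\<^sub>R k) \<in> A \<times> B" "(u', v' + t *\<^sub>R k) \<in> A \<times> B"
        using sub uv by blast+
      then show "((\<lambda>t. C (u, v' + t *\<^sub>R k) - C (u', v' + t *\<^sub>R k)) has_real_derivative
          D (0, k) (u, v' + t *\<^sub>R k) - D (0, k) (u', v' + t *\<^sub>R k)) (at t)"
        using has_real_derivative_along_line[of C "(u, v')" t "(0, k)"]
          has_real_derivative_along_line[of C "(u', v')" t "(0, k)"]
        by (intro DERIV_diff) (auto simp: D_def C_differentiable)
    qed simp
    then obtain t where t: "0 < t" "t < 1" and
      eq1: "C (u, v) - C (u', v) - (C (u, v') - C (u', v')) = D (0, k) (u, v' + t *\<^sub>R k) - D (0, k) (u', v' + t *\<^sub>R k)"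
      by (auto simp: k_def)
    define \<eta> where "\<eta> = v' + t *\<^sub>R k"
    have \<eta>: "\<eta> \<in> ball v0 d"
      unfolding \<eta>_def k_def using uv t by (intro seg) auto
    \<comment> \<open>The derivative in direction \<open>k\<close> is expanded over the axes, since
      the entries of \<open>H\<close> are derivatives of the axis derivatives.\<close>
    have "\<exists>s. 0 < s \<and> s < 1 \<and> (\<Sum>j\<in>UNIV. k $ j * D (0, axis j 1) (u' + 1 *\<^sub>R h, \<eta>)) - (\<Sum>j\<in>UNIV. k $ j * D (0, axis j 1) (u' + 0 *\<^sub>R h, \<eta>)) =
        (1 - 0) * (h \<bullet> (H (u' + s *\<^sub>R h, \<eta>) *v k))"
    proof (rule MVT2)
      fix s :: real assume "0 \<le> s" "s \<le> 1"
      then have "u' + s *\<^sub>R h \<in> ball u0 d"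
        unfolding h_def using uv by (intro seg)
      then have z: "(u' + s *\<^sub>R h, \<eta>) \<in> A \<times> B"
        using sub \<eta> by blast
      have Dh: "frechet_derivative (D w) (at (u' + s *\<^sub>R h, \<eta>)) (h, 0) =
          (\<Sum>i\<in>UNIV. h $ i * frechet_derivative (D w) (at (u' + s *\<^sub>R h, \<eta>)) (axis i 1, 0))" for w
      proof -
        have l: "linear (frechet_derivative (D w) (at (u' + s *\<^sub>R h, \<eta>)))"
          using D_differentiable[OF z] by (rule linear_frechet_derivative)
        have "(h, 0 :: real^'n) = (\<Sum>i\<in>UNIV. h $ i *\<^sub>R (axis i 1, 0))"
          by (simp add: prod_eq_iff fst_sum snd_sum vec_eq_iff axis_def if_distrib cong: if_cong)
        then have "frechet_derivative (D w) (at (u' + s *\<^sub>R h, \<eta>)) (h, 0) =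
            frechet_derivative (D w) (at (u' + s *\<^sub>R h, \<eta>)) (\<Sum>i\<in>UNIV. h $ i *\<^sub>R (axis i 1, 0))"
          by (rule arg_cong)
        also have "\<dots> = (\<Sum>i\<in>UNIV. h $ i * frechet_derivative (D w) (at (u' + s *\<^sub>R h, \<eta>)) (axis i 1, 0))"
          by (simp only: linear_sum[OF l] linear_scale[OF l] real_scaleR_def)
        finally show ?thesis .
      qed
      have "((\<lambda>s. \<Sum>j\<in>UNIV. k $ j * D (0, axis j 1) (u' + s *\<^sub>R h, \<eta>)) has_real_derivative
          (\<Sum>j\<in>UNIV. k $ j * frechet_derivative (D (0, axis j 1)) (at (u' + s *\<^sub>R h, \<eta>)) (h, 0))) (at s)"
        using has_real_derivative_along_line[of "D (0, axis _ 1)" "(u', \<eta>)" s "(h, 0)"] D_differentiable[OF z]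
        by (intro DERIV_sum DERIV_cmult) auto
      also have "(\<Sum>j\<in>UNIV. k $ j * frechet_derivative (D (0, axis j 1)) (at (u' + s *\<^sub>R h, \<eta>)) (h, 0)) =
          (\<Sum>j\<in>UNIV. \<Sum>i\<in>UNIV. h $ i * (H (u' + s *\<^sub>R h, \<eta>) $ i $ j * k $ j))"
        by (simp add: Dh H_def sum_distrib_left ac_simps)
      also have "\<dots> = h \<bullet> (H (u' + s *\<^sub>R h, \<eta>) *v k)"
        by (subst sum.swap) (simp add: inner_vec_def matrix_vector_mult_def sum_distrib_left)
      finally show "((\<lambda>s. \<Sum>j\<in>UNIV. k $ j * D (0, axis j 1) (u' + s *\<^sub>R h, \<eta>)) has_real_derivative
          h \<bullet> (H (u' + s *\<^sub>R h, \<eta>) *v k)) (at s)" .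
    qed simp
    then obtain t' where t': "0 < t'" "t' < 1" and
      eq2: "(\<Sum>j\<in>UNIV. k $ j * D (0, axis j 1) (u, \<eta>)) - (\<Sum>j\<in>UNIV. k $ j * D (0, axis j 1) (u', \<eta>)) =
        h \<bullet> (H (u' + t' *\<^sub>R h, \<eta>) *v k)"
      by (auto simp: h_def)
    define \<xi> where "\<xi> = u' + t' *\<^sub>R h"
    have \<xi>: "\<xi> \<in> ball u0 d"
      unfolding \<xi>_def h_def using uv t' by (intro seg) auto
    have "D (0, k) (u, \<eta>) - D (0, k) (u', \<eta>) = h \<bullet> (H (\<xi>, \<eta>) *v k)"
    proof -
      have "(u, \<eta>) \<in> A \<times> B" "(u', \<eta>) \<in> A \<times> B"
        using sub uv \<eta> by blast+
      then show ?thesis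
        using eq2 by (simp add: lin \<xi>_def)
    qed
    then have "C (u, v) - C (u, v') - C (u', v) + C (u', v') = h \<bullet> (H (\<xi>, \<eta>) *v k)"
      using eq1 by (simp add: \<eta>_def)
    then have "\<bar>C (u, v) - C (u, v') - C (u', v) + C (u', v') - h \<bullet> (H (u0, v0) *v k)\<bar> =
        \<bar>h \<bullet> ((H (\<xi>, \<eta>) - H (u0, v0)) *v k)\<bar>"
      by (simp add: matrix_vector_mult_diff_rdistrib inner_diff_right)
    also have "\<dots> \<le> norm h * norm ((H (\<xi>, \<eta>) - H (u0, v0)) *v k)"
      by (rule Cauchy_Schwarz_ineq2)
    also have "\<dots> \<le> norm h * (?n * norm (H (\<xi>, \<eta>) - H (u0, v0)) * norm k)"
      by (intro mult_left_mono norm_matrix_vector_mult_le) auto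
    also have "\<dots> \<le> norm h * (?n * (e / ?n) * norm k)"
    proof -
      have "dist (\<xi>, \<eta>) (u0, v0) \<le> dist \<xi> u0 + dist \<eta> v0"
        by (simp add: dist_Pair_Pair sqrt_sum_squares_le_sum)
      also have "\<dots> < s"
        using \<xi> \<eta> d by (simp add: dist_commute)
      finally have "norm (H (\<xi>, \<eta>) - H (u0, v0)) < e / ?n"
        using s(2) by (simp add: dist_norm)
      then show ?thesis
        by (intro mult_left_mono mult_right_mono) auto
    qed
    finally show ?thesis
      by (simp add: h_def k_def algebra_simps)
  qed
  then show ?thesis
    using d(1) by blast
qed

text \<open>Along a monotone graph \<open>v = g u\<close> the coordinate \<open>s = u - H g(u)\<close> controls \<open>u\<close>, as for the
  graph of a monotone map. Rademacher's theorem applies to the inverse \<open>s \<mapsto> u\<close>, and Sard's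
  theorem brings the result back to \<open>u\<close>.\<close>

lemma local_differentiable_AE_if_monotone:
  assumes S: "S \<subseteq> A" "g ` S \<subseteq> B" and g: "continuous_on S g" and u0: "u0 \<in> S"
    and mono: "\<And>u u'. u \<in> S \<Longrightarrow> u' \<in> S \<Longrightarrow> C (u, g u) + C (u', g u') \<le> C (u, g u') + C (u', g u)"
    and det: "det (H (u0, g u0)) \<noteq> 0"
  shows "\<exists>N. open N \<and> u0 \<in> N \<and> negligible {u \<in> S \<inter> N. \<not> g differentiable (at u within S)}"
proof -
  define W where "W = H (u0, g u0)"
  have "invertible W"
    using det by (simp add: W_def invertible_det_nz)
  then obtain W' where W': "W' ** W = mat 1"
    unfolding invertible_def by blast
  have inv: "W' *v (W *v k) = k" for k
    by (simp add: matrix_vector_mul_assoc W')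
  \<comment> \<open>A bound for the inverse of \<open>W\<close>; the added 1 makes it positive so
    that it can be divided by.\<close>
  define b where "b = real CARD('n) * norm W' + 1"
  have b: "0 < b"
    by (simp add: b_def add_nonneg_pos)
  have kb: "norm k \<le> b * norm (W *v k)" for k
  proof -
    have "norm k \<le> real CARD('n) * norm W' * norm (W *v k)"
      using norm_matrix_vector_mult_le[of W' "W *v k"] by (simp add: inv)
    also have "\<dots> \<le> b * norm (W *v k)"
      by (intro mult_right_mono) (auto simp: b_def)
    finally show ?thesis .
  qed
  \<comment> \<open>With this tolerance the error of the second difference is at most half of
    \<open>norm h * norm (W *v k)\<close>. Since the second difference is nonpositive by
    monotonicity, the angle between \<open>h\<close> and \<open>W *v k\<close> is then bounded away
    from 0.\<close>
  have "0 < 1 / (2 * b)" using b by simp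
  then obtain d where d: "0 < d" and md: "\<And>u u' v v'. \<lbrakk>u \<in> ball u0 d; u' \<in> ball u0 d; v \<in> ball (g u0) d; v' \<in> ball (g u0) d\<rbrakk> \<Longrightarrow>
    \<bar>C (u, v) - C (u, v') - C (u', v) + C (u', v') - (u - u') \<bullet> (W *v (v - v'))\<bar> \<le>
      1 / (2 * b) * norm (u - u') * norm (v - v')"
    using mixed_difference[of u0 "g u0" "1 / (2 * b)"] S u0 unfolding W_def by blast
  obtain \<delta> where \<delta>: "0 < \<delta>" "\<And>u. u \<in> S \<Longrightarrow> dist u u0 < \<delta> \<Longrightarrow> dist (g u) (g u0) < d"
    using g u0 d unfolding continuous_on_iff by blast
  define N where "N = ball u0 (min \<delta> d)"
  define s where "s u = u - W *v g u" for u
  let ?S = "S \<inter> N"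
  have expand: "norm (u - u') \<le> 2 * norm (s u - s u')" if u: "u \<in> ?S" "u' \<in> ?S" for u u'
  proof -
    define h where "h = u - u'"
    define k where "k = g u - g u'"
    have "\<bar>C (u, g u) - C (u, g u') - C (u', g u) + C (u', g u') - h \<bullet> (W *v k)\<bar> \<le>
        1 / (2 * b) * norm h * norm k"
    proof -
      have "u \<in> ball u0 d" "u' \<in> ball u0 d" "g u \<in> ball (g u0) d" "g u' \<in> ball (g u0) d"
        using u \<delta>(2)[of u] \<delta>(2)[of u'] by (simp_all add: N_def dist_commute)
      then show ?thesis
        unfolding h_def k_def by (rule md)
    qed
    moreover have "C (u, g u) + C (u', g u') \<le> C (u, g u') + C (u', g u)"
      using u by (intro mono) auto
    ultimately have "h \<bullet> (W *v k) \<le> 1 / (2 * b) * norm h * norm k"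
      by linarith
    also have "\<dots> \<le> 1 / (2 * b) * norm h * (b * norm (W *v k))"
      using b by (intro mult_left_mono kb) auto
    also have "\<dots> = norm h * norm (W *v k) / 2"
      using b by simp
    finally have hW: "h \<bullet> (W *v k) \<le> norm h * norm (W *v k) / 2" .
    have "s u - s u' = h - W *v k"
      by (simp add: s_def h_def k_def matrix_vector_mult_diff_distrib)
    then have "(norm (s u - s u'))\<^sup>2 = (norm h)\<^sup>2 - 2 * (h \<bullet> (W *v k)) + (norm (W *v k))\<^sup>2"
      by (simp add: power2_norm_eq_inner inner_diff_left inner_diff_right inner_commute)
    also have "\<dots> \<ge> (norm h)\<^sup>2 - norm h * norm (W *v k) + (norm (W *v k))\<^sup>2"
      using hW by simp
    \<comment> \<open>Completing the square gives \<open>norm h\<close> at most 2 / sqrt 3 times the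
      increment of \<open>s\<close>; the constant is rounded up to 2.\<close>
    moreover have "(norm h)\<^sup>2 - norm h * norm (W *v k) + (norm (W *v k))\<^sup>2 =
        (norm h / 2 - norm (W *v k))\<^sup>2 + 3 / 4 * (norm h)\<^sup>2"
      by (simp add: power2_eq_square algebra_simps)
    moreover have "0 \<le> (norm h / 2 - norm (W *v k))\<^sup>2" "0 \<le> (norm h)\<^sup>2"
      by simp_all
    ultimately have "(norm h)\<^sup>2 \<le> 4 * (norm (s u - s u'))\<^sup>2"
      by linarith
    then have "(norm h)\<^sup>2 \<le> (2 * norm (s u - s u'))\<^sup>2"
      by (simp add: power_mult_distrib)
    then show ?thesis
      unfolding h_def by (rule power2_le_imp_le) simp
  qed
  have inj: "inj_on s ?S"
  proof (rule inj_onI)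
    fix u u' assume "u \<in> ?S" "u' \<in> ?S" "s u = s u'"
    then show "u = u'"
      using expand[of u u'] by simp
  qed
  define a where "a = inv_into ?S s"
  let ?\<Sigma> = "s ` ?S"
  have as: "a (s u) = u" if "u \<in> ?S" for u
    using that inj by (simp add: a_def)
  have sa: "s (a \<sigma>) = \<sigma>" "a \<sigma> \<in> ?S" if "\<sigma> \<in> ?\<Sigma>" for \<sigma>
    using that unfolding a_def by (simp_all only: f_inv_into_f inv_into_into)
  have a\<Sigma>: "a ` ?\<Sigma> = ?S"
    using as by (force simp: image_iff)
  have lip: "norm (a \<sigma> - a \<tau>) \<le> 2 * norm (\<sigma> - \<tau>)" if "\<sigma> \<in> ?\<Sigma>" "\<tau> \<in> ?\<Sigma>" for \<sigma> \<tau>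
    using expand[OF sa(2)[OF that(1)] sa(2)[OF that(2)]] sa(1)[OF that(1)] sa(1)[OF that(2)] by simp
  define X where "X = {\<sigma> \<in> ?\<Sigma>. \<not> a differentiable (at \<sigma> within ?\<Sigma>)}"
  have "negligible X"
    unfolding X_def by (rule Rademacher_within[OF lip]) auto
  \<comment> \<open>Null sets of parameters give null sets of points, as \<open>a\<close> is
    Lipschitz between spaces of equal dimension.\<close>
  then have X: "negligible (a ` X)"
  proof (rule negligible_locally_Lipschitz_image[rotated])
    fix \<sigma> assume "\<sigma> \<in> X"
    then show "\<exists>T B. open T \<and> \<sigma> \<in> T \<and> (\<forall>\<tau>\<in>X \<inter> T. norm (a \<tau> - a \<sigma>) \<le> B * norm (\<tau> - \<sigma>))"
      by (intro exI[of _ UNIV] exI[of _ 2]) (auto simp: X_def intro: lip)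
  qed simp
  have "\<exists>M. (a has_derivative (*v) M) (at \<sigma> within ?\<Sigma>)" if \<sigma>: "\<sigma> \<in> ?\<Sigma> - X" for \<sigma>
  proof -
    obtain L where L: "(a has_derivative L) (at \<sigma> within ?\<Sigma>)"
      using \<sigma> unfolding X_def differentiable_def by blast
    then show ?thesis
      using has_derivative_matrix by blast
  qed
  then obtain M where M: "\<And>\<sigma>. \<sigma> \<in> ?\<Sigma> - X \<Longrightarrow> (a has_derivative (*v) (M \<sigma>)) (at \<sigma> within ?\<Sigma>)"
    by metis
  \<comment> \<open>Where the derivative of \<open>a\<close> is singular, its inverse
    \<open>s\<close> cannot be differentiated in this way; Sard's theorem discards the corresponding
    points \<open>a \<sigma>\<close>, whatever the size of \<open>Z\<close> itself.\<close>
  define Z where "Z = {\<sigma> \<in> ?\<Sigma> - X. det (M \<sigma>) = 0}"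
  have Z: "negligible (a ` Z)"
  proof (rule negligible_image_det_0)
    fix \<sigma> assume "\<sigma> \<in> Z"
    then have "\<sigma> \<in> ?\<Sigma> - X" "Z \<subseteq> ?\<Sigma>"
      unfolding Z_def by blast+
    then show "(a has_derivative (*v) (M \<sigma>)) (at \<sigma> within Z)"
      by (rule has_derivative_subset[OF M])
  qed (simp add: Z_def)
  have diff: "g differentiable (at u within S)" if u: "u \<in> ?S" "u \<notin> a ` X" "u \<notin> a ` Z" for u
  proof -
    have su: "s u \<in> ?\<Sigma> - X" "det (M (s u)) \<noteq> 0"
    proof -
      show "s u \<in> ?\<Sigma> - X"
        using u as[OF u(1)] by force
      then show "det (M (s u)) \<noteq> 0"
        using u(3) as[OF u(1)] unfolding Z_def by force
    qed
    then obtain M' where M': "M' ** M (s u) = mat 1"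
      using invertible_det_nz[of "M (s u)"] unfolding invertible_def by blast
    have gc: "continuous_on ?S s"
      unfolding s_def by (intro continuous_intros continuous_on_subset[OF g] bounded_linear.continuous_on[OF matrix_vector_mul_bounded_linear]) auto
    \<comment> \<open>Here \<open>s\<close> is the continuous inverse of \<open>a\<close>, whose
      derivative at \<open>s u\<close> is invertible.\<close>
    have "(s has_derivative (*v) M') (at (a (s u)) within a ` ?\<Sigma>)"
    proof (rule has_derivative_inverse_within)
      show "(a has_derivative (*v) (M (s u))) (at (s u) within ?\<Sigma>)"
        using M su by blast
      show "continuous (at (a (s u)) within a ` ?\<Sigma>) s"
        unfolding a\<Sigma> as[OF u(1)] using gc u(1) by (simp add: continuous_on_eq_continuous_within)
      show "(*v) M' \<circ> (*v) (M (s u)) = id"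
        by (simp add: fun_eq_iff matrix_vector_mul_assoc M')
    qed (use su sa in auto)
    then have s': "(s has_derivative (*v) M') (at u within ?S)"
      by (simp only: a\<Sigma> as[OF u(1)])
    \<comment> \<open>By invertibility of \<open>W\<close> the map \<open>g\<close> is recovered
      from \<open>s\<close> by solving its defining equation.\<close>
    have "((\<lambda>u. W' *v (u - s u)) has_derivative (\<lambda>h. W' *v (h - M' *v h))) (at u within ?S)"
      by (rule bounded_linear.has_derivative[OF matrix_vector_mul_bounded_linear has_derivative_diff[OF has_derivative_ident s']])
    moreover have "(\<lambda>u. W' *v (u - s u)) = g"
      by (simp add: s_def inv)
    ultimately have "g differentiable (at u within ?S)"
      by (auto simp: differentiable_def)
    moreover have "at u within ?S = at u within S"
      using u(1) by (intro at_within_nhd[of u N]) (auto simp: N_def)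
    ultimately show ?thesis by simp
  qed
  show ?thesis
  proof (intro exI conjI)
    show "open N" "u0 \<in> N"
      using \<delta> d by (auto simp: N_def)
    show "negligible {u \<in> S \<inter> N. \<not> g differentiable (at u within S)}"
      by (rule negligible_subset[OF negligible_Un[OF X Z]]) (use diff in blast)
  qed
qed

text \<open>The local neighbourhoods depend on the point; by Lindelof's theorem countably many of
  them suffice, and so do countably many null sets.\<close>

lemma differentiable_AE_if_monotone:
  assumes S: "S \<subseteq> A" "g ` S \<subseteq> B" and g: "continuous_on S g"
    and mono: "\<And>u u'. u \<in> S \<Longrightarrow> u' \<in> S \<Longrightarrow> C (u, g u) + C (u', g u') \<le> C (u, g u') + C (u', g u)"
    and det: "\<And>u. u \<in> S \<Longrightarrow> det (H (u, g u)) \<noteq> 0"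
  shows "negligible {u \<in> S. \<not> g differentiable (at u within S)}"
proof -
  have "\<forall>u\<in>S. \<exists>N. open N \<and> u \<in> N \<and> negligible {u \<in> S \<inter> N. \<not> g differentiable (at u within S)}"
    using local_differentiable_AE_if_monotone[OF S g _ mono] det by blast
  then obtain N where N: "\<forall>u\<in>S. open (N u) \<and> u \<in> N u \<and> negligible {w \<in> S \<inter> N u. \<not> g differentiable (at w within S)}"
    by (elim bchoice[THEN exE])
  have opn: "open X" if "X \<in> N ` S" for X
    using that N by blast
  obtain F where F: "F \<subseteq> N ` S" "countable F" "\<Union>F = \<Union>(N ` S)"
    by (rule Lindelof[OF opn])
  have "negligible (\<Union>X\<in>F. {w \<in> S \<inter> X. \<not> g differentiable (at w within S)})"
    using F(1,2) N by (intro negligible_countable_Union countable_image) auto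
  moreover have "{u \<in> S. \<not> g differentiable (at u within S)} \<subseteq> (\<Union>X\<in>F. {w \<in> S \<inter> X. \<not> g differentiable (at w within S)})"
  proof
    fix u assume u: "u \<in> {u \<in> S. \<not> g differentiable (at u within S)}"
    then have "u \<in> \<Union>F"
      unfolding F(3) using N by blast
    then show "u \<in> (\<Union>X\<in>F. {w \<in> S \<inter> X. \<not> g differentiable (at w within S)})"
      using u by blast
  qed
  ultimately show ?thesis
    by (rule negligible_subset)
qed

end


section \<open>The support of an optimizer\<close>

text \<open>Two points of the support which could be exchanged at a profit are surrounded by open
  sets of positive mass whose points can be exchanged as well. The competitor takes two independent
  samples of \<open>\<gamma>\<close> and keeps the first one, after exchanging the second coordinates whenever the
  two samples fall into these open sets.\<close>

lemma optimizer_support_monotone: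
  fixes \<mu> :: "'a::{t2_space, second_countable_topology} measure"
    and \<nu> :: "'b::{t2_space, second_countable_topology} measure"
  assumes opt: "kantorovich_optimizer \<mu> \<nu> c \<gamma>" and \<mu>: "borel_probability \<mu>"
    and c: "continuous_on UNIV c"
    and supp: "(x1, y1) \<in> measure_support \<gamma>" "(x2, y2) \<in> measure_support \<gamma>"
  shows "c (x1, y1) + c (x2, y2) \<le> c (x1, y2) + c (x2, y1)"
proof (rule ccontr)
  define \<delta> where "\<delta> = c (x1, y1) + c (x2, y2) - c (x1, y2) - c (x2, y1)"
  assume "\<not> c (x1, y1) + c (x2, y2) \<le> c (x1, y2) + c (x2, y1)"
  then have \<delta>: "0 < \<delta>" by (simp add: \<delta>_def)
  \<comment> \<open>Four values of the cost vary by less than \<delta> / 8 each, so at least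
    \<delta> / 2 of the profit \<delta> survives.\<close>
  have near: "\<exists>U V. open U \<and> open V \<and> x \<in> U \<and> y \<in> V \<and> (\<forall>u\<in>U. \<forall>v\<in>V. \<bar>c (u, v) - c (x, y)\<bar> < \<delta> / 8)" for x y
  proof -
    have "open (c -` ball (c (x, y)) (\<delta> / 8))"
      using c by (intro open_vimage) auto
    moreover have "(x, y) \<in> c -` ball (c (x, y)) (\<delta> / 8)"
      using \<delta> by simp
    ultimately obtain U V where "open U" "open V" "(x, y) \<in> U \<times> V" "U \<times> V \<subseteq> c -` ball (c (x, y)) (\<delta> / 8)"
      by (rule open_prod_elim)
    then show ?thesis
      by (intro exI[of _ U] exI[of _ V]) (auto simp: dist_real_def abs_minus_commute subset_iff)
  qed
  obtain U11 V11 where n11: "open U11" "open V11" "x1 \<in> U11" "y1 \<in> V11" "\<And>u v. u \<in> U11 \<Longrightarrow> v \<in> V11 \<Longrightarrow> \<bar>c (u, v) - c (x1, y1)\<bar> < \<delta> / 8"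
    using near[of x1 y1] by blast
  obtain U12 V12 where n12: "open U12" "open V12" "x1 \<in> U12" "y2 \<in> V12" "\<And>u v. u \<in> U12 \<Longrightarrow> v \<in> V12 \<Longrightarrow> \<bar>c (u, v) - c (x1, y2)\<bar> < \<delta> / 8"
    using near[of x1 y2] by blast
  obtain U21 V21 where n21: "open U21" "open V21" "x2 \<in> U21" "y1 \<in> V21" "\<And>u v. u \<in> U21 \<Longrightarrow> v \<in> V21 \<Longrightarrow> \<bar>c (u, v) - c (x2, y1)\<bar> < \<delta> / 8"
    using near[of x2 y1] by blast
  obtain U22 V22 where n22: "open U22" "open V22" "x2 \<in> U22" "y2 \<in> V22" "\<And>u v. u \<in> U22 \<Longrightarrow> v \<in> V22 \<Longrightarrow> \<bar>c (u, v) - c (x2, y2)\<bar> < \<delta> / 8"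
    using near[of x2 y2] by blast
  \<comment> \<open>The intersections put all four pairings of coordinates from the two sets,
    exchanged or not, into the range of the estimates.\<close>
  define W1 where "W1 = (U11 \<inter> U12) \<times> (V11 \<inter> V21)"
  define W2 where "W2 = (U21 \<inter> U22) \<times> (V12 \<inter> V22)"
  have W: "open W1" "open W2" "(x1, y1) \<in> W1" "(x2, y2) \<in> W2"
    using n11 n12 n21 n22 by (auto simp: W1_def W2_def intro!: open_Times)
  have Wb: "W1 \<in> sets borel" "W2 \<in> sets borel"
    using W by auto
  have W_pos: "0 < emeasure \<gamma> W1" "0 < emeasure \<gamma> W2"
    using supp W by (auto simp: measure_support_def)
  have sets: "sets \<gamma> = sets borel" and space: "space \<gamma> = UNIV"
    and marg: "\<And>A. A \<in> sets borel \<Longrightarrow> emeasure \<gamma> (A \<times> UNIV) = emeasure \<mu> A"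
      "\<And>B. B \<in> sets borel \<Longrightarrow> emeasure \<gamma> (UNIV \<times> B) = emeasure \<nu> B"
    and int: "integrable \<gamma> c"
    using opt sets_eq_imp_space_eq[of \<gamma> borel] by (auto simp: kantorovich_optimizer_def coupling_def)
  have \<gamma>1: "emeasure \<gamma> UNIV = 1"
    using marg(1)[of UNIV] \<mu> by (simp add: borel_probability_def)
  interpret \<gamma>: finite_measure \<gamma>
    by (rule finite_measureI) (simp add: space \<gamma>1)
  interpret P: pair_sigma_finite \<gamma> \<gamma> ..
  let ?P = "\<gamma> \<Otimes>\<^sub>M \<gamma>"
  have Psets: "sets ?P = sets borel"
    unfolding borel_prod[symmetric] by (intro sets_pair_measure_cong) (simp_all only: sets borel_prod)
  have Pspace: "space ?P = UNIV"
    by (simp add: space_pair_measure space)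
  have P_Times: "emeasure ?P (A \<times> B) = emeasure \<gamma> A * emeasure \<gamma> B" if "A \<in> sets borel" "B \<in> sets borel" for A B
    using that sets by (intro \<gamma>.emeasure_pair_measure_Times) auto
  interpret P: finite_measure ?P
    using P_Times[of UNIV UNIV] by (intro finite_measureI) (simp add: Pspace \<gamma>1)
  \<comment> \<open>Both orders of the samples are included: the resulting symmetry under the
    exchange of the samples is what preserves the second marginal.\<close>
  define S where "S = W1 \<times> W2 \<union> W2 \<times> W1"
  have S: "S \<in> sets ?P"
    using W unfolding Psets S_def by (intro borel_open open_Un open_Times)
  define \<Phi> where "\<Phi> z = (if z \<in> S then (fst (fst z), snd (snd z)) else fst z)" for z :: "('a \<times> 'b) \<times> ('a \<times> 'b)"
  have meas_cont: "f \<in> measurable ?P borel" if "continuous_on UNIV f" for f :: "('a \<times> 'b) \<times> ('a \<times> 'b) \<Rightarrow> 'c::topological_space"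
    using borel_measurable_continuous_onI[OF that] by (simp cong: measurable_cong_sets add: Psets)
  have \<Phi>: "\<Phi> \<in> measurable ?P borel"
    unfolding \<Phi>_def using S Pspace by (intro measurable_If_set meas_cont continuous_intros) auto
  let ?swap = "\<lambda>(z, w). (w, z) :: ('a \<times> 'b) \<times> ('a \<times> 'b)"
  have swap: "distr ?P ?P ?swap = ?P"
    using P.distr_pair_swap by simp
  have swap_meas: "?swap \<in> measurable ?P ?P"
    by (rule measurable_pair_swap')
  have swapS: "?swap z \<in> S \<longleftrightarrow> z \<in> S" for z
    by (auto simp: S_def split: prod.split)
  define \<gamma>' where "\<gamma>' = distr ?P borel \<Phi>"
  have "coupling \<mu> \<nu> \<gamma>'"
    unfolding coupling_def
  proof (intro conjI ballI)
    show "sets \<gamma>' = sets borel"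
      by (simp add: \<gamma>'_def)
    fix A :: "'a set" assume A: "A \<in> sets borel"
    have "A \<times> (UNIV :: 'b set) \<in> sets borel"
      using A by (simp flip: borel_prod)
    then have "emeasure \<gamma>' (A \<times> UNIV) = emeasure ?P (\<Phi> -` (A \<times> UNIV) \<inter> space ?P)"
      unfolding \<gamma>'_def by (intro emeasure_distr \<Phi>)
    also have "\<Phi> -` (A \<times> UNIV) \<inter> space ?P = (A \<times> UNIV) \<times> UNIV"
      by (auto simp: \<Phi>_def Pspace split: if_splits)
    also have "emeasure ?P \<dots> = emeasure \<mu> A"
      using \<open>A \<times> UNIV \<in> sets borel\<close> by (simp add: P_Times \<gamma>1 marg A)
    finally show "emeasure \<gamma>' (A \<times> UNIV) = emeasure \<mu> A" .
  next
    fix B :: "'b set" assume B: "B \<in> sets borel"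
    have UB: "(UNIV :: 'a set) \<times> B \<in> sets borel"
      using B by (simp flip: borel_prod)
    let ?B1 = "(UNIV \<times> B) \<times> UNIV" and ?B2 = "UNIV \<times> (UNIV \<times> B)"
    have B12: "?B1 \<in> sets ?P" "?B2 \<in> sets ?P"
      using UB sets by (auto intro!: pair_measureI)
    have "emeasure \<gamma>' (UNIV \<times> B) = emeasure ?P (\<Phi> -` (UNIV \<times> B) \<inter> space ?P)"
      unfolding \<gamma>'_def using UB by (intro emeasure_distr \<Phi>)
    \<comment> \<open>On \<open>S\<close> the second coordinate comes from the second sample,
      elsewhere from the first. Exchanging the samples preserves the product measure and
      \<open>S\<close>, and so replaces the first part by the missing piece of
      \<open>?B1\<close>.\<close>
    also have "\<Phi> -` (UNIV \<times> B) \<inter> space ?P = (S \<inter> ?B2) \<union> (?B1 - S)"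
      by (auto simp: \<Phi>_def Pspace split: if_splits)
    also have "emeasure ?P \<dots> = emeasure ?P (S \<inter> ?B2) + emeasure ?P (?B1 - S)"
      using S B12 by (intro plus_emeasure[symmetric]) auto
    also have "emeasure ?P (S \<inter> ?B2) = emeasure (distr ?P ?P ?swap) (S \<inter> ?B2)"
      by (simp add: swap)
    also have "\<dots> = emeasure ?P (?swap -` (S \<inter> ?B2) \<inter> space ?P)"
      using S B12 by (intro emeasure_distr swap_meas) auto
    also have "?swap -` (S \<inter> ?B2) \<inter> space ?P = S \<inter> ?B1"
      by (auto simp: Pspace S_def)
    also have "emeasure ?P (S \<inter> ?B1) + emeasure ?P (?B1 - S) = emeasure ?P ((S \<inter> ?B1) \<union> (?B1 - S))"
      using S B12 by (intro plus_emeasure) auto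
    also have "(S \<inter> ?B1) \<union> (?B1 - S) = ?B1"
      by blast
    also have "emeasure ?P ?B1 = emeasure \<nu> B"
      using UB by (simp add: P_Times \<gamma>1 marg B)
    finally show "emeasure \<gamma>' (UNIV \<times> B) = emeasure \<nu> B" .
  qed
  \<comment> \<open>\<open>f\<close> is the saving made by the competitor. It vanishes off
    \<open>S\<close> and is bounded on \<open>S\<close>, where the four costs are nearly constant,
    so the competitor also has finite cost.\<close>
  define f where "f z = indicator S z * (c (fst z) - c (fst (fst z), snd (snd z)))" for z
  have f_meas: "f \<in> borel_measurable ?P"
    unfolding f_def using S
    by (intro borel_measurable_times borel_measurable_indicator meas_cont continuous_intros
        continuous_on_compose2[OF c]) auto
  define K where "K = \<bar>c (x1, y1)\<bar> + \<bar>c (x1, y2)\<bar> + \<bar>c (x2, y1)\<bar> + \<bar>c (x2, y2)\<bar> + \<delta>"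
  have tri: "\<bar>a - b\<bar> \<le> \<bar>a'\<bar> + \<bar>b'\<bar> + \<delta>" if "\<bar>a - a'\<bar> < \<delta> / 8" "\<bar>b - b'\<bar> < \<delta> / 8" for a a' b b' :: real
    using that \<delta> by (simp add: abs_if split: if_splits)
  have gain: "\<delta> / 2 \<le> a - b + (a2 - b2)"
    if "\<bar>a - c (x1, y1)\<bar> < \<delta> / 8" "\<bar>a2 - c (x2, y2)\<bar> < \<delta> / 8" "\<bar>b - c (x1, y2)\<bar> < \<delta> / 8" "\<bar>b2 - c (x2, y1)\<bar> < \<delta> / 8" for a b a2 b2
    using that unfolding abs_less_iff \<delta>_def by (simp add: field_simps)
  \<comment> \<open>A single sample pair shows only one half of the exchange and may lose; together
    with the pair in reversed order the whole profit appears.\<close>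
  have f_bound: "\<bar>f z\<bar> \<le> K" and f_gain: "\<delta> / 2 * indicator S z \<le> f z + f (?swap z)" for z
  proof -
    obtain u v u' v' where z: "z = ((u, v), (u', v'))"
      by (metis surj_pair)
    have "\<bar>f z\<bar> \<le> K \<and> \<delta> / 2 * indicator S z \<le> f z + f (?swap z)"
    proof (cases "z \<in> S")
      case True
      then consider "u \<in> U11 \<inter> U12" "v \<in> V11 \<inter> V21" "u' \<in> U21 \<inter> U22" "v' \<in> V12 \<inter> V22"
        | "u \<in> U21 \<inter> U22" "v \<in> V12 \<inter> V22" "u' \<in> U11 \<inter> U12" "v' \<in> V11 \<inter> V21"
        by (auto simp: z S_def W1_def W2_def)
      then show ?thesis
      proof cases
        case 1
        then have n: "\<bar>c (u, v) - c (x1, y1)\<bar> < \<delta> / 8" "\<bar>c (u, v') - c (x1, y2)\<bar> < \<delta> / 8"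
          "\<bar>c (u', v) - c (x2, y1)\<bar> < \<delta> / 8" "\<bar>c (u', v') - c (x2, y2)\<bar> < \<delta> / 8"
          using n11(5) n12(5) n21(5) n22(5) by blast+
        have f: "f z = c (u, v) - c (u, v')" "f (?swap z) = c (u', v') - c (u', v)" "indicator S z = (1::real)"
          using True swapS[of z] by (simp_all add: f_def z)
        have "0 \<le> \<bar>c (x2, y1)\<bar>" "0 \<le> \<bar>c (x2, y2)\<bar>"
          by simp_all
        then show ?thesis
          unfolding f K_def mult_1_right using tri[OF n(1) n(2)] gain[OF n(1) n(4) n(2) n(3)] by linarith
      next
        case 2
        then have n: "\<bar>c (u', v') - c (x1, y1)\<bar> < \<delta> / 8" "\<bar>c (u', v) - c (x1, y2)\<bar> < \<delta> / 8"
          "\<bar>c (u, v') - c (x2, y1)\<bar> < \<delta> / 8" "\<bar>c (u, v) - c (x2, y2)\<bar> < \<delta> / 8"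
          using n11(5) n12(5) n21(5) n22(5) by blast+
        have f: "f z = c (u, v) - c (u, v')" "f (?swap z) = c (u', v') - c (u', v)" "indicator S z = (1::real)"
          using True swapS[of z] by (simp_all add: f_def z)
        have "0 \<le> \<bar>c (x1, y1)\<bar>" "0 \<le> \<bar>c (x1, y2)\<bar>"
          by simp_all
        then show ?thesis
          unfolding f K_def mult_1_right using tri[OF n(4) n(3)] gain[OF n(1) n(4) n(2) n(3)] by linarith
      qed
    next
      case False
      then show ?thesis
        using \<delta> swapS[of z] by (simp add: f_def K_def)
    qed
    then show "\<bar>f z\<bar> \<le> K" "\<delta> / 2 * indicator S z \<le> f z + f (?swap z)"
      by blast+
  qed
  have f_int: "integrable ?P f"
    using f_bound f_meas by (intro P.integrable_const_bound[of _ K]) auto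
  have fst_meas: "fst \<in> measurable ?P \<gamma>"
    by (rule measurable_fst)
  have "distr ?P \<gamma> fst = \<gamma>"
  proof (rule measure_eqI)
    fix A assume "A \<in> sets (distr ?P \<gamma> fst)"
    then have A: "A \<in> sets borel" by (simp add: sets)
    then have "emeasure (distr ?P \<gamma> fst) A = emeasure ?P (fst -` A \<inter> space ?P)"
      by (intro emeasure_distr fst_meas) (simp add: sets)
    also have "fst -` A \<inter> space ?P = A \<times> UNIV"
      by (auto simp: Pspace)
    finally show "emeasure (distr ?P \<gamma> fst) A = emeasure \<gamma> A"
      using A by (simp add: P_Times \<gamma>1)
  qed simp
  then have c_fst: "integrable ?P (\<lambda>z. c (fst z))" "(\<integral>z. c (fst z) \<partial>?P) = (\<integral>z. c z \<partial>\<gamma>)"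
    using integrable_distr[OF fst_meas, of c] integral_distr[OF fst_meas, of c] int by auto
  have c\<Phi>: "c (\<Phi> z) = c (fst z) - f z" for z
    by (simp add: \<Phi>_def f_def)
  have c_meas: "c \<in> borel_measurable borel"
    using c by (rule borel_measurable_continuous_onI)
  have "integrable \<gamma>' c"
    unfolding \<gamma>'_def using c_fst f_int by (simp add: integrable_distr_eq[OF \<Phi> c_meas] c\<Phi>)
  then have "(\<integral>z. c z \<partial>\<gamma>) \<le> (\<integral>z. c z \<partial>\<gamma>')"
    using opt \<open>coupling \<mu> \<nu> \<gamma>'\<close> by (simp add: kantorovich_optimizer_def)
  also have "\<dots> = (\<integral>z. c z \<partial>\<gamma>) - (\<integral>z. f z \<partial>?P)"
    unfolding \<gamma>'_def using c_fst f_int by (simp add: integral_distr[OF \<Phi> c_meas] c\<Phi>)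
  finally have "(\<integral>z. f z \<partial>?P) \<le> 0"
    by simp
  moreover have f_swap: "integrable ?P (\<lambda>z. f (?swap z))" "(\<integral>z. f (?swap z) \<partial>?P) = (\<integral>z. f z \<partial>?P)"
    using integrable_distr[OF swap_meas, of f] integral_distr[OF swap_meas f_meas] f_int by (simp_all add: swap)
  moreover have "(\<integral>z. \<delta> / 2 * indicator S z \<partial>?P) \<le> (\<integral>z. f z + f (?swap z) \<partial>?P)"
    using S f_int f_swap f_gain by (intro integral_mono) (auto simp: P.emeasure_eq_measure)
  moreover have "(\<integral>z. \<delta> / 2 * indicator S z \<partial>?P) = \<delta> / 2 * measure ?P S"
    using S by simp
  ultimately have "\<delta> / 2 * measure ?P S \<le> 0"
    using f_int f_swap \<delta> by auto
  then have "measure ?P S = 0"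
    using \<delta> measure_nonneg[of ?P S] by (simp add: mult_le_0_iff)
  then have "emeasure ?P S = 0"
    by (simp add: P.emeasure_eq_measure)
  moreover have "emeasure ?P (W1 \<times> W2) \<le> emeasure ?P S"
    using S by (intro emeasure_mono) (auto simp: S_def)
  ultimately show False
    using W_pos Wb by (auto simp: P_Times)
qed

text \<open>By continuity relative to \<open>domT\<close>, the part of the graph over a small
  neighbourhood of \<open>x\<close> lies in the given neighbourhood of \<open>(x, T x)\<close>. As
  \<gamma> lives on the graph, the latter has at least the \<mu>-mass of the former, which is
  positive.\<close>

lemma graph_in_support:
  fixes \<mu> :: "'a::{t2_space, second_countable_topology} measure"
    and \<nu> :: "'b::{t2_space, second_countable_topology} measure"
  assumes \<gamma>: "coupling \<mu> \<nu> \<gamma>" and graph: "AE z in \<gamma>. z \<in> {(x, T x) |x. x \<in> domT}"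
    and T: "continuous_on domT T" and x: "x \<in> domT" "x \<in> measure_support \<mu>"
  shows "(x, T x) \<in> measure_support \<gamma>"
  unfolding measure_support_def
proof (intro CollectI allI impI)
  fix O' assume "open O'" "(x, T x) \<in> O'"
  then obtain U V where UV: "open U" "open V" "(x, T x) \<in> U \<times> V" "U \<times> V \<subseteq> O'"
    by (rule open_prod_elim)
  obtain U' where U': "open U'" "U' \<inter> domT = T -` V \<inter> domT"
    using T UV(2) by (metis continuous_on_open_invariant)
  have "x \<in> U \<inter> U'" "open (U \<inter> U')"
    using UV U' x by auto
  then have "0 < emeasure \<mu> (U \<inter> U')"
    using x(2) by (simp add: measure_support_def)
  also have "\<dots> = emeasure \<gamma> ((U \<inter> U') \<times> UNIV)"
    using \<gamma> \<open>open (U \<inter> U')\<close> by (simp add: coupling_def)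
  also have "\<dots> \<le> emeasure \<gamma> O'"
  proof (rule emeasure_mono_AE)
    show "AE z in \<gamma>. z \<in> (U \<inter> U') \<times> UNIV \<longrightarrow> z \<in> O'"
      using graph by (rule AE_mp) (use U' UV in \<open>auto intro!: AE_I2\<close>)
    show "O' \<in> sets \<gamma>"
      using \<gamma> \<open>open O'\<close> by (simp add: coupling_def)
  qed
  finally show "0 < emeasure \<gamma> O'" .
qed


section \<open>Volumes in charts\<close>

lemma is_chartD:
  assumes "is_chart (U, p)"
  shows "open U" "open (p ` U)" "continuous_on U p" "continuous_on (p ` U) (inv_into U p)" "inj_on p U"
  using assms by (auto simp: is_chart_def homeomorphism_def intro: inj_on_inverseI[of U "inv_into U p"])

locale volume_chart =
  fixes U :: "'a::{t2_space, second_countable_topology} set" and p :: "'a \<Rightarrow> real^'n::finite"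
    and vol :: "'a measure" and \<rho> :: "real^'n \<Rightarrow> real"
  assumes chart: "is_chart (U, p)" and sets_vol: "sets vol = sets borel"
    and density: "volume_density vol (U, p) \<rho>"
begin

abbreviation "p_inv \<equiv> inv_into U p"

lemmas open_U = is_chartD(1)[OF chart] and open_pU = is_chartD(2)[OF chart]
  and cont_p = is_chartD(3)[OF chart] and cont_p_inv = is_chartD(4)[OF chart]
  and inj_p = is_chartD(5)[OF chart]

lemma p_inv_p [simp]: "x \<in> U \<Longrightarrow> p_inv (p x) = x"
  using inj_p by simp

lemma p_p_inv [simp]: "u \<in> p ` U \<Longrightarrow> p (p_inv u) = u"
  by (simp add: f_inv_into_f)

lemma p_inv_in: "u \<in> p ` U \<Longrightarrow> p_inv u \<in> U"
  by (simp add: inv_into_into)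

lemma image_p_inv: "p_inv ` p ` Y = Y" if "Y \<subseteq> U"
  using that by (force simp: image_image)

lemma p_image_eq: "B \<subseteq> U \<Longrightarrow> p ` B = {u \<in> p ` U. p_inv u \<in> B}"
  by (auto simp: subset_iff)

lemma open_p_image:
  assumes "open W"
  shows "open (p ` (U \<inter> W))"
proof -
  have "open (p ` U \<inter> p_inv -` W)"
    using cont_p_inv open_pU assms by (rule continuous_open_preimage)
  also have "p ` U \<inter> p_inv -` W = p ` (U \<inter> W)"
    by auto
  finally show ?thesis .
qed

lemma \<rho>_pos: "u \<in> p ` U \<Longrightarrow> 0 < \<rho> u"
  and cont_\<rho>: "continuous_on (p ` U) \<rho>"
  and emeasure_vol: "B \<in> sets borel \<Longrightarrow> B \<subseteq> U \<Longrightarrow>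
    emeasure vol B = (\<integral>\<^sup>+u. ennreal (\<rho> u) * indicator (p ` B) u \<partial>lborel)"
  using density unfolding volume_density_def smooth_on_def by (auto dest: spec[of _ 0])

lemma space_vol: "space vol = UNIV"
  using sets_eq_imp_space_eq[OF sets_vol] by simp

lemma borel_p_inv: "(\<lambda>u. if u \<in> p ` U then p_inv u else y) \<in> borel_measurable borel"
  using cont_p_inv open_pU by (intro borel_measurable_continuous_on_if) auto

lemma borel_p_image:
  assumes "B \<in> sets borel" "B \<subseteq> U"
  shows "p ` B \<in> sets borel"
proof -
  define q where "q = (\<lambda>u. if u \<in> p ` U then p_inv u else undefined)"
  have "q -` B \<inter> space borel \<in> sets borel"
    unfolding q_def using assms by (intro measurable_sets[OF borel_p_inv])
  then have "(q -` B \<inter> space borel) \<inter> p ` U \<in> sets borel"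
    using open_pU by auto
  also have "(q -` B \<inter> space borel) \<inter> p ` U = p ` B"
    unfolding p_image_eq[OF assms(2)] by (auto simp: q_def)
  finally show ?thesis .
qed

lemma borel_p_preimage:
  assumes "Z \<in> sets borel"
  shows "U \<inter> p -` Z \<in> sets borel"
proof -
  define q where "q = (\<lambda>x. if x \<in> U then p x else 0)"
  have "q -` Z \<inter> space borel \<in> sets borel"
    unfolding q_def using assms cont_p open_U
    by (intro measurable_sets[OF borel_measurable_continuous_on_if]) auto
  then have "(q -` Z \<inter> space borel) \<inter> U \<in> sets borel"
    using open_U by auto
  also have "(q -` Z \<inter> space borel) \<inter> U = U \<inter> p -` Z"
    by (auto simp: q_def)
  finally show ?thesis .
qed

text \<open>Restricted to the chart domain, the volume is the image under \<open>p_inv\<close> of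
  Lebesgue measure with density \<rho>; the definition of a volume density says this for Borel
  sets.\<close>

lemma nn_integral_chart:
  assumes h: "h \<in> borel_measurable borel"
  shows "(\<integral>\<^sup>+x. h x * indicator U x \<partial>vol) = (\<integral>\<^sup>+u. h (p_inv u) * ennreal (\<rho> u) * indicator (p ` U) u \<partial>lborel)"
proof -
  \<comment> \<open>The inverse chart is extended to the whole space to be Borel there. Its value
    outside the chart image is immaterial, because the extended density \<open>r\<close> vanishes
    there.\<close>
  define q where "q = (\<lambda>u. if u \<in> p ` U then p_inv u else undefined)"
  define r where "r = (\<lambda>u. if u \<in> p ` U then \<rho> u else 0)"
  have q: "q \<in> borel_measurable borel"
    unfolding q_def by (rule borel_p_inv)
  have r: "r \<in> borel_measurable borel"
    unfolding r_def using cont_\<rho> open_pU by (intro borel_measurable_continuous_on_if) auto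
  let ?N = "distr (density lborel (\<lambda>u. ennreal (r u))) borel q"
  have q': "q \<in> measurable (density lborel (\<lambda>u. ennreal (r u))) borel"
    using q by simp
  have U: "U \<in> sets vol"
    using open_U by (simp add: sets_vol)
  have "density vol (indicator U) = ?N"
  proof (rule measure_eqI)
    fix B assume "B \<in> sets (density vol (indicator U))"
    then have B: "B \<in> sets borel" by (simp add: sets_vol)
    then have BU: "B \<inter> U \<in> sets borel"
      using open_U by auto
    have "emeasure (density vol (indicator U)) B = emeasure vol (B \<inter> U)"
      using emeasure_density[OF borel_measurable_indicator[OF U], of B] B BU
      by (simp add: sets_vol indicator_inter_arith[symmetric] Int_commute)
    also have "\<dots> = (\<integral>\<^sup>+u. ennreal (\<rho> u) * indicator (p ` (B \<inter> U)) u \<partial>lborel)"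
      using BU by (rule emeasure_vol) simp
    also have "\<dots> = (\<integral>\<^sup>+u. ennreal (r u) * indicator (q -` B) u \<partial>lborel)"
      unfolding p_image_eq[OF Int_lower2] by (intro nn_integral_cong) (auto simp: r_def q_def indicator_def p_inv_in)
    also have "\<dots> = emeasure (density lborel (\<lambda>u. ennreal (r u))) (q -` B \<inter> space borel)"
      using r measurable_sets[OF q B] by (subst emeasure_density) auto
    also have "\<dots> = emeasure ?N B"
      using B q' by (simp add: emeasure_distr)
    finally show "emeasure (density vol (indicator U)) B = emeasure ?N B" .
  qed (simp add: sets_vol)
  then have "(\<integral>\<^sup>+x. h x \<partial>density vol (indicator U)) = (\<integral>\<^sup>+x. h x \<partial>?N)"
    by simp
  moreover have "(\<integral>\<^sup>+x. h x \<partial>density vol (indicator U)) = (\<integral>\<^sup>+x. h x * indicator U x \<partial>vol)"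
    using h U measurable_cong_sets[OF sets_vol refl, of borel]
    by (subst nn_integral_density) (auto simp: mult.commute)
  moreover have "(\<integral>\<^sup>+x. h x \<partial>?N) = (\<integral>\<^sup>+u. h (q u) \<partial>density lborel (\<lambda>u. ennreal (r u)))"
    using h q' by (intro nn_integral_distr) auto
  moreover have "\<dots> = (\<integral>\<^sup>+u. ennreal (r u) * h (q u) \<partial>lborel)"
    using h q r by (intro nn_integral_density) auto
  moreover have "\<dots> = (\<integral>\<^sup>+u. h (p_inv u) * ennreal (\<rho> u) * indicator (p ` U) u \<partial>lborel)"
    by (intro nn_integral_cong) (auto simp: r_def q_def indicator_def mult.commute)
  ultimately show ?thesis by simp
qed

text \<open>The exceptional image is enclosed in a Borel null set, whose preimage under the chart is
  Borel and has volume 0 by the density formula.\<close>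

lemma AE_vol_if_negligible_p_image:
  assumes "negligible (p ` {x \<in> U. \<not> P x})"
  shows "AE x in vol. x \<in> U \<longrightarrow> P x"
proof -
  obtain Z where Z: "Z \<in> null_sets lborel" "p ` {x \<in> U. \<not> P x} \<subseteq> Z"
    using assms by (auto simp: negligible_iff_null_sets null_sets_completion_iff2)
  let ?N = "U \<inter> p -` Z"
  have N: "?N \<in> sets borel"
    using Z(1) by (intro borel_p_preimage) auto
  have "emeasure vol ?N = (\<integral>\<^sup>+u. ennreal (\<rho> u) * indicator (p ` ?N) u \<partial>lborel)"
    using N by (rule emeasure_vol) simp
  also have "\<dots> = (\<integral>\<^sup>+u. 0 \<partial>(lborel :: (real^'n) measure))"
  proof (rule nn_integral_cong_AE)
    have "AE u in lborel. u \<notin> Z"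
      using Z(1) by (rule AE_not_in)
    then show "AE u in lborel. ennreal (\<rho> u) * indicator (p ` ?N) u = 0"
      by (rule AE_mp) (auto intro!: AE_I2 simp: indicator_def)
  qed
  finally have "?N \<in> null_sets vol"
    using N by (simp add: null_sets_def sets_vol)
  then show ?thesis
    by (rule AE_I') (use Z(2) in auto)
qed

text \<open>Here positivity of \<rho> matters: a set of volume 0 in the chart can then have no
  Lebesgue measure in coordinates.\<close>

lemma negligible_p_image_if_AE_vol:
  assumes "AE x in vol. P x"
  shows "negligible (p ` {x \<in> U. \<not> P x})"
proof -
  obtain N where N: "N \<in> null_sets vol" "{x. \<not> P x} \<subseteq> N"
    using assms by (auto simp: eventually_ae_filter space_vol)
  then have NU: "N \<inter> U \<in> sets borel"
    using open_U by (auto simp: null_sets_def sets_vol)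
  have pN: "p ` (N \<inter> U) \<in> sets borel"
    using NU by (intro borel_p_image) auto
  have "emeasure vol (N \<inter> U) = 0"
    using N(1) NU emeasure_mono[of "N \<inter> U" N vol] by (auto simp: null_sets_def)
  then have "(\<integral>\<^sup>+u. ennreal (\<rho> u) * indicator (p ` (N \<inter> U)) u \<partial>lborel) = 0"
    using emeasure_vol[OF NU] by simp
  moreover have "(\<lambda>u. ennreal (\<rho> u) * indicator (p ` (N \<inter> U)) u) \<in> borel_measurable borel"
  proof -
    have "(\<lambda>u. ennreal (if u \<in> p ` U then \<rho> u else 0) * indicator (p ` (N \<inter> U)) u) \<in> borel_measurable borel"
      using pN cont_\<rho> open_pU
      by (intro borel_measurable_times_ennreal borel_measurable_indicator measurable_compose[OF borel_measurable_continuous_on_if measurable_ennreal]) auto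
    also have "(\<lambda>u. ennreal (if u \<in> p ` U then \<rho> u else 0) * indicator (p ` (N \<inter> U)) u) =
        (\<lambda>u. ennreal (\<rho> u) * indicator (p ` (N \<inter> U)) u)"
      by (auto simp: fun_eq_iff indicator_def)
    finally show ?thesis .
  qed
  ultimately have "AE u in lborel. ennreal (\<rho> u) * indicator (p ` (N \<inter> U)) u = 0"
    by (simp add: nn_integral_0_iff_AE)
  then have "AE u in lborel. u \<notin> p ` (N \<inter> U)"
  proof (rule AE_mp, intro AE_I2 impI notI)
    fix u assume "ennreal (\<rho> u) * indicator (p ` (N \<inter> U)) u = 0" and u: "u \<in> p ` (N \<inter> U)"
    then have "ennreal (\<rho> u) = 0" by simp
    moreover have "0 < \<rho> u"
      using u by (intro \<rho>_pos) auto
    ultimately show False by simp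
  qed
  then have "p ` (N \<inter> U) \<in> null_sets lborel"
    using pN by (simp add: AE_iff_null_sets)
  then have "negligible (p ` (N \<inter> U))"
    by (simp add: negligible_iff_null_sets null_sets_completionI)
  then show ?thesis
    by (rule negligible_subset) (use N(2) in auto)
qed

text \<open>In coordinates the two densities multiply, and finiteness of the mass of
  \<open>U\<close> makes the product absolutely integrable.\<close>

lemma density_in_chart:
  fixes f :: "'a \<Rightarrow> real"
  assumes f: "f \<in> borel_measurable borel" and nonneg: "AE x in vol. 0 \<le> f x"
    and finite: "emeasure (density vol (\<lambda>x. ennreal (f x))) U < \<infinity>" and B: "B \<in> sets borel" "B \<subseteq> U"
  shows "(\<lambda>u. f (p_inv u) * \<rho> u) absolutely_integrable_on p ` B" (is ?int)
    and "integral (p ` B) (\<lambda>u. f (p_inv u) * \<rho> u) = measure (density vol (\<lambda>x. ennreal (f x))) B" (is ?eq)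
proof -
  \<comment> \<open>Cut off to the image of \<open>B\<close>, the product is Borel on the whole
    space and passes between Lebesgue measure and its completion.\<close>
  define G where "G u = indicator (p ` B) u * (f (p_inv u) * \<rho> u)" for u
  have pB: "p ` B \<in> sets borel"
    using B by (rule borel_p_image)
  have f_vol: "f \<in> borel_measurable vol"
    using f sets_vol by (simp cong: measurable_cong_sets)
  have G: "G \<in> borel_measurable borel"
  proof -
    have "(\<lambda>u. indicator (p ` B) u * (f (if u \<in> p ` U then p_inv u else undefined) * (if u \<in> p ` U then \<rho> u else 0))) \<in> borel_measurable borel"
      using pB cont_\<rho> open_pU
      by (intro borel_measurable_times borel_measurable_indicator borel_measurable_continuous_on_if
          measurable_compose[OF borel_p_inv f]) auto
    also have "(\<lambda>u. indicator (p ` B) u * (f (if u \<in> p ` U then p_inv u else undefined) * (if u \<in> p ` U then \<rho> u else 0))) = G"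
      using B(2) by (auto simp: G_def fun_eq_iff indicator_def)
    finally show ?thesis .
  qed
  have "negligible (p ` {x \<in> U. \<not> 0 \<le> f x})"
    using nonneg by (rule negligible_p_image_if_AE_vol)
  moreover have "p ` {x \<in> U. \<not> 0 \<le> f x} \<in> sets borel"
  proof (rule borel_p_image)
    have "f -` {..<0} \<inter> space borel \<in> sets borel"
      by (intro measurable_sets[OF f]) auto
    then have "U \<inter> (f -` {..<0} \<inter> space borel) \<in> sets borel"
      using open_U by auto
    also have "U \<inter> (f -` {..<0} \<inter> space borel) = {x \<in> U. \<not> 0 \<le> f x}"
      by auto
    finally show "{x \<in> U. \<not> 0 \<le> f x} \<in> sets borel" .
  qed auto
  ultimately have "p ` {x \<in> U. \<not> 0 \<le> f x} \<in> null_sets lborel"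
    by (simp add: negligible_iff_emeasure0 null_sets_def)
  then have "AE u in lborel. u \<notin> p ` {x \<in> U. \<not> 0 \<le> f x}"
    by (rule AE_not_in)
  then have G0: "AE u in lborel. 0 \<le> G u"
  proof (rule AE_mp, intro AE_I2 impI)
    fix u assume u: "u \<notin> p ` {x \<in> U. \<not> 0 \<le> f x}"
    show "0 \<le> G u"
    proof (cases "u \<in> p ` B")
      case True
      then obtain x where x: "x \<in> U" "u = p x"
        using B(2) by blast
      then have "0 \<le> f x" "0 < \<rho> u"
        using u \<rho>_pos by auto
      then show ?thesis
        using x by (simp add: G_def)
    qed (simp add: G_def)
  qed
  have nn: "(\<integral>\<^sup>+u. ennreal (G u) \<partial>lborel) = emeasure (density vol (\<lambda>x. ennreal (f x))) B"
  proof -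
    have "emeasure (density vol (\<lambda>x. ennreal (f x))) B = (\<integral>\<^sup>+x. ennreal (f x) * indicator B x \<partial>vol)"
      using f_vol B by (simp add: emeasure_density sets_vol)
    also have "\<dots> = (\<integral>\<^sup>+x. (ennreal (f x) * indicator B x) * indicator U x \<partial>vol)"
      using B(2) by (intro nn_integral_cong) (auto simp: indicator_def)
    also have "\<dots> = (\<integral>\<^sup>+u. ennreal (f (p_inv u)) * indicator B (p_inv u) * ennreal (\<rho> u) * indicator (p ` U) u \<partial>lborel)"
      using f B by (intro nn_integral_chart) auto
    also have "\<dots> = (\<integral>\<^sup>+u. ennreal (G u) \<partial>lborel)"
    proof (intro nn_integral_cong)
      fix u
      show "ennreal (f (p_inv u)) * indicator B (p_inv u) * ennreal (\<rho> u) * indicator (p ` U) u = ennreal (G u)"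
        using \<rho>_pos[of u] B(2) unfolding G_def p_image_eq[OF B(2)]
        by (auto simp: indicator_def less_imp_le ennreal_mult'' simp del: mem_Collect_eq)
    qed
    finally show ?thesis by simp
  qed
  have "emeasure (density vol (\<lambda>x. ennreal (f x))) B \<le> emeasure (density vol (\<lambda>x. ennreal (f x))) U"
    using B open_U by (intro emeasure_mono) (auto simp: sets_vol)
  then have Bfin: "emeasure (density vol (\<lambda>x. ennreal (f x))) B < \<infinity>"
    using finite by (rule le_less_trans)
  have int: "integrable lborel G"
    using G G0 nn Bfin by (intro integrableI_nonneg) auto
  have "integrable lebesgue G"
    using int G by (simp add: integrable_completion)
  then show abs: ?int
    unfolding set_integrable_def G_def by simp
  have "integral (p ` B) (\<lambda>u. f (p_inv u) * \<rho> u) = (LINT u:p ` B|lebesgue. f (p_inv u) * \<rho> u)"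
    using set_lebesgue_integral_eq_integral(2)[OF abs] by simp
  also have "\<dots> = integral\<^sup>L lborel G"
    unfolding set_lebesgue_integral_def using G by (simp add: G_def[symmetric] integral_completion)
  also have "\<dots> = measure (density vol (\<lambda>x. ennreal (f x))) B"
    using G G0 nn by (subst integral_eq_nn_integral) (auto simp: measure_def)
  finally show ?eq .
qed

end


section \<open>The Jacobian equation in charts\<close>

locale volume_chart_pair = X: volume_chart U p vol \<rho> + Y: volume_chart V q vol' \<sigma>
  for U :: "'a::{t2_space, second_countable_topology} set" and p :: "'a \<Rightarrow> real^'n::finite" and vol \<rho>
    and V :: "'b::{t2_space, second_countable_topology} set" and q :: "'b \<Rightarrow> real^'n" and vol' \<sigma>
begin

lemma continuous_on_local_map:
  assumes "Y \<subseteq> U" "T ` Y \<subseteq> V" "continuous_on Y T"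
  shows "continuous_on (p ` Y) (q \<circ> T \<circ> X.p_inv)"
proof -
  have 1: "continuous_on (p ` Y) X.p_inv"
    using X.cont_p_inv image_mono[OF assms(1)] by (rule continuous_on_subset)
  have 2: "continuous_on (X.p_inv ` p ` Y) T"
    using assms by (simp only: X.image_p_inv)
  have 3: "continuous_on (T ` X.p_inv ` p ` Y) q"
    using Y.cont_p assms(2) unfolding X.image_p_inv[OF assms(1)] by (rule continuous_on_subset)
  show ?thesis
    by (rule continuous_on_compose[OF 1 continuous_on_compose[OF 2 3]])
qed

text \<open>This is the Euclidean equation for the map read in the charts, with the coordinate
  densities \<open>f * \<rho>\<close> and \<open>f' * \<sigma>\<close> as integrands; equality of
  the masses of compact sets and their images becomes equality of the integrals.\<close>

lemma Jacobian_equation_AE: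
  assumes f: "f \<in> borel_measurable borel" "AE x in vol. 0 \<le> f x"
      "emeasure (density vol (\<lambda>x. ennreal (f x))) U < \<infinity>"
    and f': "f' \<in> borel_measurable borel" "AE y in vol'. 0 \<le> f' y"
      "emeasure (density vol' (\<lambda>y. ennreal (f' y))) V < \<infinity>"
    and Y: "Y \<subseteq> U" "p ` Y \<in> sets lebesgue" and T: "T ` Y \<subseteq> V" "continuous_on Y T" "inj_on T Y"
    and match: "\<And>K. compact K \<Longrightarrow> K \<subseteq> Y \<Longrightarrow>
      emeasure (density vol (\<lambda>x. ennreal (f x))) K = emeasure (density vol' (\<lambda>y. ennreal (f' y))) (T ` K)"
  shows "AE x in vol. x \<in> U \<longrightarrow> (x \<in> Y \<longrightarrow> (\<forall>M.
    ((q \<circ> T \<circ> X.p_inv) has_derivative (*v) M) (at (p x) within p ` Y) \<longrightarrow>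
    f x * \<rho> (p x) = \<bar>det M\<bar> * (f' (T x) * \<sigma> (q (T x)))))"
proof (rule X.AE_vol_if_negligible_p_image)
  let ?g = "q \<circ> T \<circ> X.p_inv" and ?F = "\<lambda>u. f (X.p_inv u) * \<rho> u" and ?G = "\<lambda>v. f' (Y.p_inv v) * \<sigma> v"
  have pY: "p ` Y \<subseteq> p ` U" using Y by auto
  have inv_Y: "X.p_inv u \<in> Y" if "u \<in> p ` Y" for u
    using that Y by auto
  have cont: "continuous_on (p ` Y) ?g"
    using Y(1) T(1,2) by (rule continuous_on_local_map)
  have inj: "inj_on ?g (p ` Y)"
  proof (rule inj_onI)
    fix u u' assume u: "u \<in> p ` Y" "u' \<in> p ` Y" and eq: "?g u = ?g u'"
    obtain x x' where x: "x \<in> Y" "u = p x" "x' \<in> Y" "u' = p x'"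
      using u by blast
    then have xU: "x \<in> U" "x' \<in> U" using Y by auto
    then have "q (T x) = q (T x')"
      using eq x by simp
    then have "T x = T x'"
      using Y.inj_p x T(1) by (meson image_subset_iff inj_onD)
    then show "u = u'"
      using T(3) x by (simp add: inj_on_eq_iff)
  qed
  have UB: "U \<in> sets borel" and VB: "V \<in> sets borel"
    using X.open_U Y.open_U by auto
  have F: "?F absolutely_integrable_on p ` Y"
    using X.density_in_chart(1)[OF f UB order_refl] Y(2) pY by (rule set_integrable_subset)
  have K: "?G absolutely_integrable_on ?g ` K \<and> integral (?g ` K) ?G = integral K ?F" if K: "compact K" "K \<subseteq> p ` Y" for K
  proof -
    \<comment> \<open>Pulling \<open>K\<close> back and mapping it on keeps compactness, so both
      masses in the hypothesis are taken on Borel sets.\<close>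
    define L where "L = X.p_inv ` K"
    have KU: "K \<subseteq> p ` U" using K pY by auto
    have L: "L \<subseteq> Y" "p ` L = K"
      using K inv_Y KU by (auto simp: L_def image_image subset_iff)
    then have LU: "L \<subseteq> U" and TL: "T ` L \<subseteq> V"
      using Y T by auto
    have cL: "compact L"
      unfolding L_def using K KU by (intro compact_continuous_image continuous_on_subset[OF X.cont_p_inv])
    then have "compact (T ` L)"
      using L by (intro compact_continuous_image continuous_on_subset[OF T(2)])
    then have B: "L \<in> sets borel" "T ` L \<in> sets borel"
      using cL by (auto intro: borel_compact)
    have gK: "?g ` K = q ` (T ` L)"
      by (simp add: L_def image_comp o_assoc)
    have "integral K ?F = measure (density vol (\<lambda>x. ennreal (f x))) L"
      using X.density_in_chart(2)[OF f B(1) LU] by (simp add: L)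
    also have "\<dots> = measure (density vol' (\<lambda>y. ennreal (f' y))) (T ` L)"
      using match[OF cL L(1)] by (simp add: measure_def)
    also have "\<dots> = integral (q ` (T ` L)) ?G"
      using Y.density_in_chart(2)[OF f' B(2) TL] by simp
    finally show ?thesis
      using Y.density_in_chart(1)[OF f' B(2) TL] unfolding gK by simp
  qed
  have "negligible {u \<in> p ` Y. \<exists>M. (?g has_derivative (*v) M) (at u within p ` Y) \<and> ?F u \<noteq> \<bar>det M\<bar> * ?G (?g u)}"
    by (rule Jacobian_equation_AE[OF Y(2) cont inj F]) (use K in blast)+
  then show "negligible (p ` {x \<in> U. \<not> (x \<in> Y \<longrightarrow> (\<forall>M. (?g has_derivative (*v) M) (at (p x) within p ` Y) \<longrightarrow>
      f x * \<rho> (p x) = \<bar>det M\<bar> * (f' (T x) * \<sigma> (q (T x)))))})"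
  proof (rule negligible_subset, intro image_subsetI)
    fix x assume x: "x \<in> {x \<in> U. \<not> (x \<in> Y \<longrightarrow> (\<forall>M. (?g has_derivative (*v) M) (at (p x) within p ` Y) \<longrightarrow>
      f x * \<rho> (p x) = \<bar>det M\<bar> * (f' (T x) * \<sigma> (q (T x)))))}"
    then have "x \<in> U" "x \<in> Y" by auto
    moreover from this have "T x \<in> V" using T(1) by auto
    ultimately show "p x \<in> {u \<in> p ` Y. \<exists>M. (?g has_derivative (*v) M) (at u within p ` Y) \<and> ?F u \<noteq> \<bar>det M\<bar> * ?G (?g u)}"
      using x by auto
  qed
qed

end

section \<open>Independence of the charts\<close>

lemma eq_on_open_if_eq_off_negligible:
  fixes f g :: "'a::euclidean_space \<Rightarrow> real"
  assumes S: "open S" and f: "continuous_on S f" and g: "continuous_on S g"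
    and neg: "negligible {x \<in> S. f x \<noteq> g x}" and x: "x \<in> S"
  shows "f x = g x"
proof (rule ccontr)
  assume "f x \<noteq> g x"
  have "open (S \<inter> (\<lambda>x. f x - g x) -` (- {0}))"
    using S f g by (intro continuous_open_preimage continuous_intros) auto
  moreover have "S \<inter> (\<lambda>x. f x - g x) -` (- {0}) = {x \<in> S. f x \<noteq> g x}"
    by auto
  ultimately have "{x \<in> S. f x \<noteq> g x} = {}"
    using neg open_not_negligible by auto
  then show False
    using \<open>f x \<noteq> g x\<close> x by blast
qed

lemma continuous_on_det_frechet:
  fixes \<phi> :: "real^'n::finite \<Rightarrow> real^'n"
  assumes "smooth_on S \<phi>"
  shows "continuous_on S (\<lambda>u. det (matrix (frechet_derivative \<phi> (at u))))"
proof -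
  have "Ck_on (Suc 0) S \<phi>"
    using assms unfolding smooth_on_def by blast
  then have "continuous_on S (\<lambda>u. frechet_derivative \<phi> (at u) v)" for v
    by simp
  then show ?thesis
    unfolding det_def matrix_def by (intro continuous_intros continuous_on_component) auto
qed

lemma smooth_on_has_derivative:
  fixes \<phi> :: "real^'n::finite \<Rightarrow> real^'n"
  assumes "smooth_on S \<phi>" "u \<in> S"
  shows "(\<phi> has_derivative (*v) (matrix (frechet_derivative \<phi> (at u)))) (at u)"
proof -
  have "Ck_on (Suc 0) S \<phi>"
    using assms unfolding smooth_on_def by blast
  then have "(\<phi> has_derivative frechet_derivative \<phi> (at u)) (at u)"
    using assms(2) by (simp add: frechet_derivative_works)
  then show ?thesis
    by (rule has_derivative_matrix)
qed

text \<open>This is the Jacobian equation for the identity map, which carries the volume to itself,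
  read in one chart on the source and in the other on the target. It holds almost everywhere near
  the point, and continuity of both sides removes the exceptional set.\<close>

lemma volume_density_transition:
  fixes vol :: "'a::{t2_space, second_countable_topology} measure"
    and p p1 :: "'a \<Rightarrow> real^'n::finite"
  assumes charts: "is_chart (U, p)" "is_chart (U1, p1)" and sets: "sets vol = sets borel"
    and dens: "volume_density vol (U, p) \<rho>" "volume_density vol (U1, p1) \<rho>1"
    and smooth: "smooth_on (p ` (U \<inter> U1)) (p1 \<circ> inv_into U p)" and x: "x \<in> U" "x \<in> U1"
  shows "\<rho> (p x) = \<bar>det (matrix (frechet_derivative (p1 \<circ> inv_into U p) (at (p x))))\<bar> * \<rho>1 (p1 x)"
proof -
  interpret X: volume_chart U p vol \<rho>
    using charts sets dens by unfold_locales
  interpret X1: volume_chart U1 p1 vol \<rho>1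
    using charts sets dens by unfold_locales
  interpret volume_chart_pair U p vol \<rho> U1 p1 vol \<rho>1 ..
  let ?\<phi> = "p1 \<circ> X.p_inv" and ?O = "p ` (U \<inter> U1)"
  let ?D = "\<lambda>u. matrix (frechet_derivative ?\<phi> (at u))"
  have O: "open ?O"
    by (rule X.open_p_image[OF X1.open_U])
  have OU: "?O \<subseteq> p ` U" by auto
  have \<phi>O: "?\<phi> ` ?O \<subseteq> p1 ` U1" by auto
  have \<phi>_cont: "continuous_on ?O ?\<phi>"
    using smooth unfolding smooth_on_def by (auto dest: spec[of _ 0])
  have "p x \<in> ?O" using x by blast
  \<comment> \<open>The volume may be infinite, so it is restricted to a compact coordinate ball, on
    which \<rho> is bounded.\<close>
  then obtain r where r: "0 < r" "cball (p x) r \<subseteq> ?O"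
    using O by (meson open_contains_cball)
  define C where "C = X.p_inv ` cball (p x) r"
  have pC: "p ` C = cball (p x) r"
    using r OU by (auto simp: C_def image_image subset_iff)
  have CU: "C \<subseteq> U" "C \<subseteq> U1"
    using r by (auto simp: C_def)
  have C: "compact C"
    unfolding C_def using r OU by (intro compact_continuous_image continuous_on_subset[OF X.cont_p_inv]) auto
  then have CB: "C \<in> sets borel" by (rule borel_compact)
  have eqd: "emeasure (density vol (\<lambda>x. ennreal (indicator C x))) A = emeasure vol (C \<inter> A)" if "A \<in> sets borel" for A
    using that CB sets by (subst emeasure_density) (auto simp: ennreal_indicator indicator_inter_arith[symmetric])
  have fin: "emeasure vol C < \<infinity>"
  proof -
    have "continuous_on (cball (p x) r) \<rho>"
      using X.cont_\<rho> r OU by (meson continuous_on_subset order_trans)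
    then obtain b where b: "\<And>u. u \<in> cball (p x) r \<Longrightarrow> \<rho> u \<le> b"
      using compact_continuous_image[of "cball (p x) r" \<rho>] compact_imp_bounded
      by (metis (no_types, lifting) bounded_real compact_cball image_eqI abs_le_D1)
    have "emeasure vol C = (\<integral>\<^sup>+u. ennreal (\<rho> u) * indicator (cball (p x) r) u \<partial>lborel)"
      using X.emeasure_vol[OF CB CU(1)] by (simp add: pC)
    also have "\<dots> \<le> (\<integral>\<^sup>+u. ennreal b * indicator (cball (p x) r) u \<partial>lborel)"
      using b by (intro nn_integral_mono) (auto simp: indicator_def intro!: ennreal_leI)
    also have "\<dots> = ennreal b * emeasure lborel (cball (p x) r)"
      by (simp add: nn_integral_cmult_indicator)
    also have "\<dots> < \<infinity>"
      using emeasure_bounded_finite[of "cball (p x) r"] by (simp add: ennreal_mult_less_top)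
    finally show ?thesis .
  qed
  \<comment> \<open>The form of the chart equation for the identity map with the indicator of
    \<open>C\<close> as both densities.\<close>
  let ?P = "\<lambda>z. z \<in> C \<longrightarrow> (\<forall>M.
    ((p1 \<circ> (\<lambda>z. z) \<circ> X.p_inv) has_derivative (*v) M) (at (p z) within p ` C) \<longrightarrow>
    indicator C z * \<rho> (p z) = \<bar>det M\<bar> * (indicator C z * \<rho>1 (p1 z)))"
  have "AE z in vol. z \<in> U \<longrightarrow> ?P z"
  proof (rule Jacobian_equation_AE)
    show "emeasure (density vol (\<lambda>x. ennreal (indicator C x))) U < \<infinity>" "emeasure (density vol (\<lambda>x. ennreal (indicator C x))) U1 < \<infinity>"
      using fin CU X.open_U X1.open_U by (simp_all add: eqd Int_absorb2)
    show "p ` C \<in> sets lebesgue" by (simp add: pC)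
  qed (use CU CB in auto)
  then have "negligible (p ` {z \<in> U. \<not> ?P z})"
    by (intro X.negligible_p_image_if_AE_vol, elim AE_mp, intro AE_I2) (use CU(1) in blast)
  moreover have "{u \<in> ball (p x) r. \<rho> u \<noteq> \<bar>det (?D u)\<bar> * \<rho>1 (?\<phi> u)} \<subseteq> p ` {z \<in> U. \<not> ?P z}"
  proof
    fix u assume u: "u \<in> {u \<in> ball (p x) r. \<rho> u \<noteq> \<bar>det (?D u)\<bar> * \<rho>1 (?\<phi> u)}"
    then have uO: "u \<in> ?O" "u \<in> p ` U" and uC: "X.p_inv u \<in> C"
      using r OU by (auto simp: C_def subset_iff)
    have "(?\<phi> has_derivative (*v) (?D u)) (at u within p ` C)"
      using smooth_on_has_derivative[OF smooth uO(1)] by (rule has_derivative_at_withinI)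
    then have "X.p_inv u \<in> {z \<in> U. \<not> ?P z}"
      using u uC uO(2) CU by (auto simp: o_def)
    then show "u \<in> p ` {z \<in> U. \<not> ?P z}"
      using X.p_p_inv[OF uO(2)] by (metis (no_types, lifting) image_eqI)
  qed
  ultimately have neg: "negligible {u \<in> ball (p x) r. \<rho> u \<noteq> \<bar>det (?D u)\<bar> * \<rho>1 (?\<phi> u)}"
    by (rule negligible_subset)
  have ball: "ball (p x) r \<subseteq> ?O"
    using r by auto
  have "\<rho> (p x) = \<bar>det (?D (p x))\<bar> * \<rho>1 (?\<phi> (p x))"
  proof (rule eq_on_open_if_eq_off_negligible[OF open_ball _ _ neg])
    show "continuous_on (ball (p x) r) \<rho>"
      using X.cont_\<rho> ball OU by (meson continuous_on_subset order_trans)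
    have "continuous_on ?O (\<lambda>u. \<rho>1 (?\<phi> u))"
      by (rule continuous_on_compose2[OF X1.cont_\<rho> \<phi>_cont \<phi>O])
    then show "continuous_on (ball (p x) r) (\<lambda>u. \<bar>det (?D u)\<bar> * \<rho>1 (?\<phi> u))"
      using ball by (intro continuous_intros continuous_on_subset[OF continuous_on_det_frechet[OF smooth]])
        (auto intro: continuous_on_subset)
  qed (use r in simp)
  then show ?thesis
    using x by simp
qed


text \<open>The definition supplies a derivative in some pair of charts only. The chain rule moves
  it to the given charts, and the determinants of the two coordinate changes cancel against the
  ratios of the volume densities.\<close>

lemma has_jacobian_within_in_charts:
  fixes \<A> :: "('a::{t2_space, second_countable_topology}, 'n::finite) chart set"
    and \<B> :: "('b::{t2_space, second_countable_topology}, 'n) chart set"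
  assumes atlas: "smooth_atlas \<A>" "smooth_atlas \<B>" and sets: "sets vol = sets borel" "sets vol' = sets borel"
    and T: "continuous_on S T" and x: "x \<in> S" "x \<in> U" "T x \<in> V"
    and charts: "(U, p) \<in> \<A>" "(V, q) \<in> \<B>"
    and dens: "volume_density vol (U, p) \<rho>" "volume_density vol' (V, q) \<sigma>"
    and J: "has_jacobian_within \<A> vol \<B> vol' T x S J"
  shows "\<exists>M. ((q \<circ> T \<circ> inv_into U p) has_derivative (*v) M) (at (p x) within p ` {z \<in> S. z \<in> U \<and> T z \<in> V}) \<and>
    J * \<rho> (p x) = \<bar>det M\<bar> * \<sigma> (q (T x))"
proof -
  obtain U1 p1 V1 q1 M1 \<rho>1 \<sigma>1 where charts1: "(U1, p1) \<in> \<A>" "(V1, q1) \<in> \<B>"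
    and x1: "x \<in> U1" "T x \<in> V1"
    and dens1: "volume_density vol (U1, p1) \<rho>1" "volume_density vol' (V1, q1) \<sigma>1"
    and M1: "((q1 \<circ> T \<circ> inv_into U1 p1) has_derivative (*v) M1) (at (p1 x) within p1 ` {z \<in> S. z \<in> U1 \<and> T z \<in> V1})"
    and J_eq: "J = \<bar>det M1\<bar> * \<sigma>1 (q1 (T x)) / \<rho>1 (p1 x)"
    using J unfolding has_jacobian_within_def by auto
  have is_chart: "is_chart (U, p)" "is_chart (U1, p1)" "is_chart (V, q)" "is_chart (V1, q1)"
    and smooth: "smooth_on (p ` (U \<inter> U1)) (p1 \<circ> inv_into U p)" "smooth_on (q1 ` (V1 \<inter> V)) (q \<circ> inv_into V1 q1)"
    using atlas charts charts1 unfolding smooth_atlas_def by blast+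
  interpret X: volume_chart U p vol \<rho>
    using is_chart sets dens by unfold_locales
  interpret X1: volume_chart U1 p1 vol \<rho>1
    using is_chart sets dens1 by unfold_locales
  interpret Y: volume_chart V q vol' \<sigma>
    using is_chart sets dens by unfold_locales
  interpret Y1: volume_chart V1 q1 vol' \<sigma>1
    using is_chart sets dens1 by unfold_locales
  let ?W = "{z \<in> S. z \<in> U \<and> T z \<in> V}" and ?Z = "{z \<in> S. z \<in> U1 \<and> T z \<in> V1}"
  let ?I = "?W \<inter> ?Z"
  define A where "A = matrix (frechet_derivative (p1 \<circ> X.p_inv) (at (p x)))"
  define B where "B = matrix (frechet_derivative (q \<circ> Y1.p_inv) (at (q1 (T x))))"
  have dA: "((p1 \<circ> X.p_inv) has_derivative (*v) A) (at (p x))"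
    unfolding A_def using smooth(1) x x1 by (intro smooth_on_has_derivative) auto
  have dB: "((q \<circ> Y1.p_inv) has_derivative (*v) B) (at (q1 (T x)))"
    unfolding B_def using smooth(2) x x1 by (intro smooth_on_has_derivative) auto
  have im: "(p1 \<circ> X.p_inv) ` p ` ?I \<subseteq> p1 ` ?Z" and pt: "(p1 \<circ> X.p_inv) (p x) = p1 x"
    using x by auto
  have "((q1 \<circ> T \<circ> X1.p_inv) has_derivative (*v) M1) (at ((p1 \<circ> X.p_inv) (p x)) within (p1 \<circ> X.p_inv) ` p ` ?I)"
    unfolding pt by (rule has_derivative_subset[OF M1 im])
  from has_derivative_in_compose[OF has_derivative_at_withinI[OF dA] this]
  have d1: "((\<lambda>u. (q1 \<circ> T \<circ> X1.p_inv) ((p1 \<circ> X.p_inv) u)) has_derivative (\<lambda>h. M1 *v (A *v h))) (at (p x) within p ` ?I)" .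
  have pt1: "(q1 \<circ> T \<circ> X1.p_inv) ((p1 \<circ> X.p_inv) (p x)) = q1 (T x)"
    using x x1 by simp
  have "((\<lambda>u. (q \<circ> Y1.p_inv) ((q1 \<circ> T \<circ> X1.p_inv) ((p1 \<circ> X.p_inv) u))) has_derivative (\<lambda>h. B *v (M1 *v (A *v h)))) (at (p x) within p ` ?I)"
    by (rule has_derivative_in_compose[OF d1]) (unfold pt1, rule has_derivative_at_withinI[OF dB])
  then have "((q \<circ> T \<circ> X.p_inv) has_derivative (\<lambda>h. B *v (M1 *v (A *v h)))) (at (p x) within p ` ?I)"
    by (rule has_derivative_transform[rotated 2]) (use x x1 in auto)
  \<comment> \<open>The chain rule works on the points that lie in both pairs of charts. Relative
    continuity of \<open>T\<close> makes them fill \<open>?W\<close> near \<open>x\<close>, so the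
    restriction does not change the derivative within \<open>?W\<close>.\<close>
  moreover have "at (p x) within p ` ?I = at (p x) within p ` ?W"
  proof -
    obtain O' where O': "open O'" "O' \<inter> S = T -` V1 \<inter> S"
      using T Y1.open_U by (metis continuous_on_open_invariant)
    let ?N = "p ` (U \<inter> (U1 \<inter> O'))"
    have N: "open ?N"
      using X1.open_U O'(1) by (intro X.open_p_image open_Int)
    have "x \<in> O'"
      using O'(2) x x1 by blast
    then have pN: "p x \<in> ?N"
      using x x1 by blast
    have "p ` ?W \<inter> ?N \<subseteq> p ` ?I"
    proof
      fix u assume u: "u \<in> p ` ?W \<inter> ?N"
      then obtain z z' where z: "u = p z" "z \<in> ?W" "u = p z'" "z' \<in> U \<inter> (U1 \<inter> O')"
        by blast
      then have "z = z'"
        using X.inj_p by (simp add: inj_on_eq_iff)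
      then have "z \<in> ?I"
        using z O'(2) by blast
      then show "u \<in> p ` ?I"
        using z(1) by blast
    qed
    then have "p ` ?I \<inter> ?N - {p x} = p ` ?W \<inter> ?N - {p x}"
      by blast
    then show ?thesis
      by (rule at_within_nhd[OF pN N])
  qed
  ultimately have "((q \<circ> T \<circ> X.p_inv) has_derivative (*v) (B ** (M1 ** A))) (at (p x) within p ` ?W)"
    by (simp add: matrix_vector_mul_assoc)
  moreover have "J * \<rho> (p x) = \<bar>det (B ** (M1 ** A))\<bar> * \<sigma> (q (T x))"
  proof -
    have "\<rho> (p x) = \<bar>det A\<bar> * \<rho>1 (p1 x)"
      unfolding A_def by (rule volume_density_transition[OF is_chart(1,2) sets(1) dens(1) dens1(1) smooth(1) x(2) x1(1)])
    moreover have "\<sigma>1 (q1 (T x)) = \<bar>det B\<bar> * \<sigma> (q (T x))"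
      unfolding B_def by (rule volume_density_transition[OF is_chart(4,3) sets(2) dens1(2) dens(2) smooth(2) x1(2) x(3)])
    moreover have "0 < \<rho>1 (p1 x)"
      using x1 by (intro X1.\<rho>_pos) auto
    ultimately show ?thesis
      by (simp add: J_eq det_mul abs_mult)
  qed
  ultimately show ?thesis
    by blast
qed

text \<open>The atlas may be uncountable, while exceptional null sets can be united only countably
  often; second countability and Lindelof's theorem provide the reduction.\<close>

lemma smooth_atlas_countable_cover:
  fixes \<A> :: "('a::{t2_space, second_countable_topology}, 'n::finite) chart set"
  assumes "smooth_atlas \<A>"
  obtains \<A>' where "\<A>' \<subseteq> \<A>" "countable \<A>'" "\<And>x. \<exists>(U, p)\<in>\<A>'. x \<in> U"
proof -
  have opn: "open U" if U: "U \<in> fst ` \<A>" for U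
    using U assms by (auto simp: smooth_atlas_def is_chart_def)
  obtain F where F: "F \<subseteq> fst ` \<A>" "countable F" "\<Union>F = \<Union>(fst ` \<A>)"
    by (rule Lindelof[OF opn])
  obtain \<A>' where A': "countable \<A>'" "\<A>' \<subseteq> \<A>" "F = fst ` \<A>'"
    using F(1,2) countable_subset_image[of F fst \<A>] by blast
  show thesis
  proof (rule that[OF A'(2,1)])
    fix x :: 'a
    have "(\<Union>(U, p)\<in>\<A>. U) = UNIV"
      using assms by (simp add: smooth_atlas_def)
    then have "x \<in> \<Union>(fst ` \<A>)"
      by (force simp: case_prod_unfold)
    then have "x \<in> \<Union>(fst ` \<A>')"
      using F(3) A'(3) by simp
    then show "\<exists>(U, p)\<in>\<A>'. x \<in> U"
      by force
  qed
qed

lemma closed_measure_support: "closed (measure_support \<mu>)"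
proof -
  have "- measure_support \<mu> = \<Union>{U. open U \<and> \<not> 0 < emeasure \<mu> U}"
    by (auto simp: measure_support_def)
  then have "open (- measure_support \<mu>)"
    by auto
  then show ?thesis
    by (simp add: closed_def)
qed

lemma C2_cost_continuous:
  fixes c :: "'a::{t2_space, second_countable_topology} \<times> 'b::{t2_space, second_countable_topology} \<Rightarrow> real"
    and \<A> :: "('a, 'n::finite) chart set"
  assumes "smooth_atlas \<A>" "smooth_atlas \<B>" "C2_cost \<A> \<B> c"
  shows "continuous_on UNIV c"
proof (rule continuous_at_imp_continuous_on, rule ballI)
  fix z :: "'a \<times> 'b"
  obtain x y where z: "z = (x, y)" by (cases z)
  have "x \<in> (\<Union>(U, p)\<in>\<A>. U)" "y \<in> (\<Union>(V, q)\<in>\<B>. V)"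
    using assms(1,2) by (simp_all add: smooth_atlas_def)
  then obtain U p V q where ch: "(U, p) \<in> \<A>" "x \<in> U" "(V, q) \<in> \<B>" "y \<in> V"
    by blast
  have U: "is_chart (U, p)" and V: "is_chart (V, q)"
    using assms(1,2) ch unfolding smooth_atlas_def by blast+
  note U = is_chartD[OF U] and V = is_chartD[OF V]
  have "Ck_on 2 (p ` U \<times> q ` V) (local_cost c (U, p) (V, q))"
    using assms(3) ch unfolding C2_cost_def by blast
  then have "continuous_on (p ` U \<times> q ` V) (local_cost c (U, p) (V, q))"
    unfolding numeral_2_eq_2 Ck_on.simps
    by (intro continuous_at_imp_continuous_on ballI differentiable_imp_continuous_within) blast
  then have "continuous_on (U \<times> V) (\<lambda>z. local_cost c (U, p) (V, q) (p (fst z), q (snd z)))"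
    by (rule continuous_on_compose2)
      (auto intro!: continuous_intros continuous_on_compose2[OF U(3)] continuous_on_compose2[OF V(3)])
  then have "continuous_on (U \<times> V) c"
    by (rule continuous_on_eq) (auto simp: local_cost_def inv_into_f_f[OF U(5)] inv_into_f_f[OF V(5)])
  then show "isCont c z"
    using U(1) V(1) ch z by (simp add: continuous_on_eq_continuous_at open_Times)
qed

section \<open>The transport map between the manifolds\<close>

locale transport_map =
  fixes \<A>p :: "('a::{t2_space, second_countable_topology}, 'n::finite) chart set"
    and \<A>m :: "('b::{t2_space, second_countable_topology}, 'n) chart set"
    and volp \<mu>p :: "'a measure" and volm \<mu>m :: "'b measure" and \<gamma> :: "('a \<times> 'b) measure"
    and domT :: "'a set" and T :: "'a \<Rightarrow> 'b" and fp :: "'a \<Rightarrow> real" and fm :: "'b \<Rightarrow> real"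
  assumes atlas: "smooth_atlas \<A>p" "smooth_atlas \<A>m"
    and vol: "smooth_volume \<A>p volp" "smooth_volume \<A>m volm"
    and prob: "borel_probability \<mu>p" "borel_probability \<mu>m"
    and coupling: "coupling \<mu>p \<mu>m \<gamma>"
    and domT: "AE x in volp. x \<in> domT" and inj_T: "inj_on T domT" and cont_T: "continuous_on domT T"
    and graph: "AE z in \<gamma>. z \<in> {(x, T x) |x. x \<in> domT}"
    and fp: "fp \<in> borel_measurable borel" "AE x in volp. 0 \<le> fp x" "\<mu>p = density volp (\<lambda>x. ennreal (fp x))"
    and fm: "fm \<in> borel_measurable borel" "AE y in volm. 0 \<le> fm y" "\<mu>m = density volm (\<lambda>y. ennreal (fm y))"
begin

text \<open>On the graph, by injectivity, the first coordinate lies in \<open>K\<close> exactly when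
  the second lies in its image, so the two cylinders have the same \<gamma>-mass, and their masses
  are those of the marginals.\<close>

lemma emeasure_image_T:
  assumes "compact K" "K \<subseteq> domT"
  shows "emeasure \<mu>p K = emeasure \<mu>m (T ` K)"
proof -
  have "compact (T ` K)"
    using assms by (intro compact_continuous_image continuous_on_subset[OF cont_T])
  then have B: "K \<in> sets borel" "T ` K \<in> sets borel"
    using assms by (auto intro: borel_compact)
  then have BB: "K \<times> (UNIV :: 'b set) \<in> sets borel" "(UNIV :: 'a set) \<times> T ` K \<in> sets borel"
    by (simp_all flip: borel_prod)
  have "emeasure \<gamma> (K \<times> UNIV) = emeasure \<gamma> (UNIV \<times> T ` K)"
  proof (rule emeasure_eq_AE)
    show "AE z in \<gamma>. z \<in> K \<times> UNIV \<longleftrightarrow> z \<in> UNIV \<times> T ` K"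
      using graph
    proof (rule AE_mp, intro AE_I2 impI)
      fix z assume "z \<in> {(x, T x) |x. x \<in> domT}"
      then obtain x where x: "x \<in> domT" "z = (x, T x)" by blast
      show "z \<in> K \<times> UNIV \<longleftrightarrow> z \<in> UNIV \<times> T ` K"
        using inj_on_image_mem_iff[OF inj_T x(1) assms(2)] by (simp add: x(2))
    qed
  qed (use BB coupling in \<open>simp_all add: coupling_def\<close>)
  then show ?thesis
    using coupling B by (simp add: coupling_def)
qed

lemma volume_charts:
  assumes "(U, p) \<in> \<A>p" "(V, q) \<in> \<A>m"
  obtains \<rho> \<sigma> where "volume_density volp (U, p) \<rho>" "volume_density volm (V, q) \<sigma>"
    "volume_chart_pair U p volp \<rho> V q volm \<sigma>"
proof -
  obtain \<rho> \<sigma> where d: "volume_density volp (U, p) \<rho>" "volume_density volm (V, q) \<sigma>"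
    using vol assms unfolding smooth_volume_def by meson
  have "volume_chart_pair U p volp \<rho> V q volm \<sigma>"
    using assms atlas vol d unfolding smooth_atlas_def smooth_volume_def
    by (intro volume_chart_pair.intro volume_chart.intro) blast+
  then show thesis
    using that d by blast
qed

text \<open>The complement of \<open>domT\<close> is null and therefore Lebesgue measurable in
  coordinates, and the preimage of \<open>V\<close> is relatively open in \<open>domT\<close>;
  together they give measurability without any Borel structure on \<open>domT\<close>.\<close>

lemma lebesgue_measurable_local_domain:
  assumes "volume_chart_pair U p volp \<rho> V q volm \<sigma>" and X: "X \<in> sets borel"
  shows "p ` {z \<in> domT \<inter> X. z \<in> U \<and> T z \<in> V} \<in> sets lebesgue"
proof -
  interpret volume_chart_pair U p volp \<rho> V q volm \<sigma> by fact
  obtain O' where O': "open O'" "O' \<inter> domT = T -` V \<inter> domT"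
    using cont_T Y.open_U by (metis continuous_on_open_invariant)
  have "X \<inter> U \<inter> O' \<in> sets borel"
    using X X.open_U O' by auto
  then have "p ` (X \<inter> U \<inter> O') \<in> sets lebesgue"
    by (simp add: X.borel_p_image Int_assoc le_infI1 le_infI2)
  moreover have "p ` {z \<in> U. \<not> z \<in> domT} \<in> sets lebesgue"
    by (rule negligible_imp_sets[OF X.negligible_p_image_if_AE_vol[OF domT]])
  ultimately have "p ` (X \<inter> U \<inter> O') - p ` {z \<in> U. \<not> z \<in> domT} \<in> sets lebesgue"
    by (rule sets.Diff)
  also have "p ` (X \<inter> U \<inter> O') - p ` {z \<in> U. \<not> z \<in> domT} = p ` (X \<inter> U \<inter> O' - {z \<in> U. \<not> z \<in> domT})"
    by (rule inj_on_image_set_diff[OF X.inj_p, symmetric]) auto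
  also have "X \<inter> U \<inter> O' - {z \<in> U. \<not> z \<in> domT} = {z \<in> domT \<inter> X. z \<in> U \<and> T z \<in> V}"
    using O'(2) by blast
  finally show ?thesis .
qed

text \<open>Countable covers of source and target leave countably many pairs of charts to
  consider.\<close>

lemma AE_if_AE_in_charts:
  assumes "\<And>U p V q. (U, p) \<in> \<A>p \<Longrightarrow> (V, q) \<in> \<A>m \<Longrightarrow> AE x in volp. x \<in> U \<longrightarrow> T x \<in> V \<longrightarrow> P x"
  shows "AE x in volp. P x"
proof -
  obtain \<A> where A: "\<A> \<subseteq> \<A>p" "countable \<A>" "\<And>x. \<exists>(U, p)\<in>\<A>. x \<in> U"
    by (rule smooth_atlas_countable_cover[OF atlas(1)]) blast
  obtain \<B> where B: "\<B> \<subseteq> \<A>m" "countable \<B>" "\<And>y. \<exists>(V, q)\<in>\<B>. y \<in> V"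
    by (rule smooth_atlas_countable_cover[OF atlas(2)]) blast
  have "AE x in volp. \<forall>(ch, ch')\<in>\<A> \<times> \<B>. x \<in> fst ch \<longrightarrow> T x \<in> fst ch' \<longrightarrow> P x"
  proof (subst AE_ball_countable, intro countable_SIGMA A B, intro ballI)
    fix z assume "z \<in> \<A> \<times> \<B>"
    obtain U p V q where zeq: "z = ((U, p), (V, q))"
      by (cases z) (metis surj_pair)
    then have z: "z = ((U, p), (V, q))" "(U, p) \<in> \<A>p" "(V, q) \<in> \<A>m"
      using \<open>z \<in> \<A> \<times> \<B>\<close> A(1) B(1) by auto
    then show "AE x in volp. case z of (ch, ch') \<Rightarrow> x \<in> fst ch \<longrightarrow> T x \<in> fst ch' \<longrightarrow> P x"
      using assms[OF z(2,3)] by simp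
  qed
  then show ?thesis
  proof (rule AE_mp, intro AE_I2 impI)
    fix x assume *: "\<forall>(ch, ch')\<in>\<A> \<times> \<B>. x \<in> fst ch \<longrightarrow> T x \<in> fst ch' \<longrightarrow> P x"
    obtain U p V q where "(U, p) \<in> \<A>" "x \<in> U" "(V, q) \<in> \<B>" "T x \<in> V"
      using A(3)[of x] B(3)[of "T x"] by blast
    then show "P x"
      using * by force
  qed
qed

text \<open>The Borel set \<open>X\<close> selects the points relative to which the map is
  differentiated: all points, or the support of the source measure.\<close>

lemma Jacobian_equation_AE:
  assumes X: "X \<in> sets borel"
  shows "AE x in volp. x \<in> domT \<inter> X \<longrightarrow>
    (\<forall>J. has_jacobian_within \<A>p volp \<A>m volm T x (domT \<inter> X) J \<longrightarrow> fp x = J * fm (T x))"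
proof (rule AE_if_AE_in_charts)
  fix U p V q assume ch: "(U, p) \<in> \<A>p" "(V, q) \<in> \<A>m"
  obtain \<rho> \<sigma> where d: "volume_density volp (U, p) \<rho>" "volume_density volm (V, q) \<sigma>"
    and pair: "volume_chart_pair U p volp \<rho> V q volm \<sigma>"
    by (rule volume_charts[OF ch])
  interpret volume_chart_pair U p volp \<rho> V q volm \<sigma> by fact
  let ?Y = "{z \<in> domT \<inter> X. z \<in> U \<and> T z \<in> V}"
  have space: "space \<mu>p = UNIV" "space \<mu>m = UNIV"
    using prob by (auto simp: borel_probability_def dest: sets_eq_imp_space_eq)
  have fin: "emeasure \<mu>p U < \<infinity>" "emeasure \<mu>m V < \<infinity>"
    using emeasure_space[of \<mu>p U] emeasure_space[of \<mu>m V] prob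
    by (auto simp: space borel_probability_def intro: le_less_trans)
  have "AE x in volp. x \<in> U \<longrightarrow> (x \<in> ?Y \<longrightarrow> (\<forall>M.
    ((q \<circ> T \<circ> X.p_inv) has_derivative (*v) M) (at (p x) within p ` ?Y) \<longrightarrow>
    fp x * \<rho> (p x) = \<bar>det M\<bar> * (fm (T x) * \<sigma> (q (T x)))))"
  proof (rule Jacobian_equation_AE)
    show "p ` ?Y \<in> sets lebesgue"
      using pair X by (rule lebesgue_measurable_local_domain)
    fix K assume K: "compact K" "K \<subseteq> ?Y"
    then show "emeasure (density volp (\<lambda>x. ennreal (fp x))) K = emeasure (density volm (\<lambda>y. ennreal (fm y))) (T ` K)"
      using emeasure_image_T[of K] unfolding fp(3) fm(3) by blast
  qed (use fp fm fin in \<open>auto intro: continuous_on_subset[OF cont_T] inj_on_subset[OF inj_T]\<close>)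
  then show "AE x in volp. x \<in> U \<longrightarrow> T x \<in> V \<longrightarrow> (x \<in> domT \<inter> X \<longrightarrow>
    (\<forall>J. has_jacobian_within \<A>p volp \<A>m volm T x (domT \<inter> X) J \<longrightarrow> fp x = J * fm (T x)))"
  proof (rule AE_mp, intro AE_I2 impI allI)
    fix x J assume eq: "x \<in> U \<longrightarrow> (x \<in> ?Y \<longrightarrow> (\<forall>M.
      ((q \<circ> T \<circ> X.p_inv) has_derivative (*v) M) (at (p x) within p ` ?Y) \<longrightarrow>
      fp x * \<rho> (p x) = \<bar>det M\<bar> * (fm (T x) * \<sigma> (q (T x)))))"
      and x: "x \<in> U" "T x \<in> V" "x \<in> domT \<inter> X"
      and J: "has_jacobian_within \<A>p volp \<A>m volm T x (domT \<inter> X) J"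
    have "continuous_on (domT \<inter> X) T"
      using cont_T by (rule continuous_on_subset) auto
    then obtain M where M: "((q \<circ> T \<circ> X.p_inv) has_derivative (*v) M) (at (p x) within p ` ?Y)"
      "J * \<rho> (p x) = \<bar>det M\<bar> * \<sigma> (q (T x))"
      using has_jacobian_within_in_charts[OF atlas X.sets_vol Y.sets_vol _ x(3,1,2) ch d J] by blast
    have "fp x * \<rho> (p x) = \<bar>det M\<bar> * (fm (T x) * \<sigma> (q (T x)))"
      using eq x M(1) by blast
    also have "\<dots> = (J * fm (T x)) * \<rho> (p x)"
      using M(2) by (simp add: ac_simps)
    finally show "fp x = J * fm (T x)"
      using X.\<rho>_pos[of "p x"] x(1) by simp
  qed
qed

text \<open>Over the support the graph of the map lies in the support of \<gamma>, so it is monotone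
  for the cost; written in charts this is the hypothesis of the local differentiability result, with
  non-degeneracy giving the nonzero determinant.\<close>

lemma has_jacobian_within_support_AE:
  assumes cost: "C2_cost \<A>p \<A>m c" and nondeg: "\<forall>x y. nondegenerate_at \<A>p \<A>m c x y"
    and opt: "kantorovich_optimizer \<mu>p \<mu>m c \<gamma>"
  shows "AE x in volp. x \<in> domT \<inter> measure_support \<mu>p \<longrightarrow>
    (\<exists>J. has_jacobian_within \<A>p volp \<A>m volm T x (domT \<inter> measure_support \<mu>p) J)"
proof (rule AE_if_AE_in_charts)
  fix U p V q assume ch: "(U, p) \<in> \<A>p" "(V, q) \<in> \<A>m"
  obtain \<rho> \<sigma> where d: "volume_density volp (U, p) \<rho>" "volume_density volm (V, q) \<sigma>"
    and pair: "volume_chart_pair U p volp \<rho> V q volm \<sigma>"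
    by (rule volume_charts[OF ch])
  interpret volume_chart_pair U p volp \<rho> V q volm \<sigma> by fact
  let ?E = "domT \<inter> measure_support \<mu>p" and ?C = "local_cost c (U, p) (V, q)"
  let ?Y = "{z \<in> ?E. z \<in> U \<and> T z \<in> V}" and ?g = "q \<circ> T \<circ> X.p_inv"
  interpret C2_pair "p ` U" "q ` V" ?C
    using X.open_pU Y.open_pU cost ch unfolding C2_cost_def by unfold_locales blast+
  have cont_E: "continuous_on ?E T"
    using cont_T by (rule continuous_on_subset) auto
  have mono: "c (x, T x) + c (y, T y) \<le> c (x, T y) + c (y, T x)" if "x \<in> ?E" "y \<in> ?E" for x y
    using that graph_in_support[OF coupling graph cont_T]
    by (intro optimizer_support_monotone[OF opt prob(1) C2_cost_continuous[OF atlas cost]]) auto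
  have "negligible {u \<in> p ` ?Y. \<not> ?g differentiable (at u within p ` ?Y)}"
  proof (rule differentiable_AE_if_monotone)
    show "continuous_on (p ` ?Y) ?g"
      by (intro continuous_on_local_map continuous_on_subset[OF cont_E]) auto
    fix u assume "u \<in> p ` ?Y"
    then obtain x where x: "u = p x" "x \<in> ?Y" by blast
    have "nondegenerate_at \<A>p \<A>m c x (T x)"
      using nondeg by blast
    then have "det (mixed_hessian ?C (p x) (q (T x))) \<noteq> 0"
      using ch x(2) unfolding nondegenerate_at_def by blast
    then show "det (H (u, ?g u)) \<noteq> 0"
      using x mixed_hessian_eq[of "p x" "q (T x)"] by auto
    fix u' assume "u' \<in> p ` ?Y"
    then obtain y where y: "u' = p y" "y \<in> ?Y" by blast
    show "?C (u, ?g u) + ?C (u', ?g u') \<le> ?C (u, ?g u') + ?C (u', ?g u)"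
      using mono[of x y] x y by (simp add: local_cost_def)
  qed auto
  then have "AE x in volp. x \<in> U \<longrightarrow> (x \<in> ?Y \<longrightarrow> ?g differentiable (at (p x) within p ` ?Y))"
    by (intro X.AE_vol_if_negligible_p_image) (rule negligible_subset, auto)
  then show "AE x in volp. x \<in> U \<longrightarrow> T x \<in> V \<longrightarrow> (x \<in> ?E \<longrightarrow> (\<exists>J. has_jacobian_within \<A>p volp \<A>m volm T x ?E J))"
  proof (rule AE_mp, intro AE_I2 impI)
    fix x assume diff: "x \<in> U \<longrightarrow> (x \<in> ?Y \<longrightarrow> ?g differentiable (at (p x) within p ` ?Y))"
      and x: "x \<in> U" "T x \<in> V" "x \<in> ?E"
    then obtain L where L: "(?g has_derivative L) (at (p x) within p ` ?Y)"
      by (auto simp: differentiable_def)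
    then have M: "(?g has_derivative (*v) (matrix L)) (at (p x) within p ` ?Y)"
      by (rule has_derivative_matrix)
    have lim: "(T \<longlongrightarrow> T x) (at x within ?E)"
      using cont_E x(3) by (simp add: continuous_on_def)
    have "has_jacobian_within \<A>p volp \<A>m volm T x ?E (\<bar>det (matrix L)\<bar> * \<sigma> (q (T x)) / \<rho> (p x))"
      unfolding has_jacobian_within_def
    proof (intro conjI lim bexI[OF _ ch(1)] bexI[OF _ ch(2)], unfold case_prod_conv,
        intro bexI[OF _ ch(2)], unfold case_prod_conv, intro exI conjI)
      show "volume_density volp (U, p) \<rho>" "volume_density volm (V, q) \<sigma>"
        by fact+
    qed (use x M in auto)
    then show "\<exists>J. has_jacobian_within \<A>p volp \<A>m volm T x ?E J" ..
  qed
qed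

end

theorem proposition4p1:
  fixes \<A>p :: "('a::{t2_space, second_countable_topology}, 'n::finite) chart set"
    and \<A>m :: "('b::{t2_space, second_countable_topology}, 'n) chart set"
    and volp \<mu>p :: "'a measure" and volm \<mu>m :: "'b measure"
    and c :: "'a \<times> 'b \<Rightarrow> real" and \<gamma> :: "('a \<times> 'b) measure"
    and domT :: "'a set" and T :: "'a \<Rightarrow> 'b"
    and fp :: "'a \<Rightarrow> real" and fm :: "'b \<Rightarrow> real"
  assumes "smooth_atlas \<A>p" and "smooth_atlas \<A>m"
    and "smooth_volume \<A>p volp" and "smooth_volume \<A>m volm"
    and "borel_probability \<mu>p" and "borel_probability \<mu>m"
    and "C2_cost \<A>p \<A>m c"
    and "\<forall>x y. nondegenerate_at \<A>p \<A>m c x y"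
    and "kantorovich_optimizer \<mu>p \<mu>m c \<gamma>"
    and "AE x in volp. x \<in> domT"
    and "inj_on T domT" and "continuous_on domT T"
    and "AE z in \<gamma>. z \<in> {(x, T x) |x. x \<in> domT}"
    and "fp \<in> borel_measurable borel" and "AE x in volp. 0 \<le> fp x"
    and "\<mu>p = density volp (\<lambda>x. ennreal (fp x))"
    and "fm \<in> borel_measurable borel" and "AE y in volm. 0 \<le> fm y"
    and "\<mu>m = density volm (\<lambda>y. ennreal (fm y))"
  shows "AE x in volp.
    (\<forall>J. has_jacobian_within \<A>p volp \<A>m volm T x domT J \<longrightarrow> fp x = J * fm (T x)) \<and>
    (x \<in> measure_support \<mu>p \<longrightarrow>
      (\<exists>J. has_jacobian_within \<A>p volp \<A>m volm T x (domT \<inter> measure_support \<mu>p) J \<and>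
           fp x = J * fm (T x)))"
proof -
  have "coupling \<mu>p \<mu>m \<gamma>"
    using assms(9) by (simp add: kantorovich_optimizer_def)
  then interpret transport_map \<A>p \<A>m volp \<mu>p volm \<mu>m \<gamma> domT T fp fm
    using assms by unfold_locales
  \<comment> \<open>Without restriction the equation holds only for those Jacobians that happen to
    exist; relative to the support existence is available too, and the last two facts combine to the
    second claim.\<close>
  have "AE x in volp. x \<in> domT \<inter> UNIV \<longrightarrow>
      (\<forall>J. has_jacobian_within \<A>p volp \<A>m volm T x (domT \<inter> UNIV) J \<longrightarrow> fp x = J * fm (T x))"
    by (rule Jacobian_equation_AE) simp
  moreover have "AE x in volp. x \<in> domT \<inter> measure_support \<mu>p \<longrightarrow>
      (\<forall>J. has_jacobian_within \<A>p volp \<A>m volm T x (domT \<inter> measure_support \<mu>p) J \<longrightarrow> fp x = J * fm (T x))"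
    by (rule Jacobian_equation_AE[OF borel_closed[OF closed_measure_support]])
  moreover have "AE x in volp. x \<in> domT \<inter> measure_support \<mu>p \<longrightarrow>
      (\<exists>J. has_jacobian_within \<A>p volp \<A>m volm T x (domT \<inter> measure_support \<mu>p) J)"
    by (rule has_jacobian_within_support_AE[OF assms(7,8,9)])
  moreover note domT
  ultimately show ?thesis
  proof eventually_elim
    case (elim x)
    then show ?case
      unfolding Int_UNIV_right by blast
  qed
qed

end
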